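(* Let $\mathcal G$ be the digraph with vertices $x_0$, $x_4$ and $x^i_j$ for $i\in\mathbb Z/3\mathbb Z$, $1\le j\le 3$, and with arrows, for all $i\in\mathbb Z/3\mathbb Z$ and $j\in\{1,2\}$, $$x_0\to x_1^i,\quad x_3^i\to x_4,\quad x^i_j\to x^i_{j+1},\quad x^i_j\to x^{i+1}_{j+1},\quad x_1^i\to x_3^i,\quad x_1^i\to x_3^{i+2}.$$ Then the following statements hold: (1) The rational and mod-$2$ path Euler characteristics of $\mathcal G$ are not equal: $\chi^{\mathbb Q}(\mathcal G)\neq\chi^{\mathbb Z/2\mathbb Z}(\mathcal G)$. (2) There is no topological space $X$ such that there is an isomorphism of graded abelian groups $\mathrm{PH}_*(\mathcal G;\mathbb K)\cong H_*(X;\mathbb K)$ simultaneously for $\mathbb K=\mathbb Z$ and $\mathbb K=\mathbb Z/2\mathbb Z$. (3) There is no topological space $X$ with homology of finite type such that there is an isomorphism of graded vector spaces $\mathrm{PH}_*(\mathcal G;\mathbb F)\cong H_*(X;\mathbb F)$ simultaneously for $\mathbb F=\mathbb Q$ and $\mathbb F=\mathbb Z/2\mathbb Z$. (4) There is no chain complex of free abelian groups $C_\bullet$ with homology of finite type such that $\mathrm{PH}_*(\mathcal G;\mathbb F)\cong H_*(C_\bullet\otimes_{\mathbb Z}\mathbb F)$ simultaneously for $\mathbb F=\mathbb Q$ and $\mathbb F=\mathbb Z/2\mathbb Z$. (5) There exists $n$ such that there is no "universal coefficient" short exact sequence $$0\to \mathrm{PH}_n(\mathcal G;\mathbb Z)\otimes\mathbb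 Z/2\mathbb Z\to\mathrm{PH}_n(\mathcal G;\mathbb Z/2\mathbb Z)\to\mathrm{Tor}(\mathrm{PH}_{n-1}(\mathcal G;\mathbb Z),\mathbb Z/2\mathbb Z)\to 0.$$ (6) $\Omega^4(\mathcal G;\mathbb Z)$ has $2$-torsion.
   Context: A digraph $G$ consists of a finite set $V(G)$ of vertices and a set of arrows, which are ordered pairs of distinct vertices. An $n$-path is a sequence $(p_0,\dots,p_n)$ of vertices such that $(p_i,p_{i+1})$ is an arrow for $0\le i\le n-1$. Let $\mathbb K$ be a commutative ring. For $n\ge 0$ let $\mathcal R_n(G;\mathbb K)$ be the free $\mathbb K$-module with basis $e_{x_0,\dots,x_n}$ indexed by $(x_0,\dots,x_n)\in V(G)^{n+1}$ with $x_i\ne x_{i+1}$ for all $i$, with differential $\partial(e_{x_0,\dots,x_n})=\sum_{i=0}^n(-1)^i e_{x_0,\dots,\hat x_i,\dots,x_n}$, where symbols with two equal consecutive indices are $0$ (and $\mathcal R_n=0$ for $n<0$). Let $\mathcal A_n(G;\mathbb K)\subseteq\mathcal R_n(G;\mathbb K)$ be spanned by $e_p$ for $n$-paths $p$ of $G$. The path chain complex is $\Omega_n(G;\mathbb K)=\mathcal A_n(G;\mathbb K)\cap\partial^{-1}(\mathcal A_{n-1}(G;\mathbb K))$, with differential $\partial$, and the path homology is $\mathrm{PH}_*(G;\mathbb K)=H_*(\Omega_\bullet(G;\mathbb K))$. Dually, $\mathcal R^n(G;\mathbb K)$ is the free module with basis $e^{x_0,\dots,x_n}$ ($x_i\neq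 x_{i+1}$), with differential $\partial(e^{x_0,\dots,x_n})=\sum_{i=0}^{n+1}\sum_{v\in V(G)}(-1)^i e^{x_0,\dots,x_{i-1},v,x_i,\dots,x_n}$ (terms with equal consecutive indices cancel). Let $\mathcal N^n(G;\mathbb K)$ be spanned by those $e^{x_0,\dots,x_n}$ for which $(x_0,\dots,x_n)$ is not a path of $G$, and $\mathcal J^n=\mathcal N^n+\partial(\mathcal N^{n-1})$. Then $\Omega^n(G;\mathbb K)=\mathcal R^n(G;\mathbb K)/\mathcal J^n(G;\mathbb K)$. For a field $\mathbb F$, the path Euler characteristic is defined when $\mathrm{PH}_n(G;\mathbb F)=0$ for all but finitely many $n$, and then $\chi^{\mathbb F}(G)=\sum_n(-1)^n\dim_{\mathbb F}\mathrm{PH}_n(G;\mathbb F)$. (For $\mathcal G$ it is defined for every field, since $\mathcal G$ has no $n$-paths for $n\ge5$.) $H_*(X;\mathbb K)$ denotes singular homology. A space $X$ (resp. a chain complex $C_\bullet$ of free abelian groups) has homology of finite type if $H_n(X;\mathbb Z)$ (resp. $H_n(C_\bullet)$) is finitely generated for every $n$. An abelian group has $2$-torsion if it contains a nonzero element annihilated by $2$. *)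

theory Defs
  imports
    "HOL-Homology.Homology"
    "HOL-Library.Numeral_Type"
    "HOL-Library.Z2"
    "Graph_Theory.Pair_Digraph"
    "Jordan_Normal_Form.VS_Connect"
begin

text \<open>
  Coefficient rings are types of class \<open>comm_ring_1\<close>; the field with two elements is the type
  \<^typ>\<open>bit\<close>. Modules over such a ring are \<open>HOL-Algebra\<close> module records over
  \<^const>\<open>class_ring\<close>, whose ring fields \<open>mult\<close> and \<open>one\<close> carry no meaning.
  Abelian groups are modules over the type \<^typ>\<open>int\<close>. All gradings are by \<^typ>\<open>int\<close>.
\<close>

section \<open>Free modules, quotients, homology\<close>

definition poly_scale :: "'k::comm_ring_1 \<Rightarrow> ('b \<Rightarrow>\<^sub>0 'k) \<Rightarrow> ('b \<Rightarrow>\<^sub>0 'k)" where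
  "poly_scale r c = Poly_Mapping.map ((*) r) c"

definition free_module :: "'b set \<Rightarrow> ('k::comm_ring_1, 'b \<Rightarrow>\<^sub>0 'k) module" where
  "free_module S =
     \<lparr>carrier = {c. Poly_Mapping.keys c \<subseteq> S}, monoid.mult = undefined, one = undefined,
      zero = 0, add = (+), module.smult = poly_scale\<rparr>"

definition linear_extension ::
    "('b \<Rightarrow> ('c \<Rightarrow>\<^sub>0 'k)) \<Rightarrow> ('b \<Rightarrow>\<^sub>0 'k::comm_ring_1) \<Rightarrow> ('c \<Rightarrow>\<^sub>0 'k)" where
  "linear_extension g c = (\<Sum>x\<in>Poly_Mapping.keys c. poly_scale (Poly_Mapping.lookup c x) (g x))"

definition quotient_module :: "('k::comm_ring_1, 'a) module \<Rightarrow> 'a set \<Rightarrow> ('k, 'a set) module" where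
  "quotient_module M N =
     \<lparr>carrier = a_rcosets\<^bsub>M\<^esub> N, monoid.mult = undefined, one = undefined,
      zero = N, add = set_add M, module.smult = (\<lambda>r Y. N <+>\<^bsub>M\<^esub> ((\<lambda>x. r \<odot>\<^bsub>M\<^esub> x) ` Y))\<rparr>"

definition chain_complex ::
    "(int \<Rightarrow> ('k::comm_ring_1, 'a) module) \<Rightarrow> (int \<Rightarrow> 'a \<Rightarrow> 'a) \<Rightarrow> bool" where
  "chain_complex C d \<longleftrightarrow>
     (\<forall>n. Module.module class_ring (C n)) \<and>
     (\<forall>n. d n \<in> LinearCombinations.module_hom class_ring (C n) (C (n - 1))) \<and>
     (\<forall>n. \<forall>x \<in> carrier (C n). d (n - 1) (d n x) = \<zero>\<^bsub>C (n - 2)\<^esub>)"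

definition homology ::
    "(int \<Rightarrow> ('k::comm_ring_1, 'a) module) \<Rightarrow> (int \<Rightarrow> 'a \<Rightarrow> 'a) \<Rightarrow> int \<Rightarrow> ('k, 'a set) module" where
  "homology C d n =
     quotient_module ((C n)\<lparr>carrier := {z \<in> carrier (C n). d n z = \<zero>\<^bsub>C (n - 1)\<^esub>}\<rparr>)
                     (d (n + 1) ` carrier (C (n + 1)))"

definition graded_iso ::
    "(int \<Rightarrow> ('k::comm_ring_1, 'a) module) \<Rightarrow> (int \<Rightarrow> ('k, 'b) module) \<Rightarrow> bool" where
  "graded_iso M N \<longleftrightarrow>
     (\<forall>n. \<exists>f \<in> LinearCombinations.module_hom class_ring (M n) (N n).
        bij_betw f (carrier (M n)) (carrier (N n)))"

definition graded_group_iso ::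
    "(int \<Rightarrow> ('k, 'a) module) \<Rightarrow> (int \<Rightarrow> ('l, 'b) module) \<Rightarrow> bool" where
  "graded_group_iso M N \<longleftrightarrow> (\<forall>n. add_monoid (M n) \<cong> add_monoid (N n))"

definition finitely_generated_group :: "('k, 'a) module \<Rightarrow> bool" where
  "finitely_generated_group M \<longleftrightarrow>
     (\<exists>S. finite S \<and> S \<subseteq> carrier M \<and> generate (add_monoid M) S = carrier M)"

text \<open>The basis may be indexed by a set of elements of the group itself without loss of
  generality.\<close>

definition free_abelian :: "(int, 'a) module \<Rightarrow> bool" where
  "free_abelian M \<longleftrightarrow> (\<exists>B :: 'a set. add_monoid M \<cong> free_Abelian_group B)"

definition has_2_torsion :: "(int, 'a) module \<Rightarrow> bool" where
  "has_2_torsion M \<longleftrightarrow> (\<exists>x \<in> carrier M. x \<noteq> \<zero>\<^bsub>M\<^esub> \<and> 2 \<odot>\<^bsub>M\<^esub> x = \<zero>\<^bsub>M\<^esub>)"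


section \<open>Tensor products over the integers and Tor\<close>

text \<open>
  \<open>M \<otimes>\<^sub>\<int> N\<close> for an abelian group \<open>M\<close> and a \<open>\<bbbK>\<close>-module \<open>N\<close>, as a \<open>\<bbbK>\<close>-module: \<open>\<bbbK>\<close> acts through \<open>N\<close>.
  The record \<open>tensor_pre\<close> is the free abelian group on pairs; its scalar action becomes additive in
  the scalar only after dividing by the bilinearity relations.
\<close>

definition tensor_pre ::
    "(int, 'a) module \<Rightarrow> ('k::comm_ring_1, 'b) module \<Rightarrow> ('k, ('a \<times> 'b) \<Rightarrow>\<^sub>0 int) module" where
  "tensor_pre M N =
     \<lparr>carrier = {c. Poly_Mapping.keys c \<subseteq> carrier M \<times> carrier N}, monoid.mult = undefined, one = undefined,
      zero = 0, add = (+),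
      module.smult = (\<lambda>r. frag_extend (\<lambda>(m, y). frag_of (m, r \<odot>\<^bsub>N\<^esub> y)))\<rparr>"

definition tensor_rel ::
    "(int, 'a) module \<Rightarrow> ('k::comm_ring_1, 'b) module \<Rightarrow> (('a \<times> 'b) \<Rightarrow>\<^sub>0 int) set" where
  "tensor_rel M N = generate (add_monoid (tensor_pre M N))
     ({frag_of (m \<oplus>\<^bsub>M\<^esub> m', y) - frag_of (m, y) - frag_of (m', y) | m m' y.
         m \<in> carrier M \<and> m' \<in> carrier M \<and> y \<in> carrier N} \<union>
      {frag_of (m, y \<oplus>\<^bsub>N\<^esub> y') - frag_of (m, y) - frag_of (m, y') | m y y'.
         m \<in> carrier M \<and> y \<in> carrier N \<and> y' \<in> carrier N})"

definition tensor ::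
    "(int, 'a) module \<Rightarrow> ('k::comm_ring_1, 'b) module \<Rightarrow> ('k, (('a \<times> 'b) \<Rightarrow>\<^sub>0 int) set) module" where
  "tensor M N = quotient_module (tensor_pre M N) (tensor_rel M N)"

text \<open>\<open>f \<otimes> id\<^sub>N\<close> for a homomorphism \<open>f\<close> from some abelian group to \<open>M'\<close>.\<close>

definition tensor_map ::
    "(int, 'b) module \<Rightarrow> ('k::comm_ring_1, 'c) module \<Rightarrow> ('a \<Rightarrow> 'b) \<Rightarrow>
     (('a \<times> 'c) \<Rightarrow>\<^sub>0 int) set \<Rightarrow> (('b \<times> 'c) \<Rightarrow>\<^sub>0 int) set" where
  "tensor_map M' N f X =
     tensor_rel M' N <+>\<^bsub>tensor_pre M' N\<^esub> (frag_extend (\<lambda>(m, y). frag_of (f m, y)) ` X)"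

definition self_module :: "'k itself \<Rightarrow> ('k::comm_ring_1, 'k) module" where
  "self_module _ = \<lparr>carrier = UNIV, monoid.mult = (*), one = 1, zero = 0, add = (+), module.smult = (*)\<rparr>"

definition additive_group :: "'k itself \<Rightarrow> (int, 'k::comm_ring_1) module" where
  "additive_group _ =
     \<lparr>carrier = UNIV, monoid.mult = (*), one = 1, zero = 0, add = (+), module.smult = (\<lambda>n x. of_int n * x)\<rparr>"

text \<open>
  \<open>Tor(A, B)\<close> is the first homology of \<open>F \<otimes> B\<close> for the standard free resolution
  \<open>0 \<rightarrow> F\<^sub>1 \<rightarrow> F\<^sub>0 \<rightarrow> A \<rightarrow> 0\<close>, in which \<open>F\<^sub>0\<close> is free on the underlying set of \<open>A\<close>.
\<close>

definition Tor_F0 :: "(int, 'a) module \<Rightarrow> (int, 'a \<Rightarrow>\<^sub>0 int) module" where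
  "Tor_F0 A = free_module (carrier A)"

definition Tor_aug :: "(int, 'a) module \<Rightarrow> ('a \<Rightarrow>\<^sub>0 int) \<Rightarrow> 'a" where
  "Tor_aug A c = (\<Oplus>\<^bsub>A\<^esub>a\<in>Poly_Mapping.keys c. Poly_Mapping.lookup c a \<odot>\<^bsub>A\<^esub> a)"

definition Tor_F1 :: "(int, 'a) module \<Rightarrow> (int, 'a \<Rightarrow>\<^sub>0 int) module" where
  "Tor_F1 A = (Tor_F0 A)\<lparr>carrier := {c \<in> carrier (Tor_F0 A). Tor_aug A c = \<zero>\<^bsub>A\<^esub>}\<rparr>"

definition Tor ::
    "(int, 'a) module \<Rightarrow> (int, 'b) module \<Rightarrow> (int, ((('a \<Rightarrow>\<^sub>0 int) \<times> 'b) \<Rightarrow>\<^sub>0 int) set) module" where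
  "Tor A B = (tensor (Tor_F1 A) B)
     \<lparr>carrier := {t \<in> carrier (tensor (Tor_F1 A) B).
        tensor_map (Tor_F0 A) B (\<lambda>c. c) t = \<zero>\<^bsub>tensor (Tor_F0 A) B\<^esub>}\<rparr>"

definition short_exact_sequence_exists ::
    "('k, 'a) module \<Rightarrow> ('l, 'b) module \<Rightarrow> ('m, 'c) module \<Rightarrow> bool" where
  "short_exact_sequence_exists A B C \<longleftrightarrow>
     (\<exists>f g. f \<in> mon (add_monoid A) (add_monoid B) \<and> g \<in> epi (add_monoid B) (add_monoid C) \<and>
        f ` carrier A = kernel (add_monoid B) (add_monoid C) g)"


section \<open>Singular homology with coefficients\<close>

definition singular_chain_module ::
    "'a topology \<Rightarrow> int \<Rightarrow> ('k::comm_ring_1, ((nat \<Rightarrow> real) \<Rightarrow> 'a) \<Rightarrow>\<^sub>0 'k) module" where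
  "singular_chain_module X n = free_module (if n < 0 then {} else singular_simplex_set (nat n) X)"

definition singular_boundary ::
    "int \<Rightarrow> (((nat \<Rightarrow> real) \<Rightarrow> 'a) \<Rightarrow>\<^sub>0 'k::comm_ring_1) \<Rightarrow> (((nat \<Rightarrow> real) \<Rightarrow> 'a) \<Rightarrow>\<^sub>0 'k)" where
  "singular_boundary n =
     (if n \<le> 0 then (\<lambda>c. 0)
      else linear_extension
        (\<lambda>f. \<Sum>k\<le>nat n. Poly_Mapping.single (singular_face (nat n) k f) ((-1) ^ k)))"

definition singular_homology ::
    "'k itself \<Rightarrow> 'a topology \<Rightarrow> int \<Rightarrow>
     ('k::comm_ring_1, (((nat \<Rightarrow> real) \<Rightarrow> 'a) \<Rightarrow>\<^sub>0 'k) set) module" where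
  "singular_homology _ X n = homology (singular_chain_module X) singular_boundary n"


section \<open>Path homology of digraphs\<close>

text \<open>
  A digraph is a \<^typ>\<open>'v pair_pre_digraph\<close> satisfying \<^const>\<open>pair_digraph\<close> (finite, no loops).
  A sequence \<open>(x\<^sub>0, \<dots>, x\<^sub>n)\<close> is a list of length \<open>n + 1\<close>; there are none for \<open>n < 0\<close>, the empty
  list being excluded, so that the complexes vanish in negative degrees.
\<close>

definition regular_seqs :: "'v pair_pre_digraph \<Rightarrow> int \<Rightarrow> 'v list set" where
  "regular_seqs G n =
     {xs. xs \<noteq> [] \<and> int (length xs) = n + 1 \<and> set xs \<subseteq> pverts G \<and> distinct_adj xs}"

definition path_seqs :: "'v pair_pre_digraph \<Rightarrow> int \<Rightarrow> 'v list set" where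
  "path_seqs G n =
     {xs. xs \<noteq> [] \<and> int (length xs) = n + 1 \<and> set xs \<subseteq> pverts G \<and>
          successively (\<lambda>u v. (u, v) \<in> parcs G) xs}"

definition path_boundary :: "('v list \<Rightarrow>\<^sub>0 'k::comm_ring_1) \<Rightarrow> ('v list \<Rightarrow>\<^sub>0 'k)" where
  "path_boundary = linear_extension
     (\<lambda>xs. if length xs \<le> 1 then 0
           else \<Sum>i<length xs.
             (let ys = take i xs @ drop (Suc i) xs
              in if distinct_adj ys then Poly_Mapping.single ys ((-1) ^ i) else 0))"

definition path_chain_module ::
    "'v pair_pre_digraph \<Rightarrow> int \<Rightarrow> ('k::comm_ring_1, 'v list \<Rightarrow>\<^sub>0 'k) module" where
  "path_chain_module G n = (free_module (regular_seqs G n))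
     \<lparr>carrier := carrier (free_module (path_seqs G n)) \<inter>
        {c \<in> carrier (free_module (regular_seqs G n)).
           path_boundary c \<in> carrier (free_module (path_seqs G (n - 1)))}\<rparr>"

definition path_homology ::
    "'k itself \<Rightarrow> 'v pair_pre_digraph \<Rightarrow> int \<Rightarrow> ('k::comm_ring_1, ('v list \<Rightarrow>\<^sub>0 'k) set) module" where
  "path_homology _ G n = homology (path_chain_module G) (\<lambda>n. path_boundary) n"

definition path_homology_support :: "'f::field itself \<Rightarrow> 'v pair_pre_digraph \<Rightarrow> int set" where
  "path_homology_support F G =
     {n. carrier (path_homology F G n) \<noteq> {\<zero>\<^bsub>path_homology F G n\<^esub>}}"

definition path_euler_char_defined :: "'f::field itself \<Rightarrow> 'v pair_pre_digraph \<Rightarrow> bool" where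
  "path_euler_char_defined F G \<longleftrightarrow> finite (path_homology_support F G)"

definition path_euler_char :: "'f::field itself \<Rightarrow> 'v pair_pre_digraph \<Rightarrow> int" where
  "path_euler_char F G =
     (\<Sum>n\<in>path_homology_support F G.
        (-1) ^ nat n * int (vectorspace.dim class_ring (path_homology F G n)))"

text \<open>No condition is imposed on the terms of the sum over \<open>v\<close>: the lists with two equal
  consecutive entries occur in it in pairs of opposite sign.\<close>

definition path_coboundary ::
    "'v pair_pre_digraph \<Rightarrow> ('v list \<Rightarrow>\<^sub>0 'k::comm_ring_1) \<Rightarrow> ('v list \<Rightarrow>\<^sub>0 'k)" where
  "path_coboundary G = linear_extension
     (\<lambda>xs. \<Sum>i\<le>length xs. \<Sum>v\<in>pverts G.
        Poly_Mapping.single (take i xs @ v # drop i xs) ((-1) ^ i))"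

definition nonpath_module ::
    "'v pair_pre_digraph \<Rightarrow> int \<Rightarrow> ('k::comm_ring_1, 'v list \<Rightarrow>\<^sub>0 'k) module" where
  "nonpath_module G n = free_module (regular_seqs G n - path_seqs G n)"

definition path_cochain_ideal ::
    "'v pair_pre_digraph \<Rightarrow> int \<Rightarrow> ('v list \<Rightarrow>\<^sub>0 'k::comm_ring_1) set" where
  "path_cochain_ideal G n =
     carrier (nonpath_module G n)
     <+>\<^bsub>(free_module (regular_seqs G n) :: ('k, 'v list \<Rightarrow>\<^sub>0 'k) module)\<^esub>
     (path_coboundary G ` carrier (nonpath_module G (n - 1)))"

definition path_cochain_module ::
    "'k itself \<Rightarrow> 'v pair_pre_digraph \<Rightarrow> int \<Rightarrow> ('k::comm_ring_1, ('v list \<Rightarrow>\<^sub>0 'k) set) module" where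
  "path_cochain_module _ G n =
     quotient_module (free_module (regular_seqs G n)) (path_cochain_ideal G n)"


section \<open>The digraph\<close>

text \<open>The numeral type \<^typ>\<open>3\<close> is the ring of integers modulo 3.\<close>

datatype vertex = vx0 | vx4 | vx "3" nat

definition digraph_G :: "vertex pair_pre_digraph" where
  "digraph_G =
     \<lparr>pverts = {vx0, vx4} \<union> {vx i j | i j. 1 \<le> j \<and> j \<le> 3},
      parcs =
        (\<Union>i. {(vx0, vx i 1), (vx i 3, vx4), (vx i 1, vx i 3), (vx i 1, vx (i + 2) 3)}) \<union>
        (\<Union>i. \<Union>j\<in>{1, 2}. {(vx i j, vx i (j + 1)), (vx i j, vx (i + 1) (j + 1))})\<rparr>"

lemma pair_digraph_digraph_G: "pair_digraph digraph_G"
proof -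
  have "{vx i j | i j. 1 \<le> j \<and> j \<le> 3} = (\<lambda>(i, j). vx i j) ` (UNIV \<times> {1..3})"
    by auto
  then have fin: "finite (pverts digraph_G)"
    by (simp add: digraph_G_def)
  have vx: "vx i j \<in> pverts digraph_G" if "j = 1 \<or> j = 2 \<or> j = 3" for i j
    unfolding digraph_G_def using that by auto
  have v0: "vx0 \<in> pverts digraph_G" "vx4 \<in> pverts digraph_G"
    by (simp_all add: digraph_G_def)
  have arc: "fst e \<in> pverts digraph_G \<and> snd e \<in> pverts digraph_G \<and> fst e \<noteq> snd e"
    if "e \<in> parcs digraph_G" for e
  proof -
    from that have "e \<in>
        (\<Union>i. {(vx0, vx i 1), (vx i 3, vx4), (vx i 1, vx i 3), (vx i 1, vx (i + 2) 3)}) \<union>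
        (\<Union>i. \<Union>j\<in>{1, 2}. {(vx i j, vx i (j + 1)), (vx i j, vx (i + 1) (j + 1))})"
      (is "e \<in> ?A \<union> ?B") by (simp only: digraph_G_def pair_pre_digraph.simps)
    then show ?thesis
    proof (rule UnE)
      assume "e \<in> ?A"
      then show ?thesis
        by (elim UN_E insertE emptyE) (simp_all add: vx v0)
    next
      assume "e \<in> ?B"
      then show ?thesis
        by (elim UN_E insertE emptyE) (simp_all add: vx)
    qed
  qed
  then have "parcs digraph_G \<subseteq> pverts digraph_G \<times> pverts digraph_G"
    by (auto simp: mem_Times_iff)
  then have "finite (parcs digraph_G)"
    using fin by (meson finite_SigmaI finite_subset)
  with fin arc show ?thesis
    by unfold_locales blast+
qed


section \<open>Agreement with the library's integral singular homology\<close>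

lemma poly_scale_int_eq_frag_cmul: "poly_scale r c = frag_cmul r c"
  by (rule poly_mapping_eqI) (simp add: poly_scale_def Poly_Mapping.map.rep_eq when_def)

lemma singular_boundary_int: "singular_boundary (int p) c = chain_boundary p c"
proof (cases "p = 0")
  case False
  have "frag_cmul a (frag_of f) = Poly_Mapping.single f a" for a and f :: "(nat \<Rightarrow> real) \<Rightarrow> 'a"
    by (rule poly_mapping_eqI) (simp add: lookup_single when_def)
  with False show ?thesis
    by (simp add: singular_boundary_def chain_boundary_def linear_extension_def frag_extend_def
        poly_scale_int_eq_frag_cmul)
qed (simp add: singular_boundary_def chain_boundary_def)

lemma singular_homology_int:
  "\<lparr>carrier = carrier (singular_homology TYPE(int) X (int p)),
    monoid.mult = add (singular_homology TYPE(int) X (int p)),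
    one = zero (singular_homology TYPE(int) X (int p))\<rparr> = homology_group p X"
proof -
  have cyc: "{z \<in> carrier (singular_chain_module X (int p)).
        singular_boundary (int p) z = \<zero>\<^bsub>singular_chain_module X (int p - 1)\<^esub>}
      = singular_relcycle_set p X {}"
    by (auto simp: singular_chain_module_def free_module_def singular_boundary_int
        singular_cycle singular_chain_def)
  have "singular_boundary (int p + 1) ` carrier (singular_chain_module X (int p + 1))
      = (chain_boundary (Suc p) ` {c. singular_chain (Suc p) X c})"
    using singular_boundary_int[of "Suc p"]
    by (auto simp: singular_chain_module_def free_module_def singular_chain_def nat_add_distrib
        add.commute image_iff)
  also have "\<dots> = singular_relboundary_set p X {}"
    by (auto simp: singular_boundary)
  finally have bd: "singular_boundary (int p + 1) ` carrier (singular_chain_module X (int p + 1))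
      = singular_relboundary_set p X {}" .
  have "carrier (relcycle_group p X {}) = singular_relcycle_set p X {}"
    by simp
  then have rel: "relcycle_group p X {}
      = \<lparr>carrier = singular_relcycle_set p X {}, monoid.mult = (+), one = 0\<rparr>"
    by (metis mult_relcycle_group one_relcycle_group monoid.surjective old.unit.exhaust)
  show ?thesis
    unfolding singular_homology_def homology_def bd cyc
    by (simp add: nontrivial_relative_homology_group rel quotient_module_def FactGroup_def
        A_RCOSETS_def RCOSETS_def r_coset_def set_add_def set_mult_def
        singular_chain_module_def free_module_def fun_eq_iff)
qed

end

theory Submission
  imports Defs
begin

text \<open>
  Over every commutative ring \<open>K\<close> the path homology of \<open>\<G>\<close> is \<open>K\<close> in degree 0, \<open>K/2K\<close> in degree 2, and
  zero otherwise. The class of a 2-cycle \<open>c\<close> is read off from the quantity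
  \<open>c(x\<^sub>1\<^sup>i x\<^sub>2\<^sup>i x\<^sub>3\<^sup>i\<^sup>+\<^sup>1) + c(x\<^sub>1\<^sup>i x\<^sub>3\<^sup>i x\<^sub>4) - c(x\<^sub>0 x\<^sub>1\<^sup>i\<^sup>+\<^sup>1 x\<^sub>3\<^sup>i\<^sup>+\<^sup>1)\<close>: it does not depend on \<open>i\<close>, takes the value 1 on
  some cycle, and a cycle is a boundary iff its value lies in \<open>2K\<close>.
  Hence \<open>PH\<^sub>2(\<G>; \<int>) = \<int>/2\<close> although \<open>PH\<^sub>3(\<G>; \<int>/2) = 0\<close>. If a torsion-free complex \<open>C\<close> reduces
  onto \<open>E\<close> modulo 2, then \<open>H\<^sub>n\<^sub>+\<^sub>1(E) = 0\<close> rules out 2-torsion in \<open>H\<^sub>n(C)\<close>, which excludes the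
  integral models. For the models over \<open>\<rat>\<close> and \<open>\<int>/2\<close>, the homology in degrees 1 and 2 of \<open>C\<close> is finitely
  generated and torsion, hence of finite exponent; since \<open>H\<^sub>1(E) = H\<^sub>3(E) = 0\<close>, these exponents can be
  taken odd, which forces \<open>H\<^sub>2(E) = 0\<close>.

  In the quotient \<open>\<Omega>\<^sup>4\<close>, every forbidden face of a 4-path is a face of exactly two 4-paths, with equal signs,
  so it makes their classes opposite to each other. An odd cycle of such relations gives \<open>2e = 0\<close>, while the
  sum of all coefficients modulo 2 shows that \<open>e \<noteq> 0\<close>.
\<close>

subsection \<open>Boundaries of path chains\<close>

\<comment> \<open>The factor 2 has a geometric source. The twelve triples x1, x2, x3 that occur in
  4-paths are the triangles of a Moebius strip on the nine middle vertices. Its boundary hexagon is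
  formed by the arrows from level 1 to level 3; every other edge lies on two triangles, and the
  missing arrows x1 i -> x3 (i+1) are interior edges. Each triangle has one vertex on each level, so
  an orientation would amount to two classes of triangles with neighbours in different classes. A
  circle of nine triangles excludes this, and the same circle returns in degree 3 and in the
  cochains.

  The digraph is invariant under rotation of the index. Hence coefficients are computed at one
  symbolic index, and fillings are written down explicitly because they must work over every
  commutative ring at once.

  Doubling, reduction modulo 2 and the connecting map would form a long exact sequence. The three
  parts of it that are used are proved on elements, which asks only additivity of the reduced
  complex, so that singular chains and tensor products are handled by one argument.\<close>
alias lookup = Poly_Mapping.lookup
alias keys = Poly_Mapping.keys

lemma lookup_poly_scale [simp]: "lookup (poly_scale r c) x = r * lookup c x"
  by (simp add: poly_scale_def Poly_Mapping.map.rep_eq when_def)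

text \<open>Allowing any finite superset of the support as summation range makes the sums for
  several chains comparable term by term.\<close>

lemma lookup_linear_extension:
  assumes "finite S" "keys c \<subseteq> S"
  shows "lookup (linear_extension g c) y = (\<Sum>x\<in>S. lookup c x * lookup (g x) y)"
proof -
  have "lookup (linear_extension g c) y = (\<Sum>x\<in>keys c. lookup c x * lookup (g x) y)"
    by (simp add: linear_extension_def lookup_sum)
  also have "\<dots> = (\<Sum>x\<in>S. lookup c x * lookup (g x) y)"
    by (rule sum.mono_neutral_left) (use assms in \<open>auto simp: in_keys_iff\<close>)
  finally show ?thesis .
qed

lemma linear_extension_add: "linear_extension g (c + d) = linear_extension g c + linear_extension g d"
proof (rule poly_mapping_eqI)
  fix y
  let ?S = "keys c \<union> keys d"
  have "keys (c + d) \<subseteq> ?S" by (rule Poly_Mapping.keys_add)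
  then show "lookup (linear_extension g (c + d)) y = lookup (linear_extension g c + linear_extension g d) y"
    by (simp add: lookup_linear_extension[where S = ?S] lookup_add distrib_right sum.distrib)
qed

lemma keys_poly_scale: "keys (poly_scale r c) \<subseteq> keys c"
  by (auto simp: in_keys_iff)

lemma linear_extension_scale: "linear_extension g (poly_scale r c) = poly_scale r (linear_extension g c)"
proof (rule poly_mapping_eqI)
  fix y
  show "lookup (linear_extension g (poly_scale r c)) y = lookup (poly_scale r (linear_extension g c)) y"
    by (simp add: lookup_linear_extension[where S = "keys c"] keys_poly_scale
        sum_distrib_left mult.assoc)
qed

lemma linear_extension_zero [simp]: "linear_extension g 0 = 0"
  by (simp add: linear_extension_def)

lemma linear_extension_uminus: "linear_extension g (- c) = - linear_extension g c"
  using linear_extension_add[of g c "- c"] by (simp add: eq_neg_iff_add_eq_0 add.commute)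

lemma linear_extension_diff: "linear_extension g (c - d) = linear_extension g c - linear_extension g d"
  using linear_extension_add[of g c "- d"] by (simp add: linear_extension_uminus)

text \<open>The transpose of deletion: if \<open>f\<close> gives the coefficients of a chain, the
  value at \<open>ys\<close> is the coefficient of its boundary at \<open>ys\<close>, before
  irregular faces are discarded. The recursion unfolds on explicit lists; its minus sign accounts
  for all later positions being shifted by one.\<close>

primrec ins_sum :: "'v set \<Rightarrow> ('v list \<Rightarrow> 'k::comm_ring_1) \<Rightarrow> 'v list \<Rightarrow> 'k" where
  "ins_sum V f [] = (\<Sum>v\<in>V. f [v])"
| "ins_sum V f (y # ys) = (\<Sum>v\<in>V. f (v # y # ys)) - ins_sum V (\<lambda>zs. f (y # zs)) ys"

lemma ins_sum_eq:
  "ins_sum V f ys = (\<Sum>i\<le>length ys. (-1) ^ i * (\<Sum>v\<in>V. f (take i ys @ v # drop i ys)))"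
proof (induction ys arbitrary: f)
  case (Cons y ys)
  show ?case
    by (simp add: Cons.IH sum.atMost_Suc_shift sum_negf del: sum.atMost_Suc)
qed simp

lemma ins_sum_diff: "ins_sum V (\<lambda>zs. f zs - g zs) ys = ins_sum V f ys - ins_sum V g ys"
  by (induction ys arbitrary: f g) (simp_all add: sum_subtractf)

lemma ins_sum_sum: "ins_sum V (\<lambda>zs. \<Sum>w\<in>W. f w zs) ys = (\<Sum>w\<in>W. ins_sum V (f w) ys)"
proof (induction ys arbitrary: f)
  case Nil
  show ?case by (simp add: sum.swap[of _ W])
next
  case (Cons y ys)
  then show ?case by (simp add: sum_subtractf sum.swap[of _ W])
qed

text \<open>This is the identity d d = 0 for arbitrary functions on lists. Two insertions in front
  of the first entry cancel after exchanging the summation variables, one insertion in front and one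
  behind cancel against each other, and two insertions behind are the induction hypothesis.\<close>

lemma ins_sum_ins_sum: "ins_sum V (ins_sum V f) ys = 0"
proof (induction ys arbitrary: f)
  case Nil
  have "(\<Sum>v\<in>V. \<Sum>w\<in>V. f [w, v]) = (\<Sum>v\<in>V. \<Sum>w\<in>V. f [v, w])"
    by (rule sum.swap)
  then show ?case by (simp add: sum_subtractf)
next
  case (Cons y ys)
  have "ins_sum V (\<lambda>zs. ins_sum V f (y # zs)) ys = (\<Sum>v\<in>V. ins_sum V (\<lambda>zs. f (v # y # zs)) ys)"
    by (simp add: ins_sum_diff ins_sum_sum Cons.IH)
  moreover have "(\<Sum>v\<in>V. \<Sum>w\<in>V. f (w # v # y # ys)) = (\<Sum>v\<in>V. \<Sum>w\<in>V. f (v # w # y # ys))"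
    by (rule sum.swap)
  ultimately show ?case
    by (simp add: sum_subtractf)
qed

lemma ins_sum_cong:
  assumes "\<And>v i. v \<in> V \<Longrightarrow> i \<le> length ys \<Longrightarrow>
     f (take i ys @ v # drop i ys) = g (take i ys @ v # drop i ys)"
  shows "ins_sum V f ys = ins_sum V g ys"
  unfolding ins_sum_eq by (intro sum.cong arg_cong2[of _ _ _ _ "(*)"]) (use assms in auto)

abbreviation (input) delete_at :: "nat \<Rightarrow> 'v list \<Rightarrow> 'v list" where
  "delete_at i xs \<equiv> take i xs @ drop (Suc i) xs"

definition path_faces :: "'v list \<Rightarrow> ('v list \<Rightarrow>\<^sub>0 'k::comm_ring_1)" where
  "path_faces xs = (if length xs \<le> 1 then 0
           else \<Sum>i<length xs.
             (let ys = delete_at i xs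
              in if distinct_adj ys then Poly_Mapping.single ys ((-1) ^ i) else 0))"

lemma path_boundary_eq: "path_boundary = linear_extension path_faces"
  unfolding path_boundary_def path_faces_def ..

lemmas path_boundary_add = linear_extension_add[of path_faces, folded path_boundary_eq]
  and path_boundary_scale = linear_extension_scale[of path_faces, folded path_boundary_eq]
  and path_boundary_diff = linear_extension_diff[of path_faces, folded path_boundary_eq]
  and path_boundary_zero [simp] = linear_extension_zero[of path_faces, folded path_boundary_eq]

lemma keys_path_boundary:
  fixes c :: "'v list \<Rightarrow>\<^sub>0 'k::comm_ring_1"
  assumes "ys \<in> keys (path_boundary c)"
  shows "distinct_adj ys \<and> (\<exists>xs\<in>keys c. \<exists>i<length xs. length xs > 1 \<and> ys = delete_at i xs)"
proof -
  have "(\<Sum>x\<in>keys c. lookup c x * lookup (path_faces x) ys) \<noteq> 0"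
    using assms by (simp add: in_keys_iff path_boundary_eq lookup_linear_extension[where S = "keys c"])
  then obtain xs where xs: "xs \<in> keys c" "lookup (path_faces xs :: _ \<Rightarrow>\<^sub>0 'k) ys \<noteq> 0"
    by (metis (no_types, lifting) mult_not_zero sum.neutral)
  then have l: "length xs > 1" by (auto simp: path_faces_def split: if_splits)
  with xs(2) have "(\<Sum>i<length xs. lookup (let ys = delete_at i xs
              in if distinct_adj ys then Poly_Mapping.single ys ((-1) ^ i :: 'k) else 0) ys) \<noteq> 0"
    by (simp add: path_faces_def lookup_sum)
  then obtain i where "i < length xs" "lookup (let ys = delete_at i xs
              in if distinct_adj ys then Poly_Mapping.single ys ((-1) ^ i :: 'k) else 0) ys \<noteq> 0"
    by (metis (no_types, lifting) lessThan_iff sum.neutral)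
  with xs(1) l show ?thesis
    by (auto simp: Let_def lookup_single when_def split: if_splits)
qed

text \<open>Insertion undoes deletion at the same position, so the lists with a given
  \<open>i\<close>-th face are parametrised by the inserted vertex.\<close>

lemma delete_at_eq_iff:
  assumes "i < length xs"
  shows "delete_at i xs = ys \<longleftrightarrow> i \<le> length ys \<and> length xs = Suc (length ys) \<and> xs = take i ys @ xs ! i # drop i ys"
proof
  assume h: "delete_at i xs = ys"
  then have "take i ys = take i xs" "drop i ys = drop (Suc i) xs" "length xs = Suc (length ys)"
    using assms by auto
  then show "i \<le> length ys \<and> length xs = Suc (length ys) \<and> xs = take i ys @ xs ! i # drop i ys"
    using assms id_take_nth_drop[OF assms] by simp
next
  assume h: "i \<le> length ys \<and> length xs = Suc (length ys) \<and> xs = take i ys @ xs ! i # drop i ys"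
  have "delete_at i (take i ys @ x # drop i ys) = ys" if "i \<le> length ys" for x
    using that by simp
  moreover from h have "take i ys @ xs ! i # drop i ys = xs" by simp
  ultimately show "delete_at i xs = ys" using h by (metis (no_types))
qed

text \<open>Exchanging the sum over lists with the sum over positions leaves, for each position, a
  sum over the inserted vertex. The empty face is excluded because the boundary of a single vertex
  is zero by definition.\<close>

lemma lookup_path_boundary:
  assumes V: "finite V" and c: "keys c \<subseteq> {xs. set xs \<subseteq> V \<and> length xs = Suc (length ys)}"
    and ys: "ys \<noteq> []" "set ys \<subseteq> V"
  shows "lookup (path_boundary c) ys = (if distinct_adj ys then ins_sum V (lookup c) ys else 0)"
proof -
  let ?S = "{xs. set xs \<subseteq> V \<and> length xs = Suc (length ys)}"
  let ?n = "length ys"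
  have fin: "finite ?S" using finite_lists_length_eq[OF V] by simp
  have face: "lookup (path_faces xs) ys = (\<Sum>i\<le>?n. if delete_at i xs = ys \<and> distinct_adj ys then (-1) ^ i else 0)"
    if "xs \<in> ?S" for xs
    using that ys(1) unfolding path_faces_def
    by (auto simp: Let_def lookup_sum lookup_single when_def lessThan_Suc_atMost intro!: sum.cong)
  have "lookup (path_boundary c) ys = (\<Sum>xs\<in>?S. lookup c xs *
      (\<Sum>i\<le>?n. if delete_at i xs = ys \<and> distinct_adj ys then (-1) ^ i else 0))"
    unfolding path_boundary_eq lookup_linear_extension[OF fin c]
    by (intro sum.cong refl) (simp add: face)
  also have "\<dots> = (\<Sum>i\<le>?n. \<Sum>xs\<in>?S. if delete_at i xs = ys \<and> distinct_adj ys then (-1) ^ i * lookup c xs else 0)"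
    by (subst sum.swap) (simp add: sum_distrib_left if_distrib mult.commute cong: if_cong)
  also have "\<dots> = (if distinct_adj ys then ins_sum V (lookup c) ys else 0)"
  proof (cases "distinct_adj ys")
    case True
    have "(\<Sum>xs\<in>?S. if delete_at i xs = ys then (-1) ^ i * lookup c xs else 0)
        = (-1) ^ i * (\<Sum>v\<in>V. lookup c (take i ys @ v # drop i ys))" if i: "i \<le> ?n" for i
    proof -
      let ?h = "\<lambda>v. take i ys @ v # drop i ys"
      have inj: "inj_on ?h V" by (auto simp: inj_on_def)
      have "{xs \<in> ?S. delete_at i xs = ys} = ?h ` V"
      proof (intro subset_antisym subsetI)
        fix xs assume "xs \<in> {xs \<in> ?S. delete_at i xs = ys}"
        then have "set xs \<subseteq> V" "i < length xs" "delete_at i xs = ys" using i by auto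
        moreover from this have "xs = ?h (xs ! i)" using delete_at_eq_iff[of i xs ys] by blast
        moreover have "xs ! i \<in> V" using \<open>set xs \<subseteq> V\<close> \<open>i < length xs\<close> by auto
        ultimately show "xs \<in> ?h ` V" by blast
      next
        fix xs assume "xs \<in> ?h ` V"
        then obtain v where "v \<in> V" "xs = ?h v" by blast
        moreover have "set (take i ys) \<subseteq> V" "set (drop i ys) \<subseteq> V"
          using ys(2) set_take_subset[of i ys] set_drop_subset[of i ys] by auto
        ultimately show "xs \<in> {xs \<in> ?S. delete_at i xs = ys}"
          using i by simp
      qed
      moreover have "(\<Sum>xs\<in>?S. if delete_at i xs = ys then (-1) ^ i * lookup c xs else 0)
          = (\<Sum>xs\<in>{xs \<in> ?S. delete_at i xs = ys}. (-1) ^ i * lookup c xs)"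
        by (rule sum.inter_filter[OF fin, symmetric])
      ultimately show ?thesis
        by (simp only: sum.reindex[OF inj] sum_distrib_left o_def)
    qed
    then have "(\<Sum>i\<le>?n. \<Sum>xs\<in>?S. if delete_at i xs = ys then (-1) ^ i * lookup c xs else 0)
        = ins_sum V (lookup c) ys"
      unfolding ins_sum_eq by (intro sum.cong refl) simp
    then show ?thesis using True by (simp only: simp_thms if_True)
  qed simp
  finally show ?thesis .
qed

subsection \<open>Paths of the digraph\<close>

abbreviation x1 :: "3 \<Rightarrow> vertex" where "x1 i \<equiv> vx i (Suc 0)"
abbreviation x2 :: "3 \<Rightarrow> vertex" where "x2 i \<equiv> vx i 2"
abbreviation x3 :: "3 \<Rightarrow> vertex" where "x3 i \<equiv> vx i 3"

text \<open>Opaque constants, so that arithmetic simplification rules leave the indices alone.\<close>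

definition nx :: "3 \<Rightarrow> 3" where "nx i = i + 1"
definition pv :: "3 \<Rightarrow> 3" where "pv i = i + 2"

lemma nx_pv_simps [simp]:
  "nx (nx i) = pv i" "nx (pv i) = i" "pv (nx i) = i" "pv (pv i) = nx i"
  "nx i \<noteq> i" "i \<noteq> nx i" "pv i \<noteq> i" "i \<noteq> pv i" "nx i \<noteq> pv i" "pv i \<noteq> nx i"
  by (simp_all add: nx_def pv_def)

definition arr :: "vertex \<Rightarrow> vertex \<Rightarrow> bool" where
  "arr u v \<longleftrightarrow> (u, v) \<in> parcs digraph_G"

text \<open>From level 1 to level 3 the index \<open>nx i\<close> is the only one missing; the pairs
  x1 i, x3 (nx i) are the forbidden faces of this type.\<close>

lemma arr_simps [simp]:
  "\<not> arr u vx0" "\<not> arr vx4 v" "\<not> arr vx0 vx4"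
  "arr vx0 (vx i j) \<longleftrightarrow> j = 1"
  "arr (vx i j) vx4 \<longleftrightarrow> j = 3"
  "arr (vx i j) (vx k l) \<longleftrightarrow>
     (j = 1 \<and> l = 2 \<or> j = 2 \<and> l = 3) \<and> (k = i \<or> k = nx i) \<or> j = 1 \<and> l = 3 \<and> (k = i \<or> k = pv i)"
  by (auto simp: arr_def digraph_G_def nx_def pv_def)

text \<open>A height function: arrows raise it, so a path repeats no vertex and has at most five of
  them.\<close>

primrec level :: "vertex \<Rightarrow> nat" where
  "level vx0 = 0" | "level vx4 = 4" | "level (vx i j) = j"

lemma level_less: "arr u v \<Longrightarrow> level u < level v \<and> level v \<le> 4"
  by (cases u; cases v) auto

lemma arr_verts: "arr u v \<Longrightarrow> u \<in> pverts digraph_G \<and> v \<in> pverts digraph_G"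
  by (cases u; cases v) (auto simp: digraph_G_def)

lemma verts_mem [simp]: "vx0 \<in> pverts digraph_G" "vx4 \<in> pverts digraph_G"
  "vx i j \<in> pverts digraph_G \<longleftrightarrow> j = 1 \<or> j = 2 \<or> j = 3"
  by (auto simp: digraph_G_def)

lemma UNIV_3: "(UNIV :: 3 set) = {i, nx i, pv i}"
proof -
  have a: "(j :: 3) = 0 \<or> j = 1 \<or> j = 2" for j
  proof (cases j)
    case (of_int z)
    then have "z = 0 \<or> z = 1 \<or> z = 2" by auto
    with of_int show ?thesis by auto
  qed
  have "j - i = 0 \<or> j - i = 1 \<or> j - i = 2" for j using a[of "j - i"] .
  then show ?thesis by (auto simp: algebra_simps nx_def pv_def)
qed

lemma verts_eq: "pverts digraph_G =
  {vx0, vx4, x1 i, x1 (nx i), x1 (pv i), x2 i, x2 (nx i), x2 (pv i), x3 i, x3 (nx i), x3 (pv i)}"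
proof -
  have "j = i \<or> j = nx i \<or> j = pv i" for j
    using UNIV_3[of i] by blast
  then show ?thesis by (auto simp: digraph_G_def le_Suc_eq numeral_eq_Suc)
qed

lemma finite_verts [simp]: "finite (pverts digraph_G)"
  by (subst verts_eq[of 0]) simp

text \<open>The sum is centred at an arbitrary \<open>i\<close>, so coefficient equations can be
  evaluated at a symbolic index and rotation symmetry replaces a case distinction.\<close>

lemma sum_verts: "(\<Sum>v\<in>pverts digraph_G. f v) = f vx0 + f vx4
  + (f (x1 i) + f (x1 (nx i)) + f (x1 (pv i)))
  + (f (x2 i) + f (x2 (nx i)) + f (x2 (pv i)))
  + (f (x3 i) + f (x3 (nx i)) + f (x3 (pv i)))"
  for f :: "vertex \<Rightarrow> 'k::comm_ring_1"
  by (subst verts_eq[of i]) (simp add: ac_simps)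

definition paths :: "nat \<Rightarrow> vertex list set" where
  "paths n = path_seqs digraph_G (int n)"

lemma path_verts: "successively arr xs \<Longrightarrow> length xs > 1 \<Longrightarrow> set xs \<subseteq> pverts digraph_G"
proof (induction xs)
  case (Cons u ys)
  show ?case
  proof (cases "length ys > 1")
    case True
    then obtain v zs where "ys = v # zs" by (cases ys) auto
    with True Cons arr_verts[of u v] show ?thesis by simp
  next
    case False
    with Cons.prems obtain v where "ys = [v]" by (cases ys) auto
    with Cons arr_verts[of u v] show ?thesis by simp
  qed
qed simp

text \<open>In degree 0 there is no arrow to guarantee that the entry is a vertex, hence the
  positive degree.\<close>

lemma mem_paths: "n > 0 \<Longrightarrow> xs \<in> paths n \<longleftrightarrow> length xs = Suc n \<and> successively arr xs"
  using path_verts[of xs] by (auto simp: paths_def path_seqs_def arr_def[abs_def])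

lemma paths_sorted: "successively arr xs \<Longrightarrow> sorted_wrt (<) (map level xs)"
proof -
  assume "successively arr xs"
  then have "successively (\<lambda>u v. level u < level v) xs"
    by (rule successively_mono) (use level_less in auto)
  then show ?thesis
    by (simp add: sorted_wrt_map successively_conv_sorted_wrt transp_def)
qed

lemma paths_distinct: "xs \<in> paths n \<Longrightarrow> distinct xs"
  using paths_sorted[of xs]
  by (auto simp: paths_def path_seqs_def arr_def[abs_def] strict_sorted_iff distinct_map)

lemma paths_empty: "n \<ge> 5 \<Longrightarrow> paths n = {}"
proof (rule ccontr)
  assume n: "n \<ge> 5" and "paths n \<noteq> {}"
  then obtain xs where xs: "length xs = Suc n" "successively arr xs" using mem_paths[of n] by auto
  have "v \<in> pverts digraph_G \<Longrightarrow> level v \<le> 4" for v by (cases v) auto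
  then have "set (map level xs) \<subseteq> {..4}" using path_verts[OF xs(2)] xs(1) n by auto
  moreover have "distinct (map level xs)"
    using paths_sorted[OF xs(2)] strict_sorted_iff by blast
  ultimately have "length xs \<le> 5"
    using card_mono[of "{..4::nat}" "set (map level xs)"] distinct_card[of "map level xs"] by simp
  with xs n show False by simp
qed

lemma arr_source: "arr u v \<Longrightarrow> u = vx0 \<or> (\<exists>i. u = x1 i \<or> u = x2 i \<or> u = x3 i)"
  by (cases u; cases v) auto

lemma arr_target:
  "arr vx0 v \<longleftrightarrow> (\<exists>i. v = x1 i)"
  "arr (x1 i) v \<longleftrightarrow> v = x2 i \<or> v = x2 (nx i) \<or> v = x3 i \<or> v = x3 (pv i)"
  "arr (x2 i) v \<longleftrightarrow> v = x3 i \<or> v = x3 (nx i)"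
  "arr (x3 i) v \<longleftrightarrow> v = vx4"
  by (cases v; auto)+

text \<open>Together with its analogues in degrees 2, 3 and 4, this turns the verification of an
  explicit chain into a finite conjunction at one symbolic index.\<close>

lemma all_paths_1: "(\<forall>xs\<in>paths 1. Q xs) \<longleftrightarrow> (\<forall>i.
   Q [vx0, x1 i] \<and> Q [x1 i, x2 i] \<and> Q [x1 i, x2 (nx i)] \<and> Q [x2 i, x3 i] \<and> Q [x2 i, x3 (nx i)] \<and>
   Q [x1 i, x3 i] \<and> Q [x1 i, x3 (pv i)] \<and> Q [x3 i, vx4])"
proof (intro iffI ballI)
  fix xs assume Q: "\<forall>i.
   Q [vx0, x1 i] \<and> Q [x1 i, x2 i] \<and> Q [x1 i, x2 (nx i)] \<and> Q [x2 i, x3 i] \<and> Q [x2 i, x3 (nx i)] \<and>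
   Q [x1 i, x3 i] \<and> Q [x1 i, x3 (pv i)] \<and> Q [x3 i, vx4]" and xs: "xs \<in> paths 1"
  then have "length xs = 2" "successively arr xs" by (simp_all add: mem_paths)
  moreover from this obtain u v where "xs = [u, v]"
    by (auto simp: eval_nat_numeral length_Suc_conv)
  ultimately have xs: "xs = [u, v]" and uv: "arr u v" by auto
  show "Q xs"
    using arr_source[OF uv] uv unfolding xs by (elim disjE exE) (auto simp: arr_target Q simp del: arr_simps(4-6))
qed (auto simp: mem_paths)

lemma all_paths_2: "(\<forall>xs\<in>paths 2. Q xs) \<longleftrightarrow> (\<forall>i.
   Q [vx0, x1 i, x2 i] \<and> Q [vx0, x1 i, x2 (nx i)] \<and> Q [vx0, x1 i, x3 i] \<and> Q [vx0, x1 i, x3 (pv i)] \<and>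
   Q [x1 i, x2 i, x3 i] \<and> Q [x1 i, x2 i, x3 (nx i)] \<and>
   Q [x1 i, x2 (nx i), x3 (nx i)] \<and> Q [x1 i, x2 (nx i), x3 (pv i)] \<and>
   Q [x1 i, x3 i, vx4] \<and> Q [x1 i, x3 (pv i), vx4] \<and> Q [x2 i, x3 i, vx4] \<and> Q [x2 i, x3 (nx i), vx4])"
  (is "_ \<longleftrightarrow> ?R")
proof (intro iffI ballI)
  fix xs assume Q: ?R and xs: "xs \<in> paths 2"
  then have "length xs = 3" "successively arr xs" by (simp_all add: mem_paths)
  moreover from this obtain t u v where "xs = [t, u, v]"
    by (auto simp: eval_nat_numeral length_Suc_conv)
  ultimately have xs: "xs = [t, u, v]" and arr: "arr t u" "arr u v" by auto
  show "Q xs"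
    using arr_source[OF arr(1)] arr unfolding xs
    by (elim disjE exE) (auto simp: arr_target Q ac_simps simp del: arr_simps(4-6))
qed (auto simp: mem_paths)

lemma all_paths_3: "(\<forall>xs\<in>paths 3. Q xs) \<longleftrightarrow> (\<forall>i.
   Q [vx0, x1 i, x2 i, x3 i] \<and> Q [vx0, x1 i, x2 i, x3 (nx i)] \<and>
   Q [vx0, x1 i, x2 (nx i), x3 (nx i)] \<and> Q [vx0, x1 i, x2 (nx i), x3 (pv i)] \<and>
   Q [x1 i, x2 i, x3 i, vx4] \<and> Q [x1 i, x2 i, x3 (nx i), vx4] \<and>
   Q [x1 i, x2 (nx i), x3 (nx i), vx4] \<and> Q [x1 i, x2 (nx i), x3 (pv i), vx4] \<and>
   Q [vx0, x1 i, x3 i, vx4] \<and> Q [vx0, x1 i, x3 (pv i), vx4])"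
  (is "_ \<longleftrightarrow> ?R")
proof (intro iffI ballI)
  fix xs assume Q: ?R and xs: "xs \<in> paths 3"
  then have "length xs = 4" "successively arr xs" by (simp_all add: mem_paths)
  moreover from this obtain s t u v where "xs = [s, t, u, v]"
    by (auto simp: eval_nat_numeral length_Suc_conv)
  ultimately have xs: "xs = [s, t, u, v]" and arr: "arr s t" "arr t u" "arr u v" by auto
  show "Q xs"
    using arr_source[OF arr(1)] arr unfolding xs
    by (elim disjE exE) (auto simp: arr_target Q ac_simps simp del: arr_simps(4-6))
qed (auto simp: mem_paths)

lemma all_paths_4: "(\<forall>xs\<in>paths 4. Q xs) \<longleftrightarrow> (\<forall>i.
   Q [vx0, x1 i, x2 i, x3 i, vx4] \<and> Q [vx0, x1 i, x2 i, x3 (nx i), vx4] \<and>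
   Q [vx0, x1 i, x2 (nx i), x3 (nx i), vx4] \<and> Q [vx0, x1 i, x2 (nx i), x3 (pv i), vx4])"
  (is "_ \<longleftrightarrow> ?R")
proof (intro iffI ballI)
  fix xs assume Q: ?R and xs: "xs \<in> paths 4"
  then have "length xs = 5" "successively arr xs" by (simp_all add: mem_paths)
  moreover from this obtain s t u v w where "xs = [s, t, u, v, w]"
    by (auto simp: eval_nat_numeral length_Suc_conv)
  ultimately have xs: "xs = [s, t, u, v, w]" and arr: "arr s t" "arr t u" "arr u v" "arr v w" by auto
  show "Q xs"
    using arr_source[OF arr(1)] arr unfolding xs
    by (elim disjE exE) (auto simp: arr_target Q ac_simps simp del: arr_simps(4-6))
qed (auto simp: mem_paths)

section \<open>Explicit path chains and the comparison of their boundaries\<close>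

primrec deletions :: "'v list \<Rightarrow> 'v list list" where
  "deletions [] = []"
| "deletions (x # xs) = xs # map ((#) x) (deletions xs)"

lemma set_deletions: "set (deletions xs) = (\<lambda>i. delete_at i xs) ` {..<length xs}"
proof (induction xs)
  case (Cons x xs)
  have "{..<length (x # xs)} = insert 0 (Suc ` {..<length xs})"
    by (auto simp: less_Suc_eq_0_disj)
  then show ?case by (simp add: Cons image_image)
qed simp

lemma finite_paths: "finite (paths n)"
proof (rule finite_subset)
  show "paths n \<subseteq> {xs. set xs \<subseteq> pverts digraph_G \<and> length xs = Suc n}"
    by (auto simp: paths_def path_seqs_def)
qed (simp add: finite_lists_length_eq)

definition chain_on :: "'b set \<Rightarrow> ('b \<Rightarrow> 'k::zero) \<Rightarrow> ('b \<Rightarrow>\<^sub>0 'k)" where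
  "chain_on S f = Abs_poly_mapping (\<lambda>x. if x \<in> S then f x else 0)"

lemma lookup_chain_on: "finite S \<Longrightarrow> lookup (chain_on S f) x = (if x \<in> S then f x else 0)"
  unfolding chain_on_def
  by (subst Abs_poly_mapping_inverse) (auto intro: finite_subset[of _ S])

lemma keys_chain_on: "finite S \<Longrightarrow> keys (chain_on S f) \<subseteq> S"
  by (auto simp: in_keys_iff lookup_chain_on split: if_splits)

lemma lookup_path_chain:
  "n > 0 \<Longrightarrow> lookup (chain_on (paths n) f) xs = (if length xs = Suc n \<and> successively arr xs then f xs else 0)"
  by (simp add: lookup_chain_on finite_paths mem_paths)

lemma lookup_boundary_paths:
  assumes "keys c \<subseteq> paths (Suc n)" "length ys = Suc n" "set ys \<subseteq> pverts digraph_G"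
  shows "lookup (path_boundary c) ys = (if distinct_adj ys then ins_sum (pverts digraph_G) (lookup c) ys else 0)"
  by (rule lookup_path_boundary) (use assms in \<open>auto simp: paths_def path_seqs_def\<close>)

text \<open>A boundary is supported on the faces of the paths in \<open>b\<close>, and
  \<open>c\<close> on paths of one degree less. It is enough to compare coefficients on these two
  families, both of which can be enumerated.\<close>

lemma boundary_paths_eqI:
  assumes b: "keys b \<subseteq> paths (Suc n)" and c: "keys c \<subseteq> paths n"
    and 1: "\<forall>xs\<in>paths (Suc n). \<forall>ys\<in>set (deletions xs). ins_sum (pverts digraph_G) (lookup b) ys = lookup c ys"
    and 2: "\<forall>xs\<in>paths n. ins_sum (pverts digraph_G) (lookup b) xs = lookup c xs"
  shows "path_boundary b = c"
proof (rule poly_mapping_eqI)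
  fix ys
  have face: "lookup (path_boundary b) ys = lookup c ys"
    if "xs \<in> paths (Suc n)" "i < length xs" "ys = delete_at i xs" "distinct_adj ys" for xs i
  proof -
    have "length ys = Suc n" "set ys \<subseteq> pverts digraph_G"
      using that set_take_subset[of i xs] set_drop_subset[of "Suc i" xs] by (auto simp: paths_def path_seqs_def)
    moreover have "ys \<in> set (deletions xs)"
      using that(2,3) set_deletions by fastforce
    ultimately show ?thesis
      using 1 that(1,4) by (simp add: lookup_boundary_paths[OF b])
  qed
  show "lookup (path_boundary b) ys = lookup c ys"
  proof (cases "ys \<in> keys (path_boundary b)")
    case True
    with keys_path_boundary[OF True] b face show ?thesis by blast
  next
    case False
    show ?thesis
    proof (cases "ys \<in> paths n")
      case True
      then have "distinct_adj ys"
        using paths_distinct by (simp add: distinct_adj_conv_nth nth_eq_iff_index_eq)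
      moreover have "length ys = Suc n" "set ys \<subseteq> pverts digraph_G"
        using True by (auto simp: paths_def path_seqs_def)
      ultimately show ?thesis using 2 True by (simp add: lookup_boundary_paths[OF b])
    next
      assume "ys \<notin> paths n"
      with c False show ?thesis by (auto simp: in_keys_iff)
    qed
  qed
qed

lemma boundary_zero_coeff:
  assumes "path_boundary c = 0" "keys c \<subseteq> paths (Suc n)"
    "length ys = Suc n" "set ys \<subseteq> pverts digraph_G" "distinct_adj ys"
  shows "ins_sum (pverts digraph_G) (lookup c) ys = 0"
  using lookup_boundary_paths[OF assms(2-4)] assms(1,5) by simp

subsection \<open>Path cycles and their fillings\<close>

definition invariant2 :: "(vertex list \<Rightarrow>\<^sub>0 'k::comm_ring_1) \<Rightarrow> 'k" where
  "invariant2 c = lookup c [x1 0, x2 0, x3 (nx 0)] + lookup c [x1 0, x3 0, vx4] - lookup c [vx0, x1 (nx 0), x3 (nx 0)]"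

text \<open>Each relation is the vanishing of the boundary at one pair of vertices. In the first
  five the pair is not an arrow and arises from exactly two paths, by deleting the middle vertex.
  The other six are read off at the arrows from x1 to x3, from x1 to x2 and from x2 to x3.\<close>

lemma cycle2_relations:
  fixes c :: "vertex list \<Rightarrow>\<^sub>0 'k::comm_ring_1" and i :: 3
  assumes c: "keys c \<subseteq> paths 2" and cyc: "path_boundary c = 0"
  defines "C \<equiv> lookup c"
  shows "C [vx0, x1 (pv i), x2 i] = - C [vx0, x1 i, x2 i]"
    "C [vx0, x1 (nx i), x3 i] = - C [vx0, x1 i, x3 i]"
    "C [x1 i, x2 (nx i), x3 (nx i)] = - C [x1 i, x2 i, x3 (nx i)]"
    "C [x2 i, x3 (nx i), vx4] = - C [x2 i, x3 i, vx4]"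
    "C [x1 i, x3 (pv i), vx4] = - C [x1 i, x3 i, vx4]"
    "C [x1 i, x2 i, x3 i] = C [vx0, x1 i, x3 i] + C [x1 i, x3 i, vx4]"
    "C [x1 i, x2 (nx i), x3 (pv i)] = C [vx0, x1 i, x3 (pv i)] + C [x1 i, x3 (pv i), vx4]"
    "C [vx0, x1 i, x2 i] = - C [x1 i, x2 i, x3 i] - C [x1 i, x2 i, x3 (nx i)]"
    "C [vx0, x1 i, x2 (nx i)] = - C [x1 i, x2 (nx i), x3 (nx i)] - C [x1 i, x2 (nx i), x3 (pv i)]"
    "C [x2 i, x3 i, vx4] = - C [x1 i, x2 i, x3 i] - C [x1 (pv i), x2 i, x3 i]"
    "C [x2 i, x3 (nx i), vx4] = - C [x1 i, x2 i, x3 (nx i)] - C [x1 (pv i), x2 i, x3 (nx i)]"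
proof -
  have Z: "C xs = 0" if "\<not> (length xs = 3 \<and> successively arr xs)" for xs
    using c that by (auto simp: C_def in_keys_iff mem_paths)
  have rel: "ins_sum (pverts digraph_G) C ys = 0"
    if "length ys = 2" "set ys \<subseteq> pverts digraph_G" "distinct_adj ys" for ys
    using that c boundary_zero_coeff[OF cyc, of 1 ys] by (simp add: C_def numeral_2_eq_2)
  show "C [vx0, x1 (pv i), x2 i] = - C [vx0, x1 i, x2 i]"
    using rel[of "[vx0, x2 i]"] by (simp add: sum_verts[of _ i] Z eq_neg_iff_add_eq_0 ac_simps)
  show "C [vx0, x1 (nx i), x3 i] = - C [vx0, x1 i, x3 i]"
    using rel[of "[vx0, x3 i]"] by (simp add: sum_verts[of _ i] Z eq_neg_iff_add_eq_0 ac_simps)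
  show "C [x1 i, x2 (nx i), x3 (nx i)] = - C [x1 i, x2 i, x3 (nx i)]"
    using rel[of "[x1 i, x3 (nx i)]"] by (simp add: sum_verts[of _ i] Z eq_neg_iff_add_eq_0 ac_simps)
  show "C [x2 i, x3 (nx i), vx4] = - C [x2 i, x3 i, vx4]"
    using rel[of "[x2 i, vx4]"] by (simp add: sum_verts[of _ i] Z eq_neg_iff_add_eq_0 ac_simps)
  show "C [x1 i, x3 (pv i), vx4] = - C [x1 i, x3 i, vx4]"
    using rel[of "[x1 i, vx4]"] by (simp add: sum_verts[of _ i] Z eq_neg_iff_add_eq_0 ac_simps)
  show "C [x1 i, x2 i, x3 i] = C [vx0, x1 i, x3 i] + C [x1 i, x3 i, vx4]"
    using rel[of "[x1 i, x3 i]"] by (simp add: sum_verts[of _ i] Z algebra_simps)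
  show "C [x1 i, x2 (nx i), x3 (pv i)] = C [vx0, x1 i, x3 (pv i)] + C [x1 i, x3 (pv i), vx4]"
    using rel[of "[x1 i, x3 (pv i)]"] by (simp add: sum_verts[of _ i] Z algebra_simps)
  show "C [vx0, x1 i, x2 i] = - C [x1 i, x2 i, x3 i] - C [x1 i, x2 i, x3 (nx i)]"
    using rel[of "[x1 i, x2 i]"] by (simp add: sum_verts[of _ i] Z eq_neg_iff_add_eq_0 algebra_simps)
  show "C [vx0, x1 i, x2 (nx i)] = - C [x1 i, x2 (nx i), x3 (nx i)] - C [x1 i, x2 (nx i), x3 (pv i)]"
    using rel[of "[x1 i, x2 (nx i)]"] by (simp add: sum_verts[of _ i] Z eq_neg_iff_add_eq_0 algebra_simps)
  show "C [x2 i, x3 i, vx4] = - C [x1 i, x2 i, x3 i] - C [x1 (pv i), x2 i, x3 i]"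
    using rel[of "[x2 i, x3 i]"] by (simp add: sum_verts[of _ i] Z eq_neg_iff_add_eq_0 algebra_simps)
  show "C [x2 i, x3 (nx i), vx4] = - C [x1 i, x2 i, x3 (nx i)] - C [x1 (pv i), x2 i, x3 (nx i)]"
    using rel[of "[x2 i, x3 (nx i)]"] by (simp add: sum_verts[of _ i] Z eq_neg_iff_add_eq_0 algebra_simps)
qed


lemma all_Z3: "(\<And>i :: 3. P i \<Longrightarrow> P (pv i)) \<Longrightarrow> P 0 \<Longrightarrow> P i"
  using UNIV_3[of 0] by (metis UNIV_I empty_iff insert_iff nx_pv_simps(4))

text \<open>Passing from \<open>i\<close> to \<open>pv i\<close> turns around the vertex x2 i:
  through the forbidden pair x1 (pv i), x3 i, the arrow x2 i x3 i, the forbidden pair x2 i, x4 and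
  the arrow x2 i x3 (nx i). The last two terms of the formula absorb exactly what is picked up on
  the way.\<close>

lemma cycle2_invariant:
  fixes c :: "vertex list \<Rightarrow>\<^sub>0 'k::comm_ring_1"
  assumes c: "keys c \<subseteq> paths 2" and cyc: "path_boundary c = 0"
  shows "lookup c [x1 i, x2 i, x3 (nx i)]
    = invariant2 c - lookup c [x1 i, x3 i, vx4] + lookup c [vx0, x1 (nx i), x3 (nx i)]"
proof (rule all_Z3[where i = i])
  note R = cycle2_relations[OF c cyc]
  fix i
  assume IH: "lookup c [x1 i, x2 i, x3 (nx i)]
    = invariant2 c - lookup c [x1 i, x3 i, vx4] + lookup c [vx0, x1 (nx i), x3 (nx i)]"
  have "lookup c [x1 (pv i), x2 (pv i), x3 i] = - lookup c [x1 (pv i), x2 i, x3 i]"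
    using R(3)[of "pv i"] by simp
  also have "\<dots> = lookup c [x1 i, x2 i, x3 i] + lookup c [x2 i, x3 i, vx4]"
    using R(10)[of i] by simp
  also have "lookup c [x2 i, x3 i, vx4] = lookup c [x1 i, x2 i, x3 (nx i)] + lookup c [x1 (pv i), x2 i, x3 (nx i)]"
    using R(4)[of i] R(11)[of i] by (simp add: algebra_simps)
  also have "lookup c [x1 (pv i), x2 i, x3 (nx i)] =
      - lookup c [vx0, x1 (nx i), x3 (nx i)] - lookup c [x1 (pv i), x3 (pv i), vx4]"
    using R(7)[of "pv i"] R(2)[of "nx i"] R(5)[of "pv i"] by simp
  finally show "lookup c [x1 (pv i), x2 (pv i), x3 (nx (pv i))]
    = invariant2 c - lookup c [x1 (pv i), x3 (pv i), vx4] + lookup c [vx0, x1 (nx (pv i)), x3 (nx (pv i))]"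
    using IH R(6)[of i] by simp
next
  show "lookup c [x1 0, x2 0, x3 (nx 0)]
    = invariant2 c - lookup c [x1 0, x3 0, vx4] + lookup c [vx0, x1 (nx 0), x3 (nx 0)]"
    by (simp add: invariant2_def)
qed

lemma Suc_2_3: "Suc 2 = 3" by simp

lemma cycle2_boundary:
  fixes c :: "vertex list \<Rightarrow>\<^sub>0 'k::comm_ring_1"
  assumes c: "keys c \<subseteq> paths 2" and cyc: "path_boundary c = 0" and inv: "invariant2 c = d + d"
  shows "\<exists>b. keys b \<subseteq> paths 3 \<and> path_boundary b = c"
proof -
  \<comment> \<open>All twelve kinds of coefficients of \<open>c\<close> are now expressed by
    \<alpha>, \<beta> and \<open>d\<close>.\<close>
  define \<alpha> where "\<alpha> k = lookup c [vx0, x1 k, x3 k]" for k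
  define \<beta> where "\<beta> i = lookup c [x1 i, x3 i, vx4]" for i
  note R = cycle2_relations[OF c cyc]
  have v1: "lookup c [vx0, x1 i, x3 i] = \<alpha> i" "lookup c [x1 i, x3 i, vx4] = \<beta> i" for i
    by (simp_all add: \<alpha>_def \<beta>_def)
  have v2: "lookup c [vx0, x1 (nx i), x3 i] = - \<alpha> i" "lookup c [x1 i, x3 (pv i), vx4] = - \<beta> i" for i
    using R(2,5)[of i] v1 by auto
  have v2': "lookup c [vx0, x1 i, x3 (pv i)] = - \<alpha> (pv i)" for i
    using v2(1)[of "pv i"] by simp
  have v3: "lookup c [x1 i, x2 i, x3 i] = \<alpha> i + \<beta> i"
    "lookup c [x1 i, x2 (nx i), x3 (pv i)] = - \<alpha> (pv i) - \<beta> i" for i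
    using R(6,7)[of i] v1 v2 v2' by auto
  have v4: "lookup c [x1 i, x2 i, x3 (nx i)] = d + d - \<beta> i + \<alpha> (nx i)" for i
    using cycle2_invariant[OF c cyc, of i] by (simp add: inv v1)
  have v5: "lookup c [x1 i, x2 (nx i), x3 (nx i)] = - (d + d - \<beta> i + \<alpha> (nx i))" for i
    using R(3)[of i] v4 by simp
  have v5': "lookup c [x1 (pv i), x2 i, x3 i] = - (d + d - \<beta> (pv i) + \<alpha> i)" for i
    using v5[of "pv i"] by simp
  have v6: "lookup c [vx0, x1 i, x2 i] = - \<alpha> i - \<alpha> (nx i) - d - d"
    "lookup c [vx0, x1 i, x2 (nx i)] = \<alpha> (nx i) + \<alpha> (pv i) + d + d" for i
    using R(8,9)[of i] v3 v4 v5 by (auto simp: algebra_simps)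
  have v7: "lookup c [x2 i, x3 i, vx4] = d + d - \<beta> i - \<beta> (pv i)" for i
    using R(10)[of i] v3 v5' by (auto simp: algebra_simps)
  have v8: "lookup c [x2 i, x3 (nx i), vx4] = - (d + d - \<beta> i - \<beta> (pv i))" for i
    using R(4)[of i] v7[of i] by simp
  have v8': "lookup c [x2 (nx i), x3 (pv i), vx4] = - (d + d - \<beta> (nx i) - \<beta> i)"
    "lookup c [x2 (pv i), x3 i, vx4] = - (d + d - \<beta> (pv i) - \<beta> (nx i))" for i
    using v8[of "nx i"] v8[of "pv i"] by simp_all
  have Z: "lookup c xs = 0" if "\<not> (length xs = 3 \<and> successively arr xs)" for xs
    using c that by (auto simp: in_keys_iff mem_paths)
  \<comment> \<open>Within each of the three kinds of 3-paths the forbidden faces force alternating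
    signs. The magnitude may still depend on the last vertex x3 k for paths starting in x0 x1 x2,
    and on the first vertex x1 i for paths starting in x1. At x1 i, x2 i, x3 (nx i) the extensions
    by x0 and by x4 contribute one \<open>d\<close> each; this is why the invariant has to be
    \<open>d + d\<close>.\<close>
  define f where "f xs = (case xs of
      [vx0, vx i _, vx j _, vx k _] \<Rightarrow> if i = j then \<alpha> k + d else - \<alpha> k - d
    | [vx0, vx i _, vx k _, vx4] \<Rightarrow> if k = i then d else - d
    | [vx i _, vx j _, vx k _, vx4] \<Rightarrow> if j = k then d - \<beta> i else \<beta> i - d
    | _ \<Rightarrow> 0)" for xs
  define b where "b = chain_on (paths 3) f"
  have kb: "keys b \<subseteq> paths (Suc 2)"
    using keys_chain_on[OF finite_paths, of 3 f] by (simp add: b_def numeral_3_eq_3)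
  have B: "lookup b xs = (if length xs = 4 \<and> successively arr xs then f xs else 0)" for xs
    by (simp add: b_def lookup_path_chain)
  note V = v1 v2 v2' v3 v4 v5 v5' v6 v7 v8 v8' Z
  have "path_boundary b = c"
  proof (rule boundary_paths_eqI[OF kb c])
    show "\<forall>xs\<in>paths (Suc 2). \<forall>ys\<in>set (deletions xs). ins_sum (pverts digraph_G) (lookup b) ys = lookup c ys"
      unfolding Suc_2_3
    proof (rule all_paths_3[THEN iffD2], rule allI, goal_cases)
      case (1 i) show ?case by (simp add: sum_verts[of _ i] B V f_def algebra_simps)
    qed
    show "\<forall>xs\<in>paths 2. ins_sum (pverts digraph_G) (lookup b) xs = lookup c xs"
    proof (rule all_paths_2[THEN iffD2], rule allI, goal_cases)
      case (1 i) show ?case by (simp add: sum_verts[of _ i] B V f_def algebra_simps)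
    qed
  qed
  with kb show ?thesis by (auto simp: numeral_3_eq_3)
qed

lemma Suc_3_4: "Suc 3 = 4" by simp
lemma Suc_1_2: "Suc 1 = 2" by simp

text \<open>The three coefficients in the invariant expand into six coefficients of
  \<open>b\<close>. The forbidden faces identify these in pairs: two pairs cancel, and the third is
  twice the coefficient at x0, x1 0, x3 0, x4.\<close>

lemma invariant2_boundary:
  fixes b :: "vertex list \<Rightarrow>\<^sub>0 'k::comm_ring_1"
  assumes b: "keys b \<subseteq> paths 3" and bd: "keys (path_boundary b) \<subseteq> paths 2"
  shows "\<exists>d. invariant2 (path_boundary b) = d + d"
proof -
  define B where "B = lookup b"
  have Z: "B xs = 0" if "\<not> (length xs = 4 \<and> successively arr xs)" for xs
    using b that by (auto simp: B_def in_keys_iff mem_paths)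
  have coeff: "lookup (path_boundary b) ys = ins_sum (pverts digraph_G) B ys"
    if "length ys = 3" "set ys \<subseteq> pverts digraph_G" "distinct_adj ys" for ys
    using that lookup_boundary_paths[of b 2 ys] b by (simp add: B_def numeral_3_eq_3)
  have rel: "ins_sum (pverts digraph_G) B ys = 0"
    if "length ys = 3" "set ys \<subseteq> pverts digraph_G" "distinct_adj ys" "\<not> successively arr ys" for ys
  proof -
    have "ys \<notin> keys (path_boundary b)" using bd that(4) mem_paths[of 2 ys] by auto
    then show ?thesis using coeff[OF that(1-3)] by (simp add: in_keys_iff)
  qed
  have e1: "B [x1 0, x2 0, x3 (nx 0), vx4] = - B [x1 0, x2 0, x3 0, vx4]"
    using rel[of "[x1 0, x2 0, vx4]"] by (simp add: sum_verts[of _ 0] Z eq_neg_iff_add_eq_0 ac_simps)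
  have e2: "B [vx0, x1 0, x2 (nx 0), x3 (nx 0)] = - B [vx0, x1 0, x2 0, x3 (nx 0)]"
    using rel[of "[vx0, x1 0, x3 (nx 0)]"] by (simp add: sum_verts[of _ 0] Z eq_neg_iff_add_eq_0 ac_simps)
  have e3: "B [vx0, x1 0, x2 (nx 0), x3 (nx 0)] = - B [vx0, x1 (nx 0), x2 (nx 0), x3 (nx 0)]"
    using rel[of "[vx0, x2 (nx 0), x3 (nx 0)]"] by (simp add: sum_verts[of _ 0] Z neg_eq_iff_add_eq_0 eq_neg_iff_add_eq_0)
  have e4: "B [vx0, x1 (nx 0), x3 0, vx4] = - B [vx0, x1 0, x3 0, vx4]"
    using rel[of "[vx0, x3 0, vx4]"] by (simp add: sum_verts[of _ 0] Z eq_neg_iff_add_eq_0 ac_simps)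
  have e5: "B [vx0, x1 (nx 0), x3 0, vx4] = - B [vx0, x1 (nx 0), x3 (nx 0), vx4]"
    using rel[of "[vx0, x1 (nx 0), vx4]"] by (simp add: sum_verts[of _ 0] Z eq_neg_iff_add_eq_0 ac_simps)
  have e6: "B [vx0, x1 (nx 0), x2 (nx 0), x3 (nx 0)] = B [vx0, x1 0, x2 0, x3 (nx 0)]"
    using e2 e3 by (metis minus_minus)
  have e7: "B [vx0, x1 (nx 0), x3 (nx 0), vx4] = B [vx0, x1 0, x3 0, vx4]"
    using e4 e5 by (metis minus_minus)
  have "invariant2 (path_boundary b) = B [vx0, x1 0, x3 0, vx4] + B [vx0, x1 0, x3 0, vx4]"
    by (simp add: invariant2_def coeff sum_verts[of _ 0] Z e1 e6 e7)
  then show ?thesis by blast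
qed

lemma ex_cycle2_invariant_1:
  "\<exists>c :: vertex list \<Rightarrow>\<^sub>0 'k::comm_ring_1. keys c \<subseteq> paths 2 \<and> path_boundary c = 0 \<and> invariant2 c = 1"
proof -
  \<comment> \<open>These are the values found in \<open>cycle2_boundary\<close> for \<alpha> =
    \<beta> = 0, with 1 in place of \<open>d + d\<close>.\<close>
  define f :: "vertex list \<Rightarrow> 'k" where "f xs = (case xs of
      [vx0, vx i _, vx j m] \<Rightarrow> if m = 3 then 0 else if i = j then - 1 else 1
    | [vx i m, vx j _, vx4] \<Rightarrow> if m = 1 then 0 else if i = j then 1 else - 1
    | [vx i _, vx j _, vx k _] \<Rightarrow> if k = nx i then if i = j then 1 else - 1 else 0
    | _ \<Rightarrow> 0)" for xs
  define c where "c = chain_on (paths 2) f"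
  have kc: "keys c \<subseteq> paths (Suc 1)"
    unfolding Suc_1_2 c_def by (rule keys_chain_on[OF finite_paths])
  have C: "lookup c xs = (if length xs = 3 \<and> successively arr xs then f xs else 0)" for xs
    by (simp add: c_def lookup_path_chain)
  have "path_boundary c = 0"
  proof (rule boundary_paths_eqI[OF kc])
    show "\<forall>xs\<in>paths (Suc 1). \<forall>ys\<in>set (deletions xs).
        ins_sum (pverts digraph_G) (lookup c) ys = lookup 0 ys"
      unfolding Suc_1_2
    proof (rule all_paths_2[THEN iffD2], rule allI, goal_cases)
      case (1 i) show ?case by (simp add: sum_verts[of _ i] C f_def)
    qed
    show "\<forall>xs\<in>paths 1. ins_sum (pverts digraph_G) (lookup c) xs = lookup 0 xs"
    proof (rule all_paths_1[THEN iffD2], rule allI, goal_cases)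
      case (1 i) show ?case by (simp add: sum_verts[of _ i] C f_def)
    qed
  qed simp
  moreover have "invariant2 c = 1"
    by (simp add: invariant2_def C f_def)
  ultimately show ?thesis using kc unfolding Suc_1_2 by blast
qed

text \<open>Every 3-path is a face of exactly one 4-path and every forbidden face a face of exactly
  two. Since \<open>- d = d\<close>, the signs do not matter.\<close>

lemma boundary_const_4:
  fixes d :: "'k::comm_ring_1"
  assumes d: "d + d = 0"
  shows "path_boundary (chain_on (paths 4) (\<lambda>_. d)) = chain_on (paths 3) (\<lambda>_. d)"
proof -
  let ?b = "chain_on (paths 4) (\<lambda>_. d)" and ?c = "chain_on (paths 3) (\<lambda>_. d)"
  have kb: "keys ?b \<subseteq> paths (Suc 3)" and kc: "keys ?c \<subseteq> paths 3"
    unfolding Suc_3_4 by (rule keys_chain_on[OF finite_paths])+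
  have L: "lookup ?b xs = (if length xs = 5 \<and> successively arr xs then d else 0)"
    "lookup ?c xs = (if length xs = 4 \<and> successively arr xs then d else 0)" for xs
    by (simp_all add: lookup_path_chain)
  have d': "- d = d" "2 * d = 0" using d by (simp_all add: minus_unique)
  show ?thesis
  proof (rule boundary_paths_eqI[OF kb kc])
    show "\<forall>xs\<in>paths (Suc 3). \<forall>ys\<in>set (deletions xs).
        ins_sum (pverts digraph_G) (lookup ?b) ys = lookup ?c ys"
      unfolding Suc_3_4
    proof (rule all_paths_4[THEN iffD2], rule allI, goal_cases)
      case (1 i) show ?case by (simp add: sum_verts[of _ i] L d d')
    qed
    show "\<forall>xs\<in>paths 3. ins_sum (pverts digraph_G) (lookup ?b) xs = lookup ?c xs"
    proof (rule all_paths_3[THEN iffD2], rule allI, goal_cases)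
      case (1 i) show ?case by (simp add: sum_verts[of _ i] L d d')
    qed
  qed
qed

lemma cycle3_const:
  fixes c :: "vertex list \<Rightarrow>\<^sub>0 'k::comm_ring_1"
  assumes c: "keys c \<subseteq> paths 3" and cyc: "path_boundary c = 0"
  shows "\<exists>d. d + d = 0 \<and> c = chain_on (paths 3) (\<lambda>_. d)"
proof -
  define C where "C = lookup c"
  have Z: "C xs = 0" if "\<not> (length xs = 4 \<and> successively arr xs)" for xs
    using c that by (auto simp: C_def in_keys_iff mem_paths)
  have rel: "ins_sum (pverts digraph_G) C ys = 0"
    if "length ys = 3" "set ys \<subseteq> pverts digraph_G" "distinct_adj ys" for ys
    using that c boundary_zero_coeff[OF cyc, of 2 ys] by (simp add: C_def numeral_3_eq_3)
  have R1: "C [vx0, x1 i, x2 (nx i), x3 (nx i)] = - C [vx0, x1 i, x2 i, x3 (nx i)]" for i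
    using rel[of "[vx0, x1 i, x3 (nx i)]"] by (simp add: sum_verts[of _ i] Z eq_neg_iff_add_eq_0 ac_simps)
  have R2: "C [vx0, x1 i, x2 (nx i), x3 (pv i)] = - C [vx0, x1 i, x2 (nx i), x3 (nx i)]" for i
    using rel[of "[vx0, x1 i, x2 (nx i)]"] by (simp add: sum_verts[of _ i] Z eq_neg_iff_add_eq_0 ac_simps)
  have R3: "C [vx0, x1 (pv i), x2 i, x3 (nx i)] = - C [vx0, x1 i, x2 i, x3 (nx i)]" for i
    using rel[of "[vx0, x2 i, x3 (nx i)]"] by (simp add: sum_verts[of _ i] Z eq_neg_iff_add_eq_0 ac_simps)
  have R4: "C [vx0, x1 i, x2 i, x3 i] = - C [vx0, x1 i, x2 i, x3 (nx i)]" for i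
    using rel[of "[vx0, x1 i, x2 i]"] by (simp add: sum_verts[of _ i] Z neg_eq_iff_add_eq_0 eq_neg_iff_add_eq_0 ac_simps)
  define d where "d = C [vx0, x1 0, x2 0, x3 (nx 0)]"
  \<comment> \<open>Each of the three relations changes the sign once, so one step changes it three
    times and a full turn nine times. This odd number is the circle of nine triangles in the Moebius
    strip, and it yields \<open>d = - d\<close>.\<close>
  have step: "C [vx0, x1 (pv i), x2 (pv i), x3 i] = - C [vx0, x1 i, x2 i, x3 (nx i)]" for i
    using R1[of "pv i"] R2[of "pv i"] R3[of i] by simp
  have "d = - d"
    using step[of 0] step[of "pv 0", simplified] step[of "nx 0", simplified] unfolding d_def
    by (metis minus_minus)
  then have d: "- d = d" "d + d = 0" by (simp_all add: eq_neg_iff_add_eq_0)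
  have p: "C [vx0, x1 i, x2 i, x3 (nx i)] = d" for i
  proof (rule all_Z3[where i = i])
    fix i assume "C [vx0, x1 i, x2 i, x3 (nx i)] = d"
    then show "C [vx0, x1 (pv i), x2 (pv i), x3 (nx (pv i))] = d" using step[of i] d by simp
  qed (simp add: d_def)
  have u: "C [vx0, x1 i, x2 (nx i), x3 (nx i)] = d" "C [vx0, x1 i, x2 (nx i), x3 (pv i)] = d"
    "C [vx0, x1 i, x2 i, x3 i] = d" for i
    using R1[of i] R2[of i] R4[of i] by (simp_all add: p d)
  \<comment> \<open>The triple x1, x2, x3 is a face of two 3-paths, by prepending x0 with sign plus
    and by appending x4 with sign minus.\<close>
  have v: "C [x1 i, x2 j, x3 k, vx4] = C [vx0, x1 i, x2 j, x3 k]"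
    if "j = i \<or> j = nx i" "k = j \<or> k = nx j" for i j k
    using that rel[of "[x1 i, x2 j, x3 k]"] by (auto simp: sum_verts[of _ i] Z)
  have w: "C [vx0, x1 i, x3 i, vx4] = d" "C [vx0, x1 i, x3 (pv i), vx4] = d" for i
    using rel[of "[vx0, x1 i, x3 i]"] rel[of "[vx0, x1 i, x3 (pv i)]"] by (simp_all add: sum_verts[of _ i] Z u)
  have "\<forall>xs\<in>paths 3. C xs = d"
    by (subst all_paths_3) (simp add: u p v w)
  then have "c = chain_on (paths 3) (\<lambda>_. d)"
    by (intro poly_mapping_eqI) (use c in \<open>auto simp: lookup_chain_on finite_paths C_def in_keys_iff\<close>)
  with d show ?thesis by blast
qed

lemma cycle3_boundary:
  fixes c :: "vertex list \<Rightarrow>\<^sub>0 'k::comm_ring_1"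
  assumes "keys c \<subseteq> paths 3" and "path_boundary c = 0"
  shows "\<exists>b. keys b \<subseteq> paths 4 \<and> path_boundary b = c"
  using cycle3_const[OF assms] boundary_const_4 keys_chain_on[OF finite_paths] by blast

text \<open>A 4-path is the only one that contains its face without x0, so each coefficient is
  itself a coefficient of the boundary.\<close>

lemma cycle4_zero:
  fixes c :: "vertex list \<Rightarrow>\<^sub>0 'k::comm_ring_1"
  assumes c: "keys c \<subseteq> paths 4" and cyc: "path_boundary c = 0"
  shows "c = 0"
proof -
  define C where "C = lookup c"
  have Z: "C xs = 0" if "\<not> (length xs = 5 \<and> successively arr xs)" for xs
    using c that by (auto simp: C_def in_keys_iff mem_paths)
  have rel: "ins_sum (pverts digraph_G) C ys = 0"
    if "length ys = 4" "set ys \<subseteq> pverts digraph_G" "distinct_adj ys" for ys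
    using that c boundary_zero_coeff[OF cyc, of 3 ys] by (simp add: C_def)
  have "C [vx0, x1 i, x2 j, x3 k, vx4] = 0" if "j = i \<or> j = nx i" "k = j \<or> k = nx j" for i j k
    using that rel[of "[x1 i, x2 j, x3 k, vx4]"] by (auto simp: sum_verts[of _ i] Z)
  then have "\<forall>xs\<in>paths 4. C xs = 0"
    by (subst all_paths_4) simp
  then show ?thesis
    by (intro poly_mapping_eqI) (use c in \<open>auto simp: C_def in_keys_iff\<close>)
qed

section \<open>Degree 1\<close>

lemma cycle1_relations:
  fixes c :: "vertex list \<Rightarrow>\<^sub>0 'k::comm_ring_1" and i :: 3
  assumes c: "keys c \<subseteq> paths 1" and cyc: "path_boundary c = 0"
  defines "C \<equiv> lookup c"
  shows "C [vx0, x1 i] = C [x1 i, x2 i] + C [x1 i, x2 (nx i)] + C [x1 i, x3 i] + C [x1 i, x3 (pv i)]"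
    "C [x1 (pv i), x2 i] = C [x2 i, x3 i] + C [x2 i, x3 (nx i)] - C [x1 i, x2 i]"
    "C [x2 (pv i), x3 i] = C [x3 i, vx4] - C [x2 i, x3 i] - C [x1 i, x3 i] - C [x1 (nx i), x3 i]"
    "C [x3 i, vx4] + C [x3 (nx i), vx4] + C [x3 (pv i), vx4] = 0"
proof -
  have Z: "C xs = 0" if "\<not> (length xs = 2 \<and> successively arr xs)" for xs
    using c that by (auto simp: C_def in_keys_iff mem_paths)
  have rel: "ins_sum (pverts digraph_G) C [v] = 0" if "v \<in> pverts digraph_G" for v
    using that c boundary_zero_coeff[OF cyc, of 0 "[v]"] by (simp add: C_def)
  show "C [vx0, x1 i] = C [x1 i, x2 i] + C [x1 i, x2 (nx i)] + C [x1 i, x3 i] + C [x1 i, x3 (pv i)]"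
    using rel[of "x1 i"] by (simp add: sum_verts[of _ i] Z algebra_simps)
  show "C [x1 (pv i), x2 i] = C [x2 i, x3 i] + C [x2 i, x3 (nx i)] - C [x1 i, x2 i]"
    using rel[of "x2 i"] by (simp add: sum_verts[of _ i] Z algebra_simps)
  show "C [x2 (pv i), x3 i] = C [x3 i, vx4] - C [x2 i, x3 i] - C [x1 i, x3 i] - C [x1 (nx i), x3 i]"
    using rel[of "x3 i"] by (simp add: sum_verts[of _ i] Z algebra_simps)
  show "C [x3 i, vx4] + C [x3 (nx i), vx4] + C [x3 (pv i), vx4] = 0"
    using rel[of vx4] by (simp add: sum_verts[of _ i] Z algebra_simps)
qed

text \<open>Partial sums around the circle of indices; they close up because the total is zero.
  Applied to the coefficients at the arrows into x4, whose total is the boundary coefficient at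
  x4.\<close>

lemma ex_Z3_primitive:
  fixes t :: "3 \<Rightarrow> 'k::comm_ring_1"
  assumes "t 0 + t (nx 0) + t (pv 0) = 0"
  shows "\<exists>T. \<forall>i. t i = T i - T (pv i)"
proof -
  define T where "T i = (if i = 0 then 0 else if i = nx 0 then t (nx 0) else t (nx 0) + t (pv 0))" for i
  have T: "T 0 = 0" "T (nx 0) = t (nx 0)" "T (pv 0) = t (nx 0) + t (pv 0)"
    by (simp_all add: T_def)
  have "t 0 = - (t (nx 0) + t (pv 0))"
    using assms by (simp only: eq_neg_iff_add_eq_0 add.assoc)
  with T have eq: "t 0 = T 0 - T (pv 0)" "t (nx 0) = T (nx 0) - T (pv (nx 0))" "t (pv 0) = T (pv 0) - T (pv (pv 0))"
    by simp_all
  have "t i = T i - T (pv i)" for i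
  proof -
    have "i = 0 \<or> i = nx 0 \<or> i = pv 0" using UNIV_3[of 0] by blast
    then show ?thesis using eq by (elim disjE) simp_all
  qed
  then have "\<forall>i. t i = T i - T (pv i)" by blast
  then show ?thesis by (rule exI[of _ T])
qed

lemma cycle1_boundary:
  fixes c :: "vertex list \<Rightarrow>\<^sub>0 'k::comm_ring_1"
  assumes c: "keys c \<subseteq> paths 1" and cyc: "path_boundary c = 0"
  shows "\<exists>b. keys b \<subseteq> paths 2 \<and> path_boundary b = c"
proof -
  note R = cycle1_relations[OF c cyc]
  obtain T where T: "\<And>i. lookup c [x3 i, vx4] = T i - T (pv i)"
    using ex_Z3_primitive[of "\<lambda>i. lookup c [x3 i, vx4]"] R(4)[of 0] by blast
  define s where "s i = lookup c [x1 i, x3 i]" for i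
  define s' where "s' i = lookup c [x1 i, x3 (pv i)]" for i
  define q where "q i = lookup c [x1 i, x2 i]" for i
  define r where "r i = lookup c [x2 i, x3 i]" for i
  have v1: "lookup c [x1 i, x3 i] = s i" "lookup c [x1 i, x3 (pv i)] = s' i"
    "lookup c [x1 i, x2 i] = q i" "lookup c [x2 i, x3 i] = r i" for i
    by (simp_all add: s_def s'_def q_def r_def)
  have v2: "lookup c [x1 (nx i), x3 i] = s' (nx i)" for i
    using v1(2)[of "nx i"] by simp
  have v3: "lookup c [x2 (pv i), x3 i] = T i - T (pv i) - r i - s i - s' (nx i)" for i
    using R(3)[of i] by (simp add: T v1 v2)
  have v3': "lookup c [x2 i, x3 (nx i)] = T (nx i) - T i - r (nx i) - s (nx i) - s' (pv i)"
    "lookup c [x2 (nx i), x3 (pv i)] = T (pv i) - T (nx i) - r (pv i) - s (pv i) - s' i" for i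
    using v3[of "nx i"] v3[of "pv i"] by simp_all
  have v4: "lookup c [x1 (pv i), x2 i] = T (nx i) - T i + r i - r (nx i) - s (nx i) - s' (pv i) - q i" for i
    using R(2)[of i] by (simp add: v1 v3' algebra_simps)
  have v4': "lookup c [x1 i, x2 (nx i)] = T (pv i) - T (nx i) + r (nx i) - r (pv i) - s (pv i) - s' i - q (nx i)" for i
    using v4[of "nx i"] by simp
  have v5: "lookup c [vx0, x1 i] = q i - q (nx i) + T (pv i) - T (nx i) + r (nx i) - r (pv i) + s i - s (pv i)" for i
    using R(1)[of i] by (simp add: v1 v4' algebra_simps)
  have Z: "lookup c xs = 0" if "\<not> (length xs = 2 \<and> successively arr xs)" for xs
    using c that by (auto simp: in_keys_iff mem_paths)
  \<comment> \<open>Each value of the filling is read off at one arrow: T at x3 x4, s and s' at x1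
    x3, g at x2 i x3 i, and the values at x0 x1 x2 from the arrow x1 i x2 i. In particular g (pv i)
    = T i - s i - r i is forced. The alternating signs make the contributions cancel at pairs that
    are not arrows.\<close>
  define g where "g i = T (nx i) - s (nx i) - r (nx i)" for i
  define f where "f xs = (case xs of
      [vx0, vx i _, vx j m] \<Rightarrow>
        if m = 3 then 0 else if i = j then q j + s j - g j else g j - q j - s j
    | [vx j m, vx k _, vx4] \<Rightarrow> if m = 1 then 0 else if j = k then T j else - T j
    | [vx i _, vx j _, vx k _] \<Rightarrow>
        if k = nx i then if j = i then g i else - g i else if j = i then - s i else - s' i
    | _ \<Rightarrow> 0)" for xs
  define b where "b = chain_on (paths 2) f"
  have kb: "keys b \<subseteq> paths (Suc 1)"
    unfolding Suc_1_2 b_def by (rule keys_chain_on[OF finite_paths])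
  have B: "lookup b xs = (if length xs = 3 \<and> successively arr xs then f xs else 0)" for xs
    by (simp add: b_def lookup_path_chain)
  note V = T v1 v2 v3 v3' v4 v4' v5 Z
  have "path_boundary b = c"
  proof (rule boundary_paths_eqI[OF kb c])
    show "\<forall>xs\<in>paths (Suc 1). \<forall>ys\<in>set (deletions xs). ins_sum (pverts digraph_G) (lookup b) ys = lookup c ys"
      unfolding Suc_1_2
    proof (rule all_paths_2[THEN iffD2], rule allI, goal_cases)
      case (1 i) show ?case by (simp add: sum_verts[of _ i] B V f_def g_def algebra_simps)
    qed
    show "\<forall>xs\<in>paths 1. ins_sum (pverts digraph_G) (lookup b) xs = lookup c xs"
    proof (rule all_paths_1[THEN iffD2], rule allI, goal_cases)
      case (1 i) show ?case by (simp add: sum_verts[of _ i] B V f_def g_def algebra_simps)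
    qed
  qed
  with kb show ?thesis unfolding Suc_1_2 by blast
qed

section \<open>Degree 0\<close>

definition augmentation :: "(vertex list \<Rightarrow>\<^sub>0 'k::comm_ring_1) \<Rightarrow> 'k" where
  "augmentation c = (\<Sum>v\<in>pverts digraph_G. lookup c [v])"

lemma augmentation_boundary:
  assumes "keys b \<subseteq> paths 1"
  shows "augmentation (path_boundary b) = 0"
proof -
  have "lookup (path_boundary b) [v] = (\<Sum>w\<in>pverts digraph_G. lookup b [w, v]) - (\<Sum>w\<in>pverts digraph_G. lookup b [v, w])"
    if "v \<in> pverts digraph_G" for v
    using lookup_boundary_paths[of b 0 "[v]"] assms that by simp
  then have "augmentation (path_boundary b) = (\<Sum>v\<in>pverts digraph_G. \<Sum>w\<in>pverts digraph_G. lookup b [w, v])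
     - (\<Sum>v\<in>pverts digraph_G. \<Sum>w\<in>pverts digraph_G. lookup b [v, w])"
    by (simp add: augmentation_def sum_subtractf)
  moreover have "(\<Sum>v\<in>pverts digraph_G. \<Sum>w\<in>pverts digraph_G. lookup b [w, v])
      = (\<Sum>v\<in>pverts digraph_G. \<Sum>w\<in>pverts digraph_G. lookup b [v, w])"
    by (rule sum.swap)
  ultimately show ?thesis by (metis right_minus_eq)
qed

lemma all_paths_0: "(\<forall>xs\<in>paths 0. Q xs) \<longleftrightarrow> (\<forall>v\<in>pverts digraph_G. Q [v])"
  by (auto simp: paths_def path_seqs_def length_Suc_conv)

lemma augmentation_zero_boundary:
  fixes c :: "vertex list \<Rightarrow>\<^sub>0 'k::comm_ring_1"
  assumes c: "keys c \<subseteq> paths 0" and aug: "augmentation c = 0"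
  shows "\<exists>b. keys b \<subseteq> paths 1 \<and> path_boundary b = c"
proof -
  define h where "h i = lookup c [x3 i] + (if i = 0 then lookup c [vx4] else 0)" for i
  \<comment> \<open>A flow along the spanning tree rooted at x0 with edges x0 x1 i, x1 i x2 i, x1 i
    x3 i and x3 0 x4: each edge carries the total of \<open>c\<close> on the part of the tree beyond
    it.\<close>
  define f where "f xs = (case xs of
      [vx0, vx i _] \<Rightarrow> lookup c [x1 i] + lookup c [x2 i] + h i
    | [vx i _, vx4] \<Rightarrow> if i = 0 then lookup c [vx4] else 0
    | [vx i m, vx j l] \<Rightarrow> if m = 1 \<and> i = j then if l = 2 then lookup c [x2 i] else h i else 0
    | _ \<Rightarrow> 0)" for xs
  define b where "b = chain_on (paths 1) f"
  have kb: "keys b \<subseteq> paths (Suc 0)"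
    using keys_chain_on[OF finite_paths, of 1 f] by (simp add: b_def)
  have B: "lookup b xs = (if length xs = 2 \<and> successively arr xs then f xs else 0)" for xs
    by (simp add: b_def lookup_path_chain)
  have aug': "lookup c [vx0] = - lookup c [vx4]
     - (lookup c [x1 0] + lookup c [x1 (nx 0)] + lookup c [x1 (pv 0)])
     - (lookup c [x2 0] + lookup c [x2 (nx 0)] + lookup c [x2 (pv 0)])
     - (lookup c [x3 0] + lookup c [x3 (nx 0)] + lookup c [x3 (pv 0)])"
    using aug by (simp add: augmentation_def sum_verts[of _ 0] eq_neg_iff_add_eq_0 algebra_simps)
  have "ins_sum (pverts digraph_G) (lookup b) [v] = lookup c [v]" if "v \<in> pverts digraph_G" for v
  proof (cases v)
    case (vx i j)
    with that consider "v = x1 i" | "v = x2 i" | "v = x3 i" by auto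
    then show ?thesis by cases (simp_all add: sum_verts[of _ i] B f_def h_def algebra_simps)
  qed (simp_all add: sum_verts[of _ 0] B f_def h_def aug' algebra_simps)
  then have "path_boundary b = c"
    using all_paths_1[of "\<lambda>xs. \<forall>ys\<in>set (deletions xs). ins_sum (pverts digraph_G) (lookup b) ys = lookup c ys"]
    by (intro boundary_paths_eqI[OF kb c]) (simp_all add: all_paths_0)
  with kb show ?thesis by auto
qed

subsection \<open>Homology of complexes of modules\<close>

definition cycles :: "(int \<Rightarrow> ('k, 'a) module) \<Rightarrow> (int \<Rightarrow> 'a \<Rightarrow> 'a) \<Rightarrow> int \<Rightarrow> 'a set" where
  "cycles C d n = {z \<in> carrier (C n). d n z = \<zero>\<^bsub>C (n - 1)\<^esub>}"

definition boundaries :: "(int \<Rightarrow> ('k, 'a) module) \<Rightarrow> (int \<Rightarrow> 'a \<Rightarrow> 'a) \<Rightarrow> int \<Rightarrow> 'a set" where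
  "boundaries C d n = d (n + 1) ` carrier (C (n + 1))"

definition acyclic_at :: "(int \<Rightarrow> ('k, 'a) module) \<Rightarrow> (int \<Rightarrow> 'a \<Rightarrow> 'a) \<Rightarrow> int \<Rightarrow> bool" where
  "acyclic_at C d n \<longleftrightarrow> cycles C d n \<subseteq> boundaries C d n"

lemma homology_eq: "homology C d n = quotient_module ((C n)\<lparr>carrier := cycles C d n\<rparr>) (boundaries C d n)"
  by (simp add: homology_def cycles_def boundaries_def)

lemma quotient_module_simps [simp]:
  "carrier (quotient_module M N) = a_rcosets\<^bsub>M\<^esub> N"
  "zero (quotient_module M N) = N"
  "add (quotient_module M N) = set_add M"
  "module.smult (quotient_module M N) = (\<lambda>r Y. N <+>\<^bsub>M\<^esub> ((\<lambda>x. r \<odot>\<^bsub>M\<^esub> x) ` Y))"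
  by (simp_all add: quotient_module_def)

lemma carrier_homology: "carrier (homology C d n) =
  (\<lambda>z. (\<lambda>b. b \<oplus>\<^bsub>C n\<^esub> z) ` boundaries C d n) ` cycles C d n"
  by (auto simp: homology_eq A_RCOSETS_def' a_r_coset_def')

text \<open>The identity d d = 0 is left to \<open>differential_complex\<close>. Additivity suffices
  for the complexes with reduced or rational coefficients, so tensored complexes and singular chains
  over any ring are instances at once.\<close>

locale additive_complex =
  fixes C :: "int \<Rightarrow> ('k::comm_ring_1, 'a) module" and d :: "int \<Rightarrow> 'a \<Rightarrow> 'a"
  assumes abelian: "abelian_group (C n)"
    and hom: "d n \<in> hom (add_monoid (C n)) (add_monoid (C (n - 1)))"
begin

sublocale C: abelian_group "C n" for n by (rule abelian)

lemma d_closed [simp]: "x \<in> carrier (C n) \<Longrightarrow> d n x \<in> carrier (C (n - 1))"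
  using hom by (auto simp: hom_def)

lemma d_add [simp]: "x \<in> carrier (C n) \<Longrightarrow> y \<in> carrier (C n) \<Longrightarrow> d n (x \<oplus>\<^bsub>C n\<^esub> y) = d n x \<oplus>\<^bsub>C (n - 1)\<^esub> d n y"
  using hom by (auto simp: hom_def)

lemma group_hom_d: "group_hom (add_monoid (C n)) (add_monoid (C (n - 1))) (d n)"
  using hom by (intro group_hom.intro C.a_group group_hom_axioms.intro)

lemma d_zero [simp]: "d n \<zero>\<^bsub>C n\<^esub> = \<zero>\<^bsub>C (n - 1)\<^esub>"
  using group_hom.hom_one[OF group_hom_d] by simp

lemma d_minus [simp]: "x \<in> carrier (C n) \<Longrightarrow> d n (\<ominus>\<^bsub>C n\<^esub> x) = \<ominus>\<^bsub>C (n - 1)\<^esub> d n x"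
  using group_hom.hom_inv[OF group_hom_d] by (simp add: a_inv_def)

lemma subgroup_boundaries: "subgroup (boundaries C d n) (add_monoid (C n))"
  using group_hom.img_is_subgroup[OF group_hom_d[of "n + 1"]] by (simp add: boundaries_def)

lemma subgroup_cycles: "subgroup (cycles C d n) (add_monoid (C n))"
  using group_hom.subgroup_kernel[OF group_hom_d[of n]] by (simp add: cycles_def kernel_def)

lemma boundaries_closed:
  "x \<in> boundaries C d n \<Longrightarrow> x \<in> carrier (C n)"
  "\<zero>\<^bsub>C n\<^esub> \<in> boundaries C d n"
  "x \<in> boundaries C d n \<Longrightarrow> y \<in> boundaries C d n \<Longrightarrow> x \<oplus>\<^bsub>C n\<^esub> y \<in> boundaries C d n"
  "x \<in> boundaries C d n \<Longrightarrow> \<ominus>\<^bsub>C n\<^esub> x \<in> boundaries C d n"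
  "x \<in> boundaries C d n \<Longrightarrow> [k] \<cdot>\<^bsub>C n\<^esub> x \<in> boundaries C d n" for k :: nat
proof -
  interpret subgroup "boundaries C d n" "add_monoid (C n)" by (rule subgroup_boundaries)
  show "x \<in> boundaries C d n \<Longrightarrow> x \<in> carrier (C n)"
    "\<zero>\<^bsub>C n\<^esub> \<in> boundaries C d n"
    "x \<in> boundaries C d n \<Longrightarrow> y \<in> boundaries C d n \<Longrightarrow> x \<oplus>\<^bsub>C n\<^esub> y \<in> boundaries C d n"
    "x \<in> boundaries C d n \<Longrightarrow> \<ominus>\<^bsub>C n\<^esub> x \<in> boundaries C d n"
    using mem_carrier one_closed m_closed m_inv_closed by (auto simp: a_inv_def)
  then show "x \<in> boundaries C d n \<Longrightarrow> [k] \<cdot>\<^bsub>C n\<^esub> x \<in> boundaries C d n"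
    by (induction k) (simp_all add: add_pow_def nat_pow_def one_closed m_closed[simplified])
qed

lemma cycles_closed:
  "x \<in> cycles C d n \<Longrightarrow> x \<in> carrier (C n)"
  "\<zero>\<^bsub>C n\<^esub> \<in> cycles C d n"
  "x \<in> cycles C d n \<Longrightarrow> y \<in> cycles C d n \<Longrightarrow> x \<oplus>\<^bsub>C n\<^esub> y \<in> cycles C d n"
  "x \<in> cycles C d n \<Longrightarrow> \<ominus>\<^bsub>C n\<^esub> x \<in> cycles C d n"
  by (auto simp: cycles_def)

text \<open>Acyclicity is detected by the mere number of cosets, so any bijection between homology
  carriers transports it, whether it comes from a group isomorphism or from a linear one.\<close>

lemma acyclic_at_iff: "acyclic_at C d n \<longleftrightarrow> (\<exists>X. carrier (homology C d n) = {X})"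
proof
  assume ac: "acyclic_at C d n"
  have "(\<lambda>b. b \<oplus>\<^bsub>C n\<^esub> z) ` boundaries C d n = boundaries C d n" if "z \<in> cycles C d n" for z
  proof -
    have z: "z \<in> boundaries C d n" using that ac by (auto simp: acyclic_at_def)
    have "b \<in> (\<lambda>b. b \<oplus>\<^bsub>C n\<^esub> z) ` boundaries C d n" if "b \<in> boundaries C d n" for b
      using that z boundaries_closed
      by (intro image_eqI[of _ _ "b \<oplus>\<^bsub>C n\<^esub> (\<ominus>\<^bsub>C n\<^esub> z)"]) (auto simp: C.a_assoc C.l_neg)
    with z show ?thesis using boundaries_closed(3) by blast
  qed
  then have "carrier (homology C d n) = {boundaries C d n}"
    unfolding carrier_homology using cycles_closed(2)[of n] by auto
  then show "\<exists>X. carrier (homology C d n) = {X}" by blast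
next
  assume "\<exists>X. carrier (homology C d n) = {X}"
  then obtain X where X: "carrier (homology C d n) = {X}" by blast
  show "acyclic_at C d n"
    unfolding acyclic_at_def
  proof
    fix z assume z: "z \<in> cycles C d n"
    then have "(\<lambda>b. b \<oplus>\<^bsub>C n\<^esub> z) ` boundaries C d n = (\<lambda>b. b \<oplus>\<^bsub>C n\<^esub> \<zero>\<^bsub>C n\<^esub>) ` boundaries C d n"
      using X cycles_closed(2)[of n] unfolding carrier_homology by (metis image_eqI singletonD)
    moreover have "z \<in> (\<lambda>b. b \<oplus>\<^bsub>C n\<^esub> z) ` boundaries C d n"
      using z boundaries_closed(2)[of n] cycles_closed(1)[OF z] by (intro image_eqI[of _ _ "\<zero>\<^bsub>C n\<^esub>"]) auto
    ultimately show "z \<in> boundaries C d n" using boundaries_closed(1) by auto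
  qed
qed

end

lemma additive_complex_chain_complex: "chain_complex C d \<Longrightarrow> additive_complex C d"
  unfolding chain_complex_def
  by (rule additive_complex.intro) (auto simp: module_def module_hom_def hom_def)

lemma bij_betw_singleton: assumes f: "bij_betw f A B" shows "(\<exists>x. A = {x}) \<longleftrightarrow> (\<exists>y. B = {y})"
proof
  assume "\<exists>x. A = {x}"
  then show "\<exists>y. B = {y}" using f by (auto simp: bij_betw_def)
next
  assume "\<exists>y. B = {y}"
  then obtain y where "B = {y}" by blast
  then have "the_inv_into A f ` {y} = A"
    using bij_betw_the_inv_into[OF f] by (simp add: bij_betw_def)
  then show "\<exists>x. A = {x}" by auto
qed

lemma acyclic_at_cong_iso:
  assumes "additive_complex C d" "additive_complex E e"
    and "bij_betw f (carrier (homology C d n)) (carrier (homology E e n))"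
  shows "acyclic_at C d n \<longleftrightarrow> acyclic_at E e n"
  using bij_betw_singleton[OF assms(3)] additive_complex.acyclic_at_iff[OF assms(1)]
    additive_complex.acyclic_at_iff[OF assms(2)] by simp


section \<open>Quotients of abelian groups and of modules\<close>

locale abelian_quotient = M: abelian_group M for M :: "('k::comm_ring_1, 'a) module" +
  fixes N :: "'a set"
  assumes N: "subgroup N (add_monoid M)"
begin

sublocale N: abelian_subgroup N M
  by (intro abelian_subgroupI2 M.a_comm_group N)

lemma quotient_cosets: "X \<in> carrier (quotient_module M N) \<longleftrightarrow> (\<exists>x\<in>carrier M. X = N +>\<^bsub>M\<^esub> x)"
  by (auto simp: A_RCOSETS_def')

lemma quotient_closed: "x \<in> carrier M \<Longrightarrow> N +>\<^bsub>M\<^esub> x \<in> carrier (quotient_module M N)"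
  unfolding quotient_cosets by blast

lemma quotient_add:
  "x \<in> carrier M \<Longrightarrow> y \<in> carrier M \<Longrightarrow>
   (N +>\<^bsub>M\<^esub> x) \<oplus>\<^bsub>quotient_module M N\<^esub> (N +>\<^bsub>M\<^esub> y) = N +>\<^bsub>M\<^esub> (x \<oplus>\<^bsub>M\<^esub> y)"
  using N.a_rcos_sum by simp

lemma quotient_zero: "\<zero>\<^bsub>quotient_module M N\<^esub> = N +>\<^bsub>M\<^esub> \<zero>\<^bsub>M\<^esub>"
  using M.a_coset_add_zero[OF N.a_subset] by simp

lemma coset_zero_iff:
  assumes "x \<in> carrier M"
  shows "N +>\<^bsub>M\<^esub> x = \<zero>\<^bsub>quotient_module M N\<^esub> \<longleftrightarrow> x \<in> N"
proof
  assume "N +>\<^bsub>M\<^esub> x = \<zero>\<^bsub>quotient_module M N\<^esub>"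
  then show "x \<in> N" using N.a_rcos_self[OF assms] by simp
next
  assume "x \<in> N"
  then show "N +>\<^bsub>M\<^esub> x = \<zero>\<^bsub>quotient_module M N\<^esub>" using N.a_rcos_const by simp
qed

lemma abelian_group_quotient: "abelian_group (quotient_module M N)"
proof (rule abelian_groupI)
  let ?Q = "quotient_module M N"
  fix X Y Z assume X: "X \<in> carrier ?Q" and Y: "Y \<in> carrier ?Q"
  obtain x where x: "x \<in> carrier M" "X = N +>\<^bsub>M\<^esub> x" using X unfolding quotient_cosets by blast
  obtain y where y: "y \<in> carrier M" "Y = N +>\<^bsub>M\<^esub> y" using Y unfolding quotient_cosets by blast
  show "X \<oplus>\<^bsub>?Q\<^esub> Y \<in> carrier ?Q"
    unfolding x(2) y(2) quotient_add[OF x(1) y(1)] by (intro quotient_closed M.a_closed x y)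
  show "X \<oplus>\<^bsub>?Q\<^esub> Y = Y \<oplus>\<^bsub>?Q\<^esub> X"
    unfolding x(2) y(2) quotient_add[OF x(1) y(1)] quotient_add[OF y(1) x(1)]
    using M.a_comm[OF x(1) y(1)] by simp
  show "\<zero>\<^bsub>?Q\<^esub> \<oplus>\<^bsub>?Q\<^esub> X = X"
    unfolding x(2) quotient_zero quotient_add[OF M.zero_closed x(1)] using x(1) by simp
  show "\<exists>X'\<in>carrier ?Q. X' \<oplus>\<^bsub>?Q\<^esub> X = \<zero>\<^bsub>?Q\<^esub>"
    unfolding quotient_zero x(2)
    by (rule bexI[OF _ quotient_closed[OF M.a_inv_closed[OF x(1)]]])
      (use x(1) in \<open>simp only: quotient_add M.a_inv_closed M.l_neg\<close>)
  assume Z: "Z \<in> carrier ?Q"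
  obtain z where z: "z \<in> carrier M" "Z = N +>\<^bsub>M\<^esub> z" using Z unfolding quotient_cosets by blast
  show "X \<oplus>\<^bsub>?Q\<^esub> Y \<oplus>\<^bsub>?Q\<^esub> Z = X \<oplus>\<^bsub>?Q\<^esub> (Y \<oplus>\<^bsub>?Q\<^esub> Z)"
    unfolding x(2) y(2) z(2) quotient_add[OF x(1) y(1)] quotient_add[OF y(1) z(1)]
      quotient_add[OF M.a_closed[OF x(1) y(1)] z(1)] quotient_add[OF x(1) M.a_closed[OF y(1) z(1)]]
    using x(1) y(1) z(1) by (simp add: M.a_assoc)
qed (simp_all only: quotient_zero quotient_closed M.zero_closed)

lemma quotient_pow:
  fixes k :: nat
  assumes "x \<in> carrier M"
  shows "[k] \<cdot>\<^bsub>quotient_module M N\<^esub> (N +>\<^bsub>M\<^esub> x) = N +>\<^bsub>M\<^esub> ([k] \<cdot>\<^bsub>M\<^esub> x)"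
proof -
  have "(\<lambda>x. N +>\<^bsub>M\<^esub> x) \<in> hom (add_monoid M) (add_monoid (quotient_module M N))"
    using quotient_closed quotient_add by (auto simp: hom_def simp del: quotient_module_simps)
  then interpret h: group_hom "add_monoid M" "add_monoid (quotient_module M N)" "\<lambda>x. N +>\<^bsub>M\<^esub> x"
    by (intro group_hom.intro M.a_group abelian_group.a_group abelian_group_quotient group_hom_axioms.intro)
  show ?thesis using h.hom_nat_pow[of x k] assms by (simp add: add_pow_def)
qed

end

text \<open>The scalar action on a coset adds \<open>N\<close> to the pointwise multiple, since the
  multiple alone may be smaller than a coset. The module laws follow once the action is known on
  representatives.\<close>

lemma module_quotient:
  fixes M :: "('k::comm_ring_1, 'a) module"
  assumes M: "Module.module class_ring M" and N: "subgroup N (add_monoid M)"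
    and smult: "\<And>r x. x \<in> N \<Longrightarrow> r \<odot>\<^bsub>M\<^esub> x \<in> N"
  shows "Module.module class_ring (quotient_module M N)"
proof -
  interpret M: module class_ring M by (rule M)
  interpret Q: abelian_quotient M N
    by (intro abelian_quotient.intro M.abelian_group_axioms abelian_quotient_axioms.intro N)
  let ?Q = "quotient_module M N"
  have sm: "r \<odot>\<^bsub>?Q\<^esub> (N +>\<^bsub>M\<^esub> x) = N +>\<^bsub>M\<^esub> (r \<odot>\<^bsub>M\<^esub> x)" if x: "x \<in> carrier M" for r x
  proof -
    have "r \<odot>\<^bsub>?Q\<^esub> (N +>\<^bsub>M\<^esub> x) = (\<Union>n\<in>N. \<Union>n'\<in>N. {n \<oplus>\<^bsub>M\<^esub> r \<odot>\<^bsub>M\<^esub> (n' \<oplus>\<^bsub>M\<^esub> x)})"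
      by (auto simp: set_add_def' a_r_coset_def')
    also have "\<dots> = (\<Union>n\<in>N. {n \<oplus>\<^bsub>M\<^esub> r \<odot>\<^bsub>M\<^esub> x})"
    proof (intro subset_antisym subsetI)
      fix y assume "y \<in> (\<Union>n\<in>N. \<Union>n'\<in>N. {n \<oplus>\<^bsub>M\<^esub> r \<odot>\<^bsub>M\<^esub> (n' \<oplus>\<^bsub>M\<^esub> x)})"
      then obtain n n' where n: "n \<in> N" "n' \<in> N" and y: "y = n \<oplus>\<^bsub>M\<^esub> r \<odot>\<^bsub>M\<^esub> (n' \<oplus>\<^bsub>M\<^esub> x)" by blast
      have "y = (n \<oplus>\<^bsub>M\<^esub> r \<odot>\<^bsub>M\<^esub> n') \<oplus>\<^bsub>M\<^esub> r \<odot>\<^bsub>M\<^esub> x"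
        unfolding y using n x by (simp add: M.smult_r_distr M.a_assoc)
      moreover have "n \<oplus>\<^bsub>M\<^esub> r \<odot>\<^bsub>M\<^esub> n' \<in> N"
        using n smult by (intro Q.N.a_closed)
      ultimately show "y \<in> (\<Union>n\<in>N. {n \<oplus>\<^bsub>M\<^esub> r \<odot>\<^bsub>M\<^esub> x})" by blast
    next
      fix y assume "y \<in> (\<Union>n\<in>N. {n \<oplus>\<^bsub>M\<^esub> r \<odot>\<^bsub>M\<^esub> x})"
      then obtain n where "n \<in> N" "y = n \<oplus>\<^bsub>M\<^esub> r \<odot>\<^bsub>M\<^esub> (\<zero>\<^bsub>M\<^esub> \<oplus>\<^bsub>M\<^esub> x)" using x by auto
      then show "y \<in> (\<Union>n\<in>N. \<Union>n'\<in>N. {n \<oplus>\<^bsub>M\<^esub> r \<odot>\<^bsub>M\<^esub> (n' \<oplus>\<^bsub>M\<^esub> x)})"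
        using Q.N.zero_closed by blast
    qed
    finally show ?thesis by (auto simp: a_r_coset_def')
  qed
  note add = Q.quotient_add
  show ?thesis
  proof (intro module.intro Q.abelian_group_quotient module_axioms.intro class_cring.is_cring)
    fix a b :: 'k and X Y assume X: "X \<in> carrier ?Q" and Y: "Y \<in> carrier ?Q"
    obtain x where x: "x \<in> carrier M" "X = N +>\<^bsub>M\<^esub> x" using X unfolding Q.quotient_cosets by blast
    obtain y where y: "y \<in> carrier M" "Y = N +>\<^bsub>M\<^esub> y" using Y unfolding Q.quotient_cosets by blast
    show "a \<odot>\<^bsub>?Q\<^esub> X \<in> carrier ?Q"
      unfolding x(2) sm[OF x(1)] using x(1) by (intro Q.quotient_closed) simp
    show "(a \<oplus>\<^bsub>class_ring\<^esub> b) \<odot>\<^bsub>?Q\<^esub> X = a \<odot>\<^bsub>?Q\<^esub> X \<oplus>\<^bsub>?Q\<^esub> b \<odot>\<^bsub>?Q\<^esub> X"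
      unfolding x(2) sm[OF x(1)] using x(1) M.smult_l_distr[of a b x] by (subst add) simp_all
    show "a \<odot>\<^bsub>?Q\<^esub> (X \<oplus>\<^bsub>?Q\<^esub> Y) = a \<odot>\<^bsub>?Q\<^esub> X \<oplus>\<^bsub>?Q\<^esub> a \<odot>\<^bsub>?Q\<^esub> Y"
      unfolding x(2) y(2) sm[OF x(1)] sm[OF y(1)] add[OF x(1) y(1)] sm[OF M.a_closed[OF x(1) y(1)]]
      using x(1) y(1) by (subst add) (simp_all add: M.smult_r_distr)
    show "(a \<otimes>\<^bsub>class_ring\<^esub> b) \<odot>\<^bsub>?Q\<^esub> X = a \<odot>\<^bsub>?Q\<^esub> (b \<odot>\<^bsub>?Q\<^esub> X)"
      unfolding x(2) sm[OF x(1)] using x(1) M.smult_assoc1[of a b x] by (subst sm) simp_all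
    show "\<one>\<^bsub>class_ring\<^esub> \<odot>\<^bsub>?Q\<^esub> X = X"
      unfolding x(2) sm[OF x(1)] using x(1) M.smult_one by simp
  qed
qed

locale differential_complex = additive_complex C d
  for C :: "int \<Rightarrow> ('k::comm_ring_1, 'a) module" and d +
  assumes d_d: "x \<in> carrier (C n) \<Longrightarrow> d (n - 1) (d n x) = \<zero>\<^bsub>C (n - 2)\<^esub>"
begin

lemma d_d_succ: "x \<in> carrier (C (n + 1)) \<Longrightarrow> d n (d (n + 1) x) = \<zero>\<^bsub>C (n - 1)\<^esub>"
  using d_d[of x "n + 1"] by simp

lemma boundaries_subset_cycles: "boundaries C d n \<subseteq> cycles C d n"
  using d_d_succ[of _ n] d_closed[of _ "n + 1"] by (auto simp: boundaries_def cycles_def)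

lemma subgroup_boundaries_cycles:
  "subgroup (boundaries C d n) (add_monoid ((C n)\<lparr>carrier := cycles C d n\<rparr>))"
  using group.subgroup_incl[OF C.a_group subgroup_boundaries subgroup_cycles boundaries_subset_cycles] by simp

lemma abelian_group_cycles: "abelian_group ((C n)\<lparr>carrier := cycles C d n\<rparr>)"
proof (rule abelian_groupI)
  show "\<exists>y\<in>carrier ((C n)\<lparr>carrier := cycles C d n\<rparr>).
      y \<oplus>\<^bsub>(C n)\<lparr>carrier := cycles C d n\<rparr>\<^esub> x = \<zero>\<^bsub>(C n)\<lparr>carrier := cycles C d n\<rparr>\<^esub>"
    if "x \<in> carrier ((C n)\<lparr>carrier := cycles C d n\<rparr>)" for x
    using that cycles_closed(1,4)[of x n] by (intro bexI[of _ "\<ominus>\<^bsub>C n\<^esub> x"]) (simp_all add: C.l_neg)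
qed (use cycles_closed(1)[of _ n] cycles_closed(2)[of n] cycles_closed(3)[of _ n] in \<open>auto simp: C.a_ac\<close>)

sublocale H: abelian_quotient "(C n)\<lparr>carrier := cycles C d n\<rparr>" "boundaries C d n" for n
  by (intro abelian_quotient.intro abelian_group_cycles abelian_quotient_axioms.intro subgroup_boundaries_cycles)

end

lemma differential_complex_chain_complex: "chain_complex C d \<Longrightarrow> differential_complex C d"
  by (intro differential_complex.intro additive_complex_chain_complex differential_complex_axioms.intro)
    (auto simp: chain_complex_def)

lemma module_homology:
  fixes C :: "int \<Rightarrow> ('k::comm_ring_1, 'a) module"
  assumes cc: "chain_complex C d"
  shows "Module.module class_ring (homology C d n)"
proof -
  interpret differential_complex C d by (rule differential_complex_chain_complex[OF cc])
  interpret M: module class_ring "C k" for k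
    using cc by (simp add: chain_complex_def)
  have smult: "d n (r \<odot>\<^bsub>C n\<^esub> x) = r \<odot>\<^bsub>C (n - 1)\<^esub> d n x" if "x \<in> carrier (C n)" for n r x
    using cc that by (auto simp: chain_complex_def module_hom_def)
  have sub: "LinearCombinations.submodule class_ring (cycles C d n) (C n)"
    using cycles_closed(1) cycles_closed(3)[of _ n] cycles_closed(2)[of n]
    by (intro submodule.intro M.module_axioms subsetI) (auto simp: cycles_def smult)
  have "Module.module class_ring ((C n)\<lparr>carrier := cycles C d n\<rparr>)"
    by (rule M.submodule_is_module[OF sub])
  then have "Module.module class_ring
      (quotient_module ((C n)\<lparr>carrier := cycles C d n\<rparr>) (boundaries C d n))"
  proof (rule module_quotient)
    show "subgroup (boundaries C d n) (add_monoid ((C n)\<lparr>carrier := cycles C d n\<rparr>))"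
      by (rule subgroup_boundaries_cycles)
    show "r \<odot>\<^bsub>(C n)\<lparr>carrier := cycles C d n\<rparr>\<^esub> x \<in> boundaries C d n" if xb: "x \<in> boundaries C d n" for r x
    proof -
      obtain y where "y \<in> carrier (C (n + 1))" "x = d (n + 1) y"
        using xb by (auto simp: boundaries_def)
      then show ?thesis
        using smult[of y "n + 1" r] unfolding boundaries_def
        by (intro image_eqI[of _ _ "r \<odot>\<^bsub>C (n + 1)\<^esub> y"]) simp_all
    qed
  qed
  then show ?thesis by (simp only: homology_eq)
qed

text \<open>The assumptions say that doubling on \<open>C\<close> followed by \<rho> is a short
  exact sequence of complexes 0 -> C -> C -> E -> 0. The instances are singular chains reduced
  modulo 2 and complexes of free groups tensored with the field of two elements.\<close>

locale mod_2_reduction =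
  C: differential_complex C d + E: additive_complex E e
  for C :: "int \<Rightarrow> (int, 'a) module" and d and E :: "int \<Rightarrow> ('k::comm_ring_1, 'b) module" and e +
  fixes \<rho> :: "int \<Rightarrow> 'a \<Rightarrow> 'b"
  assumes rho_hom: "\<rho> n \<in> hom (add_monoid (C n)) (add_monoid (E n))"
    and rho_d: "x \<in> carrier (C n) \<Longrightarrow> e n (\<rho> n x) = \<rho> (n - 1) (d n x)"
    and rho_surj: "carrier (E n) \<subseteq> \<rho> n ` carrier (C n)"
    and rho_double: "x \<in> carrier (C n) \<Longrightarrow> \<rho> n (x \<oplus>\<^bsub>C n\<^esub> x) = \<zero>\<^bsub>E n\<^esub>"
    and rho_kernel: "x \<in> carrier (C n) \<Longrightarrow> \<rho> n x = \<zero>\<^bsub>E n\<^esub> \<Longrightarrow> \<exists>y\<in>carrier (C n). x = y \<oplus>\<^bsub>C n\<^esub> y"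
    and no_2_torsion: "x \<in> carrier (C n) \<Longrightarrow> x \<oplus>\<^bsub>C n\<^esub> x = \<zero>\<^bsub>C n\<^esub> \<Longrightarrow> x = \<zero>\<^bsub>C n\<^esub>"
begin

lemma rho_closed [simp]: "x \<in> carrier (C n) \<Longrightarrow> \<rho> n x \<in> carrier (E n)"
  using rho_hom by (auto simp: hom_def)

lemma rho_add [simp]: "x \<in> carrier (C n) \<Longrightarrow> y \<in> carrier (C n) \<Longrightarrow> \<rho> n (x \<oplus>\<^bsub>C n\<^esub> y) = \<rho> n x \<oplus>\<^bsub>E n\<^esub> \<rho> n y"
  using rho_hom by (auto simp: hom_def)

lemma group_hom_rho: "group_hom (add_monoid (C n)) (add_monoid (E n)) (\<rho> n)"
  using rho_hom by (intro group_hom.intro C.C.a_group E.C.a_group group_hom_axioms.intro)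

lemma rho_zero [simp]: "\<rho> n \<zero>\<^bsub>C n\<^esub> = \<zero>\<^bsub>E n\<^esub>"
  using group_hom.hom_one[OF group_hom_rho] by simp

lemma rho_minus [simp]: "x \<in> carrier (C n) \<Longrightarrow> \<rho> n (\<ominus>\<^bsub>C n\<^esub> x) = \<ominus>\<^bsub>E n\<^esub> \<rho> n x"
  using group_hom.hom_inv[OF group_hom_rho] by (simp add: a_inv_def)

lemma d_closed_succ: "x \<in> carrier (C (n + 1)) \<Longrightarrow> d (n + 1) x \<in> carrier (C n)"
  using C.d_closed[of x "n + 1"] by simp

text \<open>A chain of \<open>E\<close> that bounds the reduction of \<open>x\<close> is lifted
  along \<rho>; the error lies in the kernel and is therefore a double.\<close>

lemma lift_boundary:
  assumes x: "x \<in> carrier (C n)" and bd: "\<rho> n x \<in> boundaries E e n"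
  shows "\<exists>f\<in>carrier (C n). \<exists>w\<in>carrier (C (n + 1)). x = d (n + 1) w \<oplus>\<^bsub>C n\<^esub> (f \<oplus>\<^bsub>C n\<^esub> f)"
proof -
  obtain u where "u \<in> carrier (E (n + 1))" "\<rho> n x = e (n + 1) u"
    using bd by (auto simp: boundaries_def)
  moreover from this obtain w where w: "w \<in> carrier (C (n + 1))" "u = \<rho> (n + 1) w"
    using rho_surj[of "n + 1"] by auto
  ultimately have eq: "\<rho> n x = \<rho> n (d (n + 1) w)"
    using rho_d[of w "n + 1"] by simp
  note dw = d_closed_succ[OF w(1)]
  have "\<rho> n (x \<ominus>\<^bsub>C n\<^esub> d (n + 1) w) = \<zero>\<^bsub>E n\<^esub>"
    using x dw eq by (simp add: C.C.minus_eq E.C.r_neg)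
  then obtain f where f: "f \<in> carrier (C n)" "x \<ominus>\<^bsub>C n\<^esub> d (n + 1) w = f \<oplus>\<^bsub>C n\<^esub> f"
    using rho_kernel[of "x \<ominus>\<^bsub>C n\<^esub> d (n + 1) w" n] x dw by auto
  have "x = (x \<ominus>\<^bsub>C n\<^esub> d (n + 1) w) \<oplus>\<^bsub>C n\<^esub> d (n + 1) w"
    using x dw by (simp add: C.C.minus_eq C.C.a_assoc C.C.l_neg)
  also have "\<dots> = d (n + 1) w \<oplus>\<^bsub>C n\<^esub> (f \<oplus>\<^bsub>C n\<^esub> f)"
    using f dw by (simp add: C.C.a_comm)
  finally show ?thesis using f(1) w by blast
qed

lemma double_cancel:
  assumes "x \<in> carrier (C n)" "y \<in> carrier (C n)" "x \<oplus>\<^bsub>C n\<^esub> x = y \<oplus>\<^bsub>C n\<^esub> y"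
  shows "x = y"
proof -
  have "(x \<ominus>\<^bsub>C n\<^esub> y) \<oplus>\<^bsub>C n\<^esub> (x \<ominus>\<^bsub>C n\<^esub> y) = (x \<oplus>\<^bsub>C n\<^esub> x) \<ominus>\<^bsub>C n\<^esub> (y \<oplus>\<^bsub>C n\<^esub> y)"
    using assms(1,2) by (simp add: C.C.minus_eq C.C.minus_add C.C.a_ac)
  also have "\<dots> = \<zero>\<^bsub>C n\<^esub>"
    using assms by (simp add: C.C.minus_eq C.C.r_neg)
  finally have "x \<ominus>\<^bsub>C n\<^esub> y = \<zero>\<^bsub>C n\<^esub>"
    using assms(1,2) by (intro no_2_torsion[of "x \<ominus>\<^bsub>C n\<^esub> y" n] C.C.minus_closed)
  then show ?thesis using assms(1,2) by simp
qed

text \<open>The connecting map sends homology of \<open>E\<close> in degree n + 1 onto the 2-torsion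
  in degree n. On elements: if \<open>c\<close> bounds 2z, its reduction is a cycle; when this
  bounds, \<open>c\<close> is 2f up to a boundary, and doubling can be cancelled in 2z = 2 d
  f.\<close>

lemma homology_no_2_torsion:
  assumes ac: "acyclic_at E e (n + 1)" and z: "z \<in> cycles C d n" and zz: "z \<oplus>\<^bsub>C n\<^esub> z \<in> boundaries C d n"
  shows "z \<in> boundaries C d n"
proof -
  note zC = C.cycles_closed(1)[OF z]
  obtain c where c: "c \<in> carrier (C (n + 1))" "z \<oplus>\<^bsub>C n\<^esub> z = d (n + 1) c"
    using zz by (auto simp: boundaries_def)
  have "e (n + 1) (\<rho> (n + 1) c) = \<rho> n (z \<oplus>\<^bsub>C n\<^esub> z)"
    unfolding c(2) using rho_d[OF c(1)] by simp
  then have "e (n + 1) (\<rho> (n + 1) c) = \<zero>\<^bsub>E n\<^esub>"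
    by (simp only: rho_double[OF zC])
  then have "\<rho> (n + 1) c \<in> boundaries E e (n + 1)"
    using ac c(1) by (auto simp: acyclic_at_def cycles_def)
  then obtain f w where f: "f \<in> carrier (C (n + 1))" and w: "w \<in> carrier (C (n + 1 + 1))"
    and "c = d (n + 1 + 1) w \<oplus>\<^bsub>C (n + 1)\<^esub> (f \<oplus>\<^bsub>C (n + 1)\<^esub> f)"
    using lift_boundary[OF c(1)] by auto
  then have "d (n + 1) c = d (n + 1) f \<oplus>\<^bsub>C n\<^esub> d (n + 1) f"
    using d_closed_succ[OF w] C.d_d_succ[OF w] d_closed_succ[OF f] by simp
  then have "z = d (n + 1) f"
    using c(2) double_cancel[OF zC d_closed_succ[OF f]] by simp
  with f show ?thesis by (auto simp: boundaries_def)
qed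

text \<open>The homology of \<open>C\<close> modulo doubles embeds into the homology of
  \<open>E\<close> in the same degree.\<close>

lemma homology_2_divisible:
  assumes ac: "acyclic_at E e n" and z: "z \<in> cycles C d n"
  shows "\<exists>z'\<in>cycles C d n. \<exists>b\<in>boundaries C d n. z = b \<oplus>\<^bsub>C n\<^esub> (z' \<oplus>\<^bsub>C n\<^esub> z')"
proof -
  note zC = C.cycles_closed(1)[OF z]
  have "e n (\<rho> n z) = \<zero>\<^bsub>E (n - 1)\<^esub>"
    using rho_d[OF zC] z by (simp add: cycles_def)
  then have "\<rho> n z \<in> boundaries E e n"
    using ac zC by (auto simp: acyclic_at_def cycles_def)
  then obtain f w where f: "f \<in> carrier (C n)" and w: "w \<in> carrier (C (n + 1))"
    and eq: "z = d (n + 1) w \<oplus>\<^bsub>C n\<^esub> (f \<oplus>\<^bsub>C n\<^esub> f)"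
    using lift_boundary[OF zC] by auto
  have "d n f \<oplus>\<^bsub>C (n - 1)\<^esub> d n f = d n z"
    using eq f d_closed_succ[OF w] C.d_d_succ[OF w] by simp
  then have "d n f = \<zero>\<^bsub>C (n - 1)\<^esub>"
    using z f no_2_torsion[of "d n f" "n - 1"] by (simp add: cycles_def)
  with f w eq show ?thesis by (auto simp: cycles_def boundaries_def)
qed

text \<open>Homology of \<open>E\<close> in degree n sits between homology of \<open>C\<close>
  modulo doubles in degree n and the 2-torsion in degree n - 1; both ends vanish here.\<close>

lemma acyclic_reduction:
  assumes no_torsion: "\<And>z. z \<in> cycles C d (n - 1) \<Longrightarrow> z \<oplus>\<^bsub>C (n - 1)\<^esub> z \<in> boundaries C d (n - 1) \<Longrightarrow> z \<in> boundaries C d (n - 1)"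
    and divisible: "\<And>z. z \<in> cycles C d n \<Longrightarrow>
      \<exists>z'\<in>cycles C d n. \<exists>b\<in>boundaries C d n. z = b \<oplus>\<^bsub>C n\<^esub> (z' \<oplus>\<^bsub>C n\<^esub> z')"
  shows "acyclic_at E e n"
  unfolding acyclic_at_def
proof
  fix x assume x: "x \<in> cycles E e n"
  then obtain c where c: "c \<in> carrier (C n)" "x = \<rho> n c"
    using rho_surj[of n] E.cycles_closed(1)[of x n] by auto
  then have "\<rho> (n - 1) (d n c) = \<zero>\<^bsub>E (n - 1)\<^esub>"
    using x rho_d[of c n] by (simp add: cycles_def)
  \<comment> \<open>\<open>b\<close> represents the image of \<open>x\<close> under the connecting
    map.\<close>
  then obtain b where b: "b \<in> carrier (C (n - 1))" "d n c = b \<oplus>\<^bsub>C (n - 1)\<^esub> b"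
    using rho_kernel[of "d n c" "n - 1"] c by auto
  have "d (n - 1) b \<oplus>\<^bsub>C (n - 2)\<^esub> d (n - 1) b = d (n - 1) (d n c)"
    using b C.d_add[of b "n - 1" b] by simp
  then have "d (n - 1) b = \<zero>\<^bsub>C (n - 2)\<^esub>"
    using C.d_d[OF c(1)] b(1) no_2_torsion[of "d (n - 1) b" "n - 2"] C.d_closed[OF b(1)] by simp
  then have bZ: "b \<in> cycles C d (n - 1)" using b by (simp add: cycles_def)
  have "b \<oplus>\<^bsub>C (n - 1)\<^esub> b \<in> boundaries C d (n - 1)"
    unfolding boundaries_def b(2)[symmetric] using c(1) by simp
  from no_torsion[OF bZ this] obtain f where f: "f \<in> carrier (C n)" "b = d n f"
    by (auto simp: boundaries_def)
  define z where "z = c \<ominus>\<^bsub>C n\<^esub> (f \<oplus>\<^bsub>C n\<^esub> f)"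
  have ff: "f \<oplus>\<^bsub>C n\<^esub> f \<in> carrier (C n)" using f(1) by simp
  have "d n (f \<oplus>\<^bsub>C n\<^esub> f) = d n c" using b(2) f by simp
  then have "d n z = \<zero>\<^bsub>C (n - 1)\<^esub>"
    using c(1) ff by (simp only: z_def C.C.minus_eq C.d_add C.d_minus C.C.a_inv_closed C.C.r_neg C.d_closed)
  then have "z \<in> cycles C d n"
    using c(1) ff by (simp add: z_def cycles_def)
  from divisible[OF this] obtain z' w where "z' \<in> cycles C d n" and w: "w \<in> carrier (C (n + 1))"
    and z: "z = d (n + 1) w \<oplus>\<^bsub>C n\<^esub> (z' \<oplus>\<^bsub>C n\<^esub> z')"
    unfolding boundaries_def by blast
  then have z': "z' \<in> carrier (C n)" using C.cycles_closed(1) by simp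
  note dw = d_closed_succ[OF w]
  have "c = z \<oplus>\<^bsub>C n\<^esub> (f \<oplus>\<^bsub>C n\<^esub> f)"
    using c(1) ff by (simp only: z_def C.C.minus_eq C.C.a_assoc C.C.a_inv_closed C.C.l_neg C.C.r_zero)
  then have "x = \<rho> n (d (n + 1) w) \<oplus>\<^bsub>E n\<^esub> \<rho> n (z' \<oplus>\<^bsub>C n\<^esub> z') \<oplus>\<^bsub>E n\<^esub> \<rho> n (f \<oplus>\<^bsub>C n\<^esub> f)"
    using c(2) z z' dw f(1) by (simp only: rho_add C.C.a_closed)
  then have "x = \<rho> n (d (n + 1) w)"
    using rho_double[OF z'] rho_double[OF f(1)] dw by simp
  then have "x = e (n + 1) (\<rho> (n + 1) w)"
    using rho_d[OF w] by simp
  then show "x \<in> boundaries E e n"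
    using w by (auto simp: boundaries_def)
qed

end

lemma (in comm_group) finitely_generated_torsion_exponent:
  assumes S: "finite S" "S \<subseteq> carrier G" "generate G S = carrier G"
    and tor: "\<And>s. s \<in> S \<Longrightarrow> \<exists>k>0. s [^] (k :: nat) = \<one>"
  shows "\<exists>N>0. \<forall>x\<in>carrier G. x [^] (N :: nat) = \<one>"
proof -
  obtain k where k: "\<And>s. s \<in> S \<Longrightarrow> k s > 0 \<and> s [^] (k s :: nat) = \<one>"
    using tor by metis
  define N where "N = (\<Prod>s\<in>S. k s)"
  have "x [^] N = \<one>" if "x \<in> generate G S" for x
    using that
  proof induction
    case (incl s)
    then obtain l where "N = k s * l"
      unfolding N_def using S(1) by (metis dvd_prodI dvdE)
    then have "s [^] N = (s [^] k s) [^] l"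
      using incl S(2) by (simp add: nat_pow_pow subset_iff)
    then show ?case using k[OF incl] by simp
  next
    case (inv s)
    then obtain l where "N = k s * l"
      unfolding N_def using S(1) by (metis dvd_prodI dvdE)
    moreover have "s \<in> carrier G" using inv S(2) by blast
    ultimately have "s [^] N = (s [^] k s) [^] l"
      by (simp add: nat_pow_pow)
    then show ?case using k[OF inv] \<open>s \<in> carrier G\<close> nat_pow_inv[of s N] by simp
  next
    case (eng x y)
    then have "x \<in> carrier G" "y \<in> carrier G" using S(3) by auto
    then show ?case using eng by (simp add: nat_pow_distrib)
  qed simp
  moreover have "N > 0" unfolding N_def using k by (intro prod_pos) auto
  ultimately show ?thesis using S(3) by auto
qed

text \<open>The properties of the inclusion of a torsion-free complex into its rationalisation: it
  is injective, and every element of the target has a positive multiple in the image.\<close>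

locale rational_extension =
  C: differential_complex C d + Q: additive_complex Q q
  for C :: "int \<Rightarrow> (int, 'a) module" and d and Q :: "int \<Rightarrow> ('k::comm_ring_1, 'b) module" and q +
  fixes \<sigma> :: "int \<Rightarrow> 'a \<Rightarrow> 'b"
  assumes sigma_hom: "\<sigma> n \<in> hom (add_monoid (C n)) (add_monoid (Q n))"
    and sigma_d: "x \<in> carrier (C n) \<Longrightarrow> q n (\<sigma> n x) = \<sigma> (n - 1) (d n x)"
    and sigma_dense: "y \<in> carrier (Q n) \<Longrightarrow> \<exists>k>0. \<exists>x\<in>carrier (C n). [(k :: nat)] \<cdot>\<^bsub>Q n\<^esub> y = \<sigma> n x"
    and sigma_inj: "x \<in> carrier (C n) \<Longrightarrow> \<sigma> n x = \<zero>\<^bsub>Q n\<^esub> \<Longrightarrow> x = \<zero>\<^bsub>C n\<^esub>"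
begin

lemma group_hom_sigma: "group_hom (add_monoid (C n)) (add_monoid (Q n)) (\<sigma> n)"
  using sigma_hom by (intro group_hom.intro C.C.a_group Q.C.a_group group_hom_axioms.intro)

text \<open>Clearing denominators in a rational filling of \<open>z\<close> gives an integral
  filling of a multiple of \<open>z\<close>, by injectivity of \<sigma>.\<close>

lemma homology_torsion:
  assumes ac: "acyclic_at Q q n" and z: "z \<in> cycles C d n"
  shows "\<exists>k>0. [(k :: nat)] \<cdot>\<^bsub>C n\<^esub> z \<in> boundaries C d n"
proof -
  interpret s: group_hom "add_monoid (C i)" "add_monoid (Q i)" "\<sigma> i" for i by (rule group_hom_sigma)
  interpret dq: group_hom "add_monoid (Q i)" "add_monoid (Q (i - 1))" "q i" for i by (rule Q.group_hom_d)
  have zC: "z \<in> carrier (C n)" using C.cycles_closed(1)[OF z] .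
  have "q n (\<sigma> n z) = \<zero>\<^bsub>Q (n - 1)\<^esub>"
    using sigma_d[OF zC] z s.hom_one[of "n - 1"] by (simp add: cycles_def)
  then have "\<sigma> n z \<in> cycles Q q n"
    using zC s.hom_closed[of z n] by (simp add: cycles_def)
  then obtain u where u: "u \<in> carrier (Q (n + 1))" "\<sigma> n z = q (n + 1) u"
    using ac by (auto simp: acyclic_at_def boundaries_def)
  obtain k c where k: "k > 0" and c: "c \<in> carrier (C (n + 1))" "[(k :: nat)] \<cdot>\<^bsub>Q (n + 1)\<^esub> u = \<sigma> (n + 1) c"
    using sigma_dense[OF u(1)] by blast
  have dc: "d (n + 1) c \<in> carrier (C n)" using C.d_closed[OF c(1)] by simp
  have kz: "[k] \<cdot>\<^bsub>C n\<^esub> z \<in> carrier (C n)" using zC by simp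
  have "\<sigma> n ([k] \<cdot>\<^bsub>C n\<^esub> z) = [k] \<cdot>\<^bsub>Q n\<^esub> (q (n + 1) u)"
    using s.hom_nat_pow[of z n k] zC u(2) by (simp add: add_pow_def)
  also have "\<dots> = q (n + 1) ([k] \<cdot>\<^bsub>Q (n + 1)\<^esub> u)"
    using dq.hom_nat_pow[of u "n + 1" k] u(1) by (simp add: add_pow_def)
  also have "\<dots> = \<sigma> n (d (n + 1) c)"
    using sigma_d[OF c(1)] c(2) by simp
  finally have "\<sigma> n ([k] \<cdot>\<^bsub>C n\<^esub> z \<ominus>\<^bsub>C n\<^esub> d (n + 1) c) = \<zero>\<^bsub>Q n\<^esub>"
    using dc kz s.hom_mult[of "[k] \<cdot>\<^bsub>C n\<^esub> z" n "\<ominus>\<^bsub>C n\<^esub> d (n + 1) c"] s.hom_inv[of "d (n + 1) c" n]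
      s.hom_closed[of "d (n + 1) c" n] Q.C.r_neg[of "\<sigma> n (d (n + 1) c)" n]
    by (simp add: C.C.minus_eq a_inv_def)
  then have "[k] \<cdot>\<^bsub>C n\<^esub> z \<ominus>\<^bsub>C n\<^esub> d (n + 1) c = \<zero>\<^bsub>C n\<^esub>"
    using sigma_inj[OF C.C.minus_closed[OF kz dc]] by blast
  then have "[k] \<cdot>\<^bsub>C n\<^esub> z = d (n + 1) c" using dc kz by simp
  then show ?thesis using k c(1) by (auto simp: boundaries_def)
qed

lemma homology_exponent:
  assumes ac: "acyclic_at Q q n" and fg: "finitely_generated_group (homology C d n)"
  shows "\<exists>N>0. \<forall>z\<in>cycles C d n. [(N :: nat)] \<cdot>\<^bsub>C n\<^esub> z \<in> boundaries C d n"
proof -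
  let ?H = "homology C d n" and ?Z = "(C n)\<lparr>carrier := cycles C d n\<rparr>" and ?B = "boundaries C d n"
  have H: "?H = quotient_module ?Z ?B" by (rule homology_eq)
  interpret H: abelian_group ?H
    unfolding H by (rule C.H.abelian_group_quotient)
  have pow: "[k] \<cdot>\<^bsub>?Z\<^esub> z = [k] \<cdot>\<^bsub>C n\<^esub> z" for k :: nat and z
    by (simp add: add_pow_def nat_pow_def)
  have coset_pow: "[k] \<cdot>\<^bsub>?H\<^esub> (?B +>\<^bsub>?Z\<^esub> z) = \<zero>\<^bsub>?H\<^esub> \<longleftrightarrow> [k] \<cdot>\<^bsub>C n\<^esub> z \<in> ?B"
    if z: "z \<in> cycles C d n" for z and k :: nat
  proof -
    have kz: "[k] \<cdot>\<^bsub>?Z\<^esub> z \<in> carrier ?Z"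
      using C.H.M.add.nat_pow_closed[of z n k] z by (simp add: add_pow_def)
    have "[k] \<cdot>\<^bsub>?H\<^esub> (?B +>\<^bsub>?Z\<^esub> z) = ?B +>\<^bsub>?Z\<^esub> ([k] \<cdot>\<^bsub>?Z\<^esub> z)"
      unfolding H using z by (intro C.H.quotient_pow) simp
    then show ?thesis
      using C.H.coset_zero_iff[OF kz] unfolding H[symmetric] pow by simp
  qed
  obtain S where S: "finite S" "S \<subseteq> carrier ?H" "generate (add_monoid ?H) S = carrier ?H"
    using fg by (auto simp: finitely_generated_group_def)
  have "\<exists>N>0. \<forall>x\<in>carrier (add_monoid ?H). x [^]\<^bsub>add_monoid ?H\<^esub> (N :: nat) = \<one>\<^bsub>add_monoid ?H\<^esub>"
  proof (rule comm_group.finitely_generated_torsion_exponent[OF H.a_comm_group S(1)])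
    show "S \<subseteq> carrier (add_monoid ?H)" "generate (add_monoid ?H) S = carrier (add_monoid ?H)"
      using S by simp_all
    fix s assume "s \<in> S"
    then have "s \<in> carrier ?H" using S(2) by blast
    then obtain z where z: "z \<in> cycles C d n" "s = ?B +>\<^bsub>?Z\<^esub> z"
      unfolding H C.H.quotient_cosets by auto
    obtain k where "k > 0" "[(k :: nat)] \<cdot>\<^bsub>C n\<^esub> z \<in> ?B"
      using homology_torsion[OF ac z(1)] by blast
    then show "\<exists>k>0. s [^]\<^bsub>add_monoid ?H\<^esub> (k :: nat) = \<one>\<^bsub>add_monoid ?H\<^esub>"
      using coset_pow[OF z(1), of k] z(2) by (auto simp: add_pow_def)
  qed
  then obtain N :: nat where N: "N > 0" "\<And>x. x \<in> carrier ?H \<Longrightarrow> [N] \<cdot>\<^bsub>?H\<^esub> x = \<zero>\<^bsub>?H\<^esub>"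
    by (auto simp: add_pow_def)
  have "[N] \<cdot>\<^bsub>C n\<^esub> z \<in> ?B" if z: "z \<in> cycles C d n" for z
  proof -
    have "?B +>\<^bsub>?Z\<^esub> z \<in> carrier ?H"
      unfolding H using z by (intro C.H.quotient_closed) simp
    then show ?thesis using N(2) coset_pow[OF z] by blast
  qed
  with N(1) show ?thesis by blast
qed

end


section \<open>Odd exponents and vanishing of the reduced homology\<close>

context mod_2_reduction
begin

lemma pow_add: "x \<in> carrier (C n) \<Longrightarrow> [(j + k :: nat)] \<cdot>\<^bsub>C n\<^esub> x = [j] \<cdot>\<^bsub>C n\<^esub> x \<oplus>\<^bsub>C n\<^esub> [k] \<cdot>\<^bsub>C n\<^esub> x"
  using C.C.add.nat_pow_mult[of x n j k] by (simp add: add_pow_def)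

lemma pow_distrib:
  "x \<in> carrier (C n) \<Longrightarrow> y \<in> carrier (C n) \<Longrightarrow>
   [(k :: nat)] \<cdot>\<^bsub>C n\<^esub> (x \<oplus>\<^bsub>C n\<^esub> y) = [k] \<cdot>\<^bsub>C n\<^esub> x \<oplus>\<^bsub>C n\<^esub> [k] \<cdot>\<^bsub>C n\<^esub> y"
  using comm_monoid.nat_pow_distrib[OF C.C.a_comm_monoid, of x n y k] by (simp add: add_pow_def)

lemma pow_cycles: "z \<in> cycles C d n \<Longrightarrow> [(k :: nat)] \<cdot>\<^bsub>C n\<^esub> z \<in> cycles C d n"
proof (induction k)
  case 0
  then show ?case using C.cycles_closed(2)[of n] by (simp add: add_pow_def)
next
  case (Suc k)
  then show ?case using C.cycles_closed(3)[of _ n z] by (simp add: add_pow_def)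
qed

text \<open>If every even exponent can be halved, the least one is odd. Writing it as 1 + 2k lets
  both applications split off a double.\<close>

lemma odd_exponent:
  assumes ex: "\<exists>N>0. \<forall>z\<in>cycles C d n. [(N :: nat)] \<cdot>\<^bsub>C n\<^esub> z \<in> boundaries C d n"
    and halve: "\<And>k. \<forall>z\<in>cycles C d n. [(k + k :: nat)] \<cdot>\<^bsub>C n\<^esub> z \<in> boundaries C d n \<Longrightarrow>
      \<forall>z\<in>cycles C d n. [k] \<cdot>\<^bsub>C n\<^esub> z \<in> boundaries C d n"
  shows "\<exists>k. \<forall>z\<in>cycles C d n. z \<oplus>\<^bsub>C n\<^esub> ([(k :: nat)] \<cdot>\<^bsub>C n\<^esub> z \<oplus>\<^bsub>C n\<^esub> [k] \<cdot>\<^bsub>C n\<^esub> z) \<in> boundaries C d n"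
proof -
  define P where "P N \<longleftrightarrow> N > 0 \<and> (\<forall>z\<in>cycles C d n. [N] \<cdot>\<^bsub>C n\<^esub> z \<in> boundaries C d n)" for N :: nat
  define N where "N = (LEAST N. P N)"
  have "\<exists>N. P N" using ex by (simp add: P_def)
  then have N: "P N" unfolding N_def by (rule LeastI_ex)
  have "odd N"
  proof
    assume "even N"
    then obtain k where k: "N = k + k" by (metis evenE mult_2)
    then have "P k" using N halve[of k] by (auto simp: P_def)
    then have "N \<le> k" unfolding N_def by (rule Least_le)
    with k N show False by (simp add: P_def)
  qed
  then obtain k where k: "N = 1 + (k + k)" by (metis add.commute mult_2 oddE)
  have "z \<oplus>\<^bsub>C n\<^esub> ([k] \<cdot>\<^bsub>C n\<^esub> z \<oplus>\<^bsub>C n\<^esub> [k] \<cdot>\<^bsub>C n\<^esub> z) = [N] \<cdot>\<^bsub>C n\<^esub> z"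
    if "z \<in> cycles C d n" for z
  proof -
    have z: "z \<in> carrier (C n)" using C.cycles_closed(1)[OF that] .
    have "[(1 :: nat)] \<cdot>\<^bsub>C n\<^esub> z = z" using z by (simp add: add_pow_def)
    then show ?thesis unfolding k pow_add[OF z] by simp
  qed
  then show ?thesis using N by (intro exI[of _ k]) (auto simp: P_def)
qed

text \<open>When all classes are doubles, an exponent 2k already kills all classes with k. With an
  odd exponent 1 + 2k, a class killed by 2 equals its multiple by 1 + 2k and so vanishes.\<close>

lemma no_2_torsion_of_divisible:
  assumes ex: "\<exists>N>0. \<forall>z\<in>cycles C d n. [(N :: nat)] \<cdot>\<^bsub>C n\<^esub> z \<in> boundaries C d n"
    and ac: "acyclic_at E e n"
    and z: "z \<in> cycles C d n" "z \<oplus>\<^bsub>C n\<^esub> z \<in> boundaries C d n"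
  shows "z \<in> boundaries C d n"
proof -
  have "\<exists>k. \<forall>z\<in>cycles C d n. z \<oplus>\<^bsub>C n\<^esub> ([(k :: nat)] \<cdot>\<^bsub>C n\<^esub> z \<oplus>\<^bsub>C n\<^esub> [k] \<cdot>\<^bsub>C n\<^esub> z) \<in> boundaries C d n"
  proof (rule odd_exponent[OF ex], intro ballI)
    fix k :: nat and z assume *: "\<forall>z\<in>cycles C d n. [(k + k)] \<cdot>\<^bsub>C n\<^esub> z \<in> boundaries C d n" and z: "z \<in> cycles C d n"
    obtain z' b where z': "z' \<in> cycles C d n" and b: "b \<in> boundaries C d n" and eq: "z = b \<oplus>\<^bsub>C n\<^esub> (z' \<oplus>\<^bsub>C n\<^esub> z')"
      using homology_2_divisible[OF ac z] by blast
    note c = C.cycles_closed(1)[OF z'] C.boundaries_closed(1)[OF b]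
    have "[k] \<cdot>\<^bsub>C n\<^esub> z = [k] \<cdot>\<^bsub>C n\<^esub> b \<oplus>\<^bsub>C n\<^esub> [(k + k)] \<cdot>\<^bsub>C n\<^esub> z'"
      unfolding eq using c by (simp add: pow_distrib pow_add)
    then show "[k] \<cdot>\<^bsub>C n\<^esub> z \<in> boundaries C d n"
      using * z' C.boundaries_closed(3,5) b by auto
  qed
  then obtain k :: nat where k: "z \<oplus>\<^bsub>C n\<^esub> ([k] \<cdot>\<^bsub>C n\<^esub> z \<oplus>\<^bsub>C n\<^esub> [k] \<cdot>\<^bsub>C n\<^esub> z) \<in> boundaries C d n"
    using z(1) by blast
  note zC = C.cycles_closed(1)[OF z(1)]
  have kk: "[k] \<cdot>\<^bsub>C n\<^esub> z \<oplus>\<^bsub>C n\<^esub> [k] \<cdot>\<^bsub>C n\<^esub> z \<in> boundaries C d n"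
    using C.boundaries_closed(5)[OF z(2), of k] zC by (simp add: pow_distrib)
  have "z = (z \<oplus>\<^bsub>C n\<^esub> ([k] \<cdot>\<^bsub>C n\<^esub> z \<oplus>\<^bsub>C n\<^esub> [k] \<cdot>\<^bsub>C n\<^esub> z)) \<oplus>\<^bsub>C n\<^esub> (\<ominus>\<^bsub>C n\<^esub> ([k] \<cdot>\<^bsub>C n\<^esub> z \<oplus>\<^bsub>C n\<^esub> [k] \<cdot>\<^bsub>C n\<^esub> z))"
    using zC C.boundaries_closed(1)[OF kk]
    by (simp only: C.C.a_assoc C.C.a_inv_closed C.C.r_neg C.C.r_zero)
  then show ?thesis using C.boundaries_closed(3)[OF k C.boundaries_closed(4)[OF kk]] by simp
qed

text \<open>Without 2-torsion an exponent 2k improves to k. An odd exponent 1 + 2k then shows each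
  class to be twice its multiple by - k.\<close>

lemma divisible_of_no_2_torsion:
  assumes ex: "\<exists>N>0. \<forall>z\<in>cycles C d n. [(N :: nat)] \<cdot>\<^bsub>C n\<^esub> z \<in> boundaries C d n"
    and ac: "acyclic_at E e (n + 1)"
    and z: "z \<in> cycles C d n"
  shows "\<exists>z'\<in>cycles C d n. \<exists>b\<in>boundaries C d n. z = b \<oplus>\<^bsub>C n\<^esub> (z' \<oplus>\<^bsub>C n\<^esub> z')"
proof -
  have "\<exists>k. \<forall>z\<in>cycles C d n. z \<oplus>\<^bsub>C n\<^esub> ([(k :: nat)] \<cdot>\<^bsub>C n\<^esub> z \<oplus>\<^bsub>C n\<^esub> [k] \<cdot>\<^bsub>C n\<^esub> z) \<in> boundaries C d n"
  proof (rule odd_exponent[OF ex], intro ballI)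
    fix k :: nat and z assume *: "\<forall>z\<in>cycles C d n. [(k + k)] \<cdot>\<^bsub>C n\<^esub> z \<in> boundaries C d n" and z: "z \<in> cycles C d n"
    show "[k] \<cdot>\<^bsub>C n\<^esub> z \<in> boundaries C d n"
    proof (rule homology_no_2_torsion[OF ac pow_cycles[OF z]])
      show "[k] \<cdot>\<^bsub>C n\<^esub> z \<oplus>\<^bsub>C n\<^esub> [k] \<cdot>\<^bsub>C n\<^esub> z \<in> boundaries C d n"
        using bspec[OF * z] unfolding pow_add[OF C.cycles_closed(1)[OF z]] .
    qed
  qed
  then obtain k :: nat where k: "z \<oplus>\<^bsub>C n\<^esub> ([k] \<cdot>\<^bsub>C n\<^esub> z \<oplus>\<^bsub>C n\<^esub> [k] \<cdot>\<^bsub>C n\<^esub> z) \<in> boundaries C d n"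
    using z by blast
  let ?k = "[k] \<cdot>\<^bsub>C n\<^esub> z"
  have kC: "?k \<in> carrier (C n)" and zC: "z \<in> carrier (C n)"
    using C.cycles_closed(1)[OF pow_cycles[OF z]] C.cycles_closed(1)[OF z] .
  have "\<ominus>\<^bsub>C n\<^esub> ?k \<oplus>\<^bsub>C n\<^esub> \<ominus>\<^bsub>C n\<^esub> ?k = \<ominus>\<^bsub>C n\<^esub> (?k \<oplus>\<^bsub>C n\<^esub> ?k)"
    using kC by (simp add: C.C.minus_add)
  then have "z = (z \<oplus>\<^bsub>C n\<^esub> (?k \<oplus>\<^bsub>C n\<^esub> ?k)) \<oplus>\<^bsub>C n\<^esub> (\<ominus>\<^bsub>C n\<^esub> ?k \<oplus>\<^bsub>C n\<^esub> \<ominus>\<^bsub>C n\<^esub> ?k)"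
    using zC kC C.C.a_closed[OF kC kC]
    by (simp only: C.C.a_assoc C.C.a_inv_closed C.C.a_closed C.C.r_neg C.C.r_zero)
  then show ?thesis using k C.cycles_closed(4)[OF pow_cycles[OF z]] by blast
qed

text \<open>The two degrees are treated dually: degree n - 1 turns divisibility into absence of
  2-torsion, degree n turns absence of 2-torsion into divisibility, and
  \<open>acyclic_reduction\<close> combines the results.\<close>

lemma acyclic_of_exponents:
  assumes "\<exists>N>0. \<forall>z\<in>cycles C d (n - 1). [(N :: nat)] \<cdot>\<^bsub>C (n - 1)\<^esub> z \<in> boundaries C d (n - 1)"
    and "\<exists>N>0. \<forall>z\<in>cycles C d n. [(N :: nat)] \<cdot>\<^bsub>C n\<^esub> z \<in> boundaries C d n"
    and "acyclic_at E e (n - 1)" and "acyclic_at E e (n + 1)"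
  shows "acyclic_at E e n"
proof (rule acyclic_reduction)
  show "z \<in> boundaries C d (n - 1)"
    if "z \<in> cycles C d (n - 1)" "z \<oplus>\<^bsub>C (n - 1)\<^esub> z \<in> boundaries C d (n - 1)" for z
    using that by (rule no_2_torsion_of_divisible[OF assms(1,3)])
  show "\<exists>z'\<in>cycles C d n. \<exists>b\<in>boundaries C d n. z = b \<oplus>\<^bsub>C n\<^esub> (z' \<oplus>\<^bsub>C n\<^esub> z')"
    if "z \<in> cycles C d n" for z
    using that by (rule divisible_of_no_2_torsion[OF assms(2,4)])
qed

end

section \<open>Free modules over a commutative ring\<close>

lemma free_module_simps [simp]:
  "carrier (free_module S) = {c. keys c \<subseteq> S}"
  "zero (free_module S) = 0"
  "add (free_module S) = (+)"
  "module.smult (free_module S) = poly_scale"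
  by (simp_all add: free_module_def)

lemma keys_uminus: "keys (- c) = keys c" for c :: "'b \<Rightarrow>\<^sub>0 'k::comm_ring_1"
  by (auto simp: in_keys_iff)

lemma keys_add_subset: "keys a \<subseteq> S \<Longrightarrow> keys b \<subseteq> S \<Longrightarrow> keys (a + b) \<subseteq> S"
  using Poly_Mapping.keys_add[of a b] by blast

lemma module_free_module: "Module.module class_ring (free_module S :: ('k::comm_ring_1, 'b \<Rightarrow>\<^sub>0 'k) module)"
proof (intro module.intro module_axioms.intro class_cring.is_cring abelian_groupI)
  show "\<exists>y\<in>carrier (free_module S). y \<oplus>\<^bsub>free_module S\<^esub> x = \<zero>\<^bsub>free_module S\<^esub>"
    if "x \<in> carrier (free_module S)" for x :: "'b \<Rightarrow>\<^sub>0 'k"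
    using that by (intro bexI[of _ "- x"]) (auto simp: keys_uminus)
qed (auto simp: keys_add_subset add.assoc add.commute algebra_simps lookup_add
    intro: poly_mapping_eqI dest: subsetD[OF keys_poly_scale])

lemmas abelian_group_free_module = module.axioms(2)[OF module_free_module]

lemma add_pow_free_module: "[(k :: nat)] \<cdot>\<^bsub>free_module S\<^esub> x = poly_scale (of_nat k) x"
proof (induction k)
  case 0
  show ?case by (intro poly_mapping_eqI) (simp add: add_pow_def)
next
  case (Suc k)
  then show ?case by (intro poly_mapping_eqI) (simp add: add_pow_def lookup_add algebra_simps)
qed

subsection \<open>Singular chains\<close>

definition singular_faces :: "int \<Rightarrow> ((nat \<Rightarrow> real) \<Rightarrow> 'a) \<Rightarrow> (((nat \<Rightarrow> real) \<Rightarrow> 'a) \<Rightarrow>\<^sub>0 'k::comm_ring_1)" where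
  "singular_faces n f = (\<Sum>k\<le>nat n. Poly_Mapping.single (singular_face (nat n) k f) ((-1) ^ k))"

lemma singular_boundary_eq:
  "singular_boundary n = (if n \<le> 0 then (\<lambda>c. 0) else linear_extension (singular_faces n))"
  by (simp add: singular_boundary_def singular_faces_def[abs_def])

lemma keys_linear_extension: "keys (linear_extension g c) \<subseteq> (\<Union>x\<in>keys c. keys (g x))"
proof
  fix y assume "y \<in> keys (linear_extension g c)"
  then have "(\<Sum>x\<in>keys c. lookup c x * lookup (g x) y) \<noteq> 0"
    by (simp add: in_keys_iff lookup_linear_extension[where S = "keys c"])
  then obtain x where "x \<in> keys c" "lookup c x * lookup (g x) y \<noteq> 0"
    by (rule sum.not_neutral_contains_not_neutral)
  then show "y \<in> (\<Union>x\<in>keys c. keys (g x))"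
    by (intro UN_I[of x]) (auto simp: in_keys_iff)
qed

lemma keys_singular_faces: "keys (singular_faces n f) \<subseteq> (\<lambda>k. singular_face (nat n) k f) ` {..nat n}"
proof
  fix y assume "y \<in> keys (singular_faces n f :: _ \<Rightarrow>\<^sub>0 'b)"
  then have "(\<Sum>k\<le>nat n. lookup (Poly_Mapping.single (singular_face (nat n) k f) ((-1) ^ k :: 'b)) y) \<noteq> 0"
    by (simp add: in_keys_iff singular_faces_def lookup_sum)
  then obtain k where "k \<in> {..nat n}" "lookup (Poly_Mapping.single (singular_face (nat n) k f) ((-1) ^ k :: 'b)) y \<noteq> 0"
    by (rule sum.not_neutral_contains_not_neutral)
  then show "y \<in> (\<lambda>k. singular_face (nat n) k f) ` {..nat n}"
    by (auto simp: lookup_single when_def split: if_splits)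
qed

lemma additive_complex_singular:
  "additive_complex (singular_chain_module X :: int \<Rightarrow> ('k::comm_ring_1, _) module) singular_boundary"
proof (rule additive_complex.intro)
  fix n :: int
  show "abelian_group (singular_chain_module X n :: ('k, _) module)"
    unfolding singular_chain_module_def by (rule abelian_group_free_module)
  have "keys (singular_boundary n c) \<subseteq> (if n - 1 < 0 then {} else singular_simplex_set (nat (n - 1)) X)"
    if c: "keys c \<subseteq> (if n < 0 then {} else singular_simplex_set (nat n) X)" for c :: "_ \<Rightarrow>\<^sub>0 'k"
  proof (cases "n \<le> 0")
    case False
    have "y \<in> singular_simplex_set (nat (n - 1)) X" if f: "f \<in> keys c" and y: "y \<in> keys (singular_faces n f :: _ \<Rightarrow>\<^sub>0 'k)" for f y
    proof -
      obtain k where "k \<le> nat n" "y = singular_face (nat n) k f"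
        using subsetD[OF keys_singular_faces y] by auto
      moreover have "singular_simplex (nat n) X f" using f c False by auto
      ultimately show ?thesis
        using singular_simplex_singular_face[of "nat n" X f k] False by (simp add: nat_diff_distrib)
    qed
    then show ?thesis
      using False keys_linear_extension[of "singular_faces n" c] by (auto simp: singular_boundary_eq)
  qed (simp add: singular_boundary_eq)
  then show "singular_boundary n \<in> hom (add_monoid (singular_chain_module X n :: ('k, _) module))
      (add_monoid (singular_chain_module X (n - 1)))"
    by (auto simp: hom_def singular_chain_module_def singular_boundary_eq linear_extension_add)
qed

lemma differential_complex_singular_int:
  "differential_complex (singular_chain_module X :: int \<Rightarrow> (int, _) module) singular_boundary"
proof (intro differential_complex.intro additive_complex_singular differential_complex_axioms.intro)
  fix c n assume c: "c \<in> carrier (singular_chain_module X n :: (int, _) module)"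
  show "singular_boundary (n - 1) (singular_boundary n c) = \<zero>\<^bsub>singular_chain_module X (n - 2)\<^esub>"
  \<comment> \<open>For \<open>n\<close> at most 1 the outer boundary map is zero by definition;
    beyond that, \<open>p - 1\<close> is a genuine predecessor and the integral library boundary
    applies.\<close>
  proof (cases "n \<le> 1")
    case True
    then show ?thesis by (simp add: singular_boundary_eq singular_chain_module_def)
  next
    case False
    define p where "p = nat n"
    have p: "n = int p" "n - 1 = int (p - 1)" using False by (auto simp: p_def)
    have "singular_chain p X c" using c by (simp add: singular_chain_module_def singular_chain_def p(1))
    then have "chain_boundary (p - Suc 0) (chain_boundary p c) = 0" by (rule chain_boundary_boundary)
    then show ?thesis unfolding p(2) unfolding p(1) by (simp add: singular_boundary_int singular_chain_module_def)
  qed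
qed

subsection \<open>Change of coefficients\<close>

lemma lookup_map_of_int [simp]: "lookup (Poly_Mapping.map of_int c) x = of_int (lookup c x)"
  by (simp add: Poly_Mapping.map.rep_eq when_def)

lemma map_of_int_linear_extension:
  fixes g :: "'b \<Rightarrow> ('c \<Rightarrow>\<^sub>0 int)" and h :: "'b \<Rightarrow> ('c \<Rightarrow>\<^sub>0 'k::comm_ring_1)"
  assumes "\<And>x. h x = Poly_Mapping.map of_int (g x)"
  shows "linear_extension h (Poly_Mapping.map of_int c) = Poly_Mapping.map of_int (linear_extension g c)"
proof (rule poly_mapping_eqI)
  fix y
  have "keys (Poly_Mapping.map of_int c :: _ \<Rightarrow>\<^sub>0 'k) \<subseteq> keys c"
    by (auto simp: in_keys_iff)
  then show "lookup (linear_extension h (Poly_Mapping.map of_int c)) y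
      = lookup (Poly_Mapping.map of_int (linear_extension g c)) y"
    by (simp add: lookup_linear_extension[where S = "keys c"] assms)
qed

lemma singular_boundary_map_of_int:
  "singular_boundary n (Poly_Mapping.map of_int c) =
   (Poly_Mapping.map of_int (singular_boundary n c) :: _ \<Rightarrow>\<^sub>0 'k::comm_ring_1)"
proof -
  have "(singular_faces n f :: _ \<Rightarrow>\<^sub>0 'k) = Poly_Mapping.map of_int (singular_faces n f)"
    for f :: "(nat \<Rightarrow> real) \<Rightarrow> 'a"
    by (rule poly_mapping_eqI) (simp add: singular_faces_def lookup_sum lookup_single when_def if_distrib cong: if_cong)
  then show ?thesis
    by (auto simp: singular_boundary_eq map_of_int_linear_extension intro: poly_mapping_eqI)
qed

lemma hom_map_of_int:
  fixes S :: "'b set"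
  shows "Poly_Mapping.map of_int \<in> hom (add_monoid (free_module S :: (int, _) module))
     (add_monoid (free_module S :: ('k::comm_ring_1, _) module))"
proof -
  have "Poly_Mapping.map of_int (x + y) = (Poly_Mapping.map of_int x + Poly_Mapping.map of_int y :: _ \<Rightarrow>\<^sub>0 'k)"
    for x y :: "'b \<Rightarrow>\<^sub>0 int"
    by (rule poly_mapping_eqI) (simp add: lookup_add)
  moreover have "keys (Poly_Mapping.map of_int x :: _ \<Rightarrow>\<^sub>0 'k) \<subseteq> S" if "keys x \<subseteq> S" for x :: "'b \<Rightarrow>\<^sub>0 int"
  proof -
    have "keys (Poly_Mapping.map of_int x :: _ \<Rightarrow>\<^sub>0 'k) \<subseteq> keys x"
      by (auto simp: in_keys_iff)
    with that show ?thesis by blast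
  qed
  ultimately show ?thesis by (simp add: hom_def)
qed

lemma lookup_map_zero: "f 0 = 0 \<Longrightarrow> lookup (Poly_Mapping.map f c) x = f (lookup c x)"
  by (simp add: Poly_Mapping.map.rep_eq when_def)

lemma of_int_bit_eq_0_iff: "(of_int m :: bit) = 0 \<longleftrightarrow> even m"
proof
  assume "even m"
  then obtain k where "m = 2 * k" by (rule evenE)
  then show "(of_int m :: bit) = 0" by simp
next
  assume 0: "(of_int m :: bit) = 0"
  show "even m"
  proof (rule ccontr)
    assume "odd m"
    then obtain k where "m = 2 * k + 1" by (rule oddE)
    with 0 show False by simp
  qed
qed

lemma bit_add_self: "(x :: bit) + x = 0"
  by (cases x) simp_all

lemma mod_2_reduction_singular:
  "mod_2_reduction (singular_chain_module X :: int \<Rightarrow> (int, _) module) singular_boundary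
     (singular_chain_module X :: int \<Rightarrow> (bit, _) module) singular_boundary (\<lambda>n. Poly_Mapping.map of_int)"
proof (intro mod_2_reduction.intro differential_complex_singular_int additive_complex_singular
    mod_2_reduction_axioms.intro)
  fix n :: int
  let ?S = "if n < 0 then {} else singular_simplex_set (nat n) X"
  show "carrier (singular_chain_module X n :: (bit, _) module)
      \<subseteq> Poly_Mapping.map of_int ` carrier (singular_chain_module X n)"
  proof
    fix c assume c: "c \<in> carrier (singular_chain_module X n :: (bit, _) module)"
    define c' :: "_ \<Rightarrow>\<^sub>0 int" where "c' = Poly_Mapping.map (\<lambda>b. if b = 0 then 0 else 1) c"
    have "c = Poly_Mapping.map of_int c'"
      by (rule poly_mapping_eqI) (simp add: c'_def lookup_map_zero)
    moreover have "keys c' \<subseteq> keys c"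
      by (auto simp: in_keys_iff c'_def lookup_map_zero split: if_splits)
    ultimately show "c \<in> Poly_Mapping.map of_int ` carrier (singular_chain_module X n)"
      using c by (intro image_eqI[of _ _ c']) (auto simp: singular_chain_module_def)
  qed
  fix x assume x: "x \<in> carrier (singular_chain_module X n :: (int, _) module)"
  show "singular_boundary n (Poly_Mapping.map of_int x) = (Poly_Mapping.map of_int (singular_boundary n x) :: _ \<Rightarrow>\<^sub>0 bit)"
    by (rule singular_boundary_map_of_int)
  show "Poly_Mapping.map of_int (x \<oplus>\<^bsub>singular_chain_module X n\<^esub> x) = \<zero>\<^bsub>singular_chain_module X n :: (bit, _) module\<^esub>"
    by (rule poly_mapping_eqI) (simp add: singular_chain_module_def lookup_add bit_add_self)
  show "\<exists>y\<in>carrier (singular_chain_module X n). x = y \<oplus>\<^bsub>singular_chain_module X n\<^esub> y"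
    if "Poly_Mapping.map of_int x = \<zero>\<^bsub>singular_chain_module X n :: (bit, _) module\<^esub>"
  proof -
    define y :: "_ \<Rightarrow>\<^sub>0 int" where "y = Poly_Mapping.map (\<lambda>m. m div 2) x"
    have "even (lookup x s)" for s
    proof -
      have "lookup (Poly_Mapping.map of_int x :: _ \<Rightarrow>\<^sub>0 bit) s = 0"
        using that by (simp add: singular_chain_module_def del: lookup_map_of_int)
      then show ?thesis by (simp add: of_int_bit_eq_0_iff)
    qed
    then have "x = y + y"
      by (intro poly_mapping_eqI) (simp add: y_def lookup_map_zero lookup_add)
    moreover have "keys y \<subseteq> keys x"
      by (auto simp: in_keys_iff y_def lookup_map_zero)
    ultimately show ?thesis
      using x by (intro bexI[of _ y]) (auto simp: singular_chain_module_def)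
  qed
  show "x = \<zero>\<^bsub>singular_chain_module X n\<^esub>"
    if "x \<oplus>\<^bsub>singular_chain_module X n\<^esub> x = \<zero>\<^bsub>singular_chain_module X n\<^esub>"
  proof -
    have "x + x = 0" using that by (simp add: singular_chain_module_def)
    then have "lookup x s + lookup x s = 0" for s by (metis lookup_add lookup_zero)
    then show ?thesis by (intro poly_mapping_eqI) (simp add: singular_chain_module_def)
  qed
qed (unfold singular_chain_module_def, rule hom_map_of_int)

lemma common_denominator: "finite A \<Longrightarrow> \<exists>k>0. \<forall>r\<in>A. \<exists>m :: int. of_nat k * r = of_int m" for A :: "rat set"
proof (induction A rule: finite_induct)
  case (insert r A)
  then obtain k where k: "k > 0" "\<forall>r\<in>A. \<exists>m :: int. of_nat k * r = of_int m" by blast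
  obtain a b where ab: "r = Rat.Fract a b" "b > 0" using Rat_cases[of r] by metis
  have "\<exists>m :: int. of_nat (k * nat b) * s = of_int m" if "s \<in> insert r A" for s
  proof (cases "s = r")
    case True
    then have "of_nat (k * nat b) * s = of_int (int k * a)"
      using ab by (simp add: Fract_of_int_quotient)
    then show ?thesis by blast
  next
    case False
    with that k obtain m where "of_nat k * s = of_int m" by blast
    then have "of_nat (k * nat b) * s = of_int (m * b)"
      using ab(2) by (simp add: algebra_simps)
    then show ?thesis by blast
  qed
  moreover have "k * nat b > 0" using k(1) ab(2) by simp
  ultimately show ?case by blast
qed (auto intro: exI[of _ 1])

lemma rational_extension_singular:
  "rational_extension (singular_chain_module X :: int \<Rightarrow> (int, _) module) singular_boundary
     (singular_chain_module X :: int \<Rightarrow> (rat, _) module) singular_boundary (\<lambda>n. Poly_Mapping.map of_int)"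
proof (intro rational_extension.intro differential_complex_singular_int additive_complex_singular
    rational_extension_axioms.intro)
  fix n :: int
  show "Poly_Mapping.map of_int \<in> hom (add_monoid (singular_chain_module X n :: (int, _) module))
      (add_monoid (singular_chain_module X n :: (rat, _) module))"
    unfolding singular_chain_module_def by (rule hom_map_of_int)
  show "\<exists>k>0. \<exists>x\<in>carrier (singular_chain_module X n). [(k :: nat)] \<cdot>\<^bsub>singular_chain_module X n\<^esub> y = Poly_Mapping.map of_int x"
    if y: "y \<in> carrier (singular_chain_module X n)" for y :: "_ \<Rightarrow>\<^sub>0 rat"
  proof -
    obtain k where k: "k > 0" "\<forall>r\<in>lookup y ` keys y. \<exists>m :: int. of_nat k * r = of_int m"
      using common_denominator[of "lookup y ` keys y"] by auto
    \<comment> \<open>The floor only names the integer that \<open>k\<close> times each coefficient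
      already is.\<close>
    define x where "x = Poly_Mapping.map (\<lambda>r. \<lfloor>of_nat k * r\<rfloor>) y"
    have "\<exists>m :: int. of_nat k * lookup y s = of_int m" for s
    proof (cases "s \<in> keys y")
      case False
      then have "of_nat k * lookup y s = of_int 0" by (simp add: in_keys_iff)
      then show ?thesis by blast
    qed (use k(2) in blast)
    then have "poly_scale (of_nat k) y = Poly_Mapping.map of_int x"
      by (intro poly_mapping_eqI) (metis (no_types, lifting) floor_of_int lookup_map_of_int lookup_map_zero
          lookup_poly_scale mult_zero_right x_def floor_zero)
    moreover have "keys x \<subseteq> keys y"
      by (auto simp: in_keys_iff x_def lookup_map_zero)
    ultimately show ?thesis
      using y k(1) by (intro exI[of _ k] conjI bexI[of _ x]) (auto simp: singular_chain_module_def add_pow_free_module)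
  qed
  fix x assume x: "x \<in> carrier (singular_chain_module X n :: (int, _) module)"
  show "singular_boundary n (Poly_Mapping.map of_int x) = (Poly_Mapping.map of_int (singular_boundary n x) :: _ \<Rightarrow>\<^sub>0 rat)"
    by (rule singular_boundary_map_of_int)
  show "x = \<zero>\<^bsub>singular_chain_module X n\<^esub>"
    if "Poly_Mapping.map of_int x = \<zero>\<^bsub>singular_chain_module X n :: (rat, _) module\<^esub>"
  proof -
    have "lookup (Poly_Mapping.map of_int x :: _ \<Rightarrow>\<^sub>0 rat) s = 0" for s
      using that by (simp add: singular_chain_module_def del: lookup_map_of_int)
    then show ?thesis by (intro poly_mapping_eqI) (simp add: singular_chain_module_def)
  qed
qed

subsection \<open>Tensor products\<close>

lemma (in abelian_quotient) coset_eqI: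
  assumes "x \<in> carrier M" "y \<in> carrier M" "x \<ominus>\<^bsub>M\<^esub> y \<in> N"
  shows "N +>\<^bsub>M\<^esub> x = N +>\<^bsub>M\<^esub> y"
proof -
  have "N +>\<^bsub>M\<^esub> x = N +>\<^bsub>M\<^esub> ((x \<ominus>\<^bsub>M\<^esub> y) \<oplus>\<^bsub>M\<^esub> y)"
    using assms(1,2) by (simp add: M.minus_eq M.a_assoc M.l_neg)
  also have "\<dots> = (N +>\<^bsub>M\<^esub> (x \<ominus>\<^bsub>M\<^esub> y)) +>\<^bsub>M\<^esub> y"
    using assms(1,2) M.a_coset_add_assoc[OF N.a_subset, of "x \<ominus>\<^bsub>M\<^esub> y" y] by simp
  also have "\<dots> = N +>\<^bsub>M\<^esub> y"
    using N.a_rcos_const[OF assms(3)] by simp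
  finally show ?thesis .
qed

text \<open>Only the additive group of \<open>N\<close> is fixed, with scalars and elements of
  separate types. This covers both the ring as a module over itself and the ring as an abelian
  group, as needed for Tor.\<close>

locale tensor_product = M: abelian_group M
  for M :: "(int, 'a) module" +
  fixes N :: "('k::comm_ring_1, 'b::comm_ring_1) module"
  assumes N_carrier [simp]: "carrier N = UNIV" and N_add [simp]: "add N = (+)"
begin

abbreviation "R \<equiv> tensor_rel M N"
abbreviation "F \<equiv> tensor_pre M N"

lemma pre_simps [simp]:
  "carrier F = {c. keys c \<subseteq> carrier M \<times> UNIV}" "zero F = 0" "add F = (+)"
  by (simp_all add: tensor_pre_def)

lemma abelian_group_pre: "abelian_group F"
proof (rule abelian_groupI)
  show "\<exists>y\<in>carrier F. y \<oplus>\<^bsub>F\<^esub> x = \<zero>\<^bsub>F\<^esub>" if "x \<in> carrier F" for x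
    using that by (intro bexI[of _ "- x"]) (auto simp: keys_uminus)
qed (auto simp: keys_add_subset add.assoc add.commute)

sublocale F: abelian_group F by (rule abelian_group_pre)

lemma pre_uminus: "x \<in> carrier F \<Longrightarrow> \<ominus>\<^bsub>F\<^esub> x = - x"
  using F.minus_equality[of "- x" x] by (simp add: keys_uminus)

lemma pre_minus: "x \<in> carrier F \<Longrightarrow> y \<in> carrier F \<Longrightarrow> x \<ominus>\<^bsub>F\<^esub> y = x - y"
  using pre_uminus[of y] by (simp add: F.minus_eq)

lemma pre_pow: "[(k :: nat)] \<cdot>\<^bsub>F\<^esub> x = frag_cmul (int k) x"
  by (induction k) (simp_all add: add_pow_def frag_cmul_distrib add.commute)

definition "gens =
   {frag_of (m \<oplus>\<^bsub>M\<^esub> m', y) - frag_of (m, y) - frag_of (m', y) | m m' (y :: 'b).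
       m \<in> carrier M \<and> m' \<in> carrier M \<and> y \<in> carrier N} \<union>
   {frag_of (m, y \<oplus>\<^bsub>N\<^esub> y') - frag_of (m, y) - frag_of (m, y') | m y y'.
       m \<in> carrier M \<and> y \<in> carrier N \<and> y' \<in> carrier N}"

lemma rel_eq: "R = generate (add_monoid F) gens"
  by (simp add: tensor_rel_def gens_def)

lemma keys_diff_subset: "keys a \<subseteq> S \<Longrightarrow> keys b \<subseteq> S \<Longrightarrow> keys (a - b) \<subseteq> S" for a b :: "'c \<Rightarrow>\<^sub>0 int"
  using keys_diff[of a b] by blast

lemma gens_subset: "gens \<subseteq> carrier F"
proof
  fix g assume "g \<in> gens"
  then show "g \<in> carrier F"
    unfolding gens_def by (elim UnE CollectE exE conjE) (simp_all add: keys_diff_subset)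
qed

sublocale T: abelian_quotient F R
proof (intro abelian_quotient.intro abelian_group_pre abelian_quotient_axioms.intro)
  show "subgroup R (add_monoid F)"
    unfolding rel_eq using gens_subset
    by (intro group.generate_is_subgroup F.a_group) simp
qed

lemma tensor_eq: "tensor M N = quotient_module F R"
  by (simp add: tensor_def)

lemma rel_closed:
  "x \<in> R \<Longrightarrow> keys x \<subseteq> carrier M \<times> UNIV"
  "0 \<in> R" "x \<in> R \<Longrightarrow> y \<in> R \<Longrightarrow> x + y \<in> R" "x \<in> R \<Longrightarrow> - x \<in> R"
  "x \<in> R \<Longrightarrow> y \<in> R \<Longrightarrow> x - y \<in> R"
proof -
  show c: "keys x \<subseteq> carrier M \<times> UNIV" if "x \<in> R" for x using T.N.a_Hcarr[OF that] by simp
  show "0 \<in> R" using T.N.zero_closed by simp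
  show add: "x \<in> R \<Longrightarrow> y \<in> R \<Longrightarrow> x + y \<in> R" for x y using T.N.a_closed[of x y] by simp
  show neg: "- x \<in> R" if "x \<in> R" for x
    using T.N.a_inv_closed[OF that] pre_uminus[of x] c[OF that] by simp
  show "x \<in> R \<Longrightarrow> y \<in> R \<Longrightarrow> x - y \<in> R" for x y
    using add[of x "- y"] neg[of y] by simp
qed

lemma rel_left:
  "m \<in> carrier M \<Longrightarrow> m' \<in> carrier M \<Longrightarrow> frag_of (m \<oplus>\<^bsub>M\<^esub> m', y) - frag_of (m, y) - frag_of (m', y) \<in> R"
  unfolding rel_eq by (rule generate.incl) (auto simp: gens_def)

lemma rel_right:
  "m \<in> carrier M \<Longrightarrow> frag_of (m, y + y') - frag_of (m, y) - frag_of (m, y') \<in> R"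
  unfolding rel_eq gens_def
  by (intro generate.incl UnI2 CollectI exI[of _ m] exI[of _ y] exI[of _ y']) simp

lemma rel_induct [consumes 1, case_names left right zero uminus plus]:
  assumes x: "x \<in> R"
    and l: "\<And>m m' y. m \<in> carrier M \<Longrightarrow> m' \<in> carrier M \<Longrightarrow>
       P (frag_of (m \<oplus>\<^bsub>M\<^esub> m', y) - frag_of (m, y) - frag_of (m', y))"
    and r: "\<And>m y y'. m \<in> carrier M \<Longrightarrow> P (frag_of (m, y + y') - frag_of (m, y) - frag_of (m, y'))"
    and "P 0" and neg: "\<And>x. keys x \<subseteq> carrier M \<times> UNIV \<Longrightarrow> P x \<Longrightarrow> P (- x)"
    and add: "\<And>x y. keys x \<subseteq> carrier M \<times> UNIV \<Longrightarrow> keys y \<subseteq> carrier M \<times> UNIV \<Longrightarrow> P x \<Longrightarrow> P y \<Longrightarrow> P (x + y)"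
  shows "P x"
proof -
  have gens: "P g" if "g \<in> gens" for g
    using that l r by (auto simp: gens_def)
  show ?thesis
    using x unfolding rel_eq
  proof induction
    case one
    then show ?case using assms(4) by simp
  next
    case (incl h)
    then show ?case by (rule gens)
  next
    case (inv h)
    have h: "h \<in> carrier F" using inv gens_subset by blast
    then have "inv\<^bsub>add_monoid F\<^esub> h = - h" using pre_uminus[OF h] by (simp add: a_inv_def)
    then show ?case using neg[OF _ gens[OF inv]] h by simp
  next
    case (eng a b)
    then have "a \<in> R" "b \<in> R" by (simp_all add: rel_eq)
    then show ?case using add[OF rel_closed(1) rel_closed(1)] eng by simp
  qed
qed

definition coset :: "('a \<times> 'b \<Rightarrow>\<^sub>0 int) \<Rightarrow> ('a \<times> 'b \<Rightarrow>\<^sub>0 int) set" where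
  "coset x = R +>\<^bsub>F\<^esub> x"

lemma coset_eqI: "x \<in> carrier F \<Longrightarrow> y \<in> carrier F \<Longrightarrow> x - y \<in> R \<Longrightarrow> coset x = coset y"
  unfolding coset_def using T.coset_eqI[of x y] pre_minus[of x y] by simp

lemma coset_zero_iff: "x \<in> carrier F \<Longrightarrow> coset x = \<zero>\<^bsub>tensor M N\<^esub> \<longleftrightarrow> x \<in> R"
  unfolding coset_def tensor_eq by (rule T.coset_zero_iff)

lemma coset_add: "x \<in> carrier F \<Longrightarrow> y \<in> carrier F \<Longrightarrow> coset x \<oplus>\<^bsub>tensor M N\<^esub> coset y = coset (x + y)"
  unfolding coset_def tensor_eq using T.quotient_add[of x y] by simp

lemma carrier_tensor: "X \<in> carrier (tensor M N) \<longleftrightarrow> (\<exists>x\<in>carrier F. X = coset x)"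
  unfolding coset_def tensor_eq by (rule T.quotient_cosets)

lemma coset_closed: "x \<in> carrier F \<Longrightarrow> coset x \<in> carrier (tensor M N)"
  unfolding carrier_tensor by blast

lemma abelian_group_tensor: "abelian_group (tensor M N)"
  unfolding tensor_eq by (rule T.abelian_group_quotient)

lemma coset_pow: "x \<in> carrier F \<Longrightarrow> [(k :: nat)] \<cdot>\<^bsub>tensor M N\<^esub> coset x = coset (frag_cmul (int k) x)"
  unfolding coset_def tensor_eq using T.quotient_pow[of x k] by (simp add: pre_pow)

text \<open>The comparison map to the tensor product; for the field of two elements it plays the
  part of \<rho>, for the rationals that of \<sigma>.\<close>

definition unit_tensor :: "'a \<Rightarrow> ('a \<times> 'b \<Rightarrow>\<^sub>0 int) set" where
  "unit_tensor m = coset (frag_of (m, 1))"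

lemma unit_tensor_hom: "unit_tensor \<in> hom (add_monoid M) (add_monoid (tensor M N))"
proof -
  have "unit_tensor (m \<oplus>\<^bsub>M\<^esub> m') = unit_tensor m \<oplus>\<^bsub>tensor M N\<^esub> unit_tensor m'"
    if "m \<in> carrier M" "m' \<in> carrier M" for m m'
  proof -
    have "unit_tensor (m \<oplus>\<^bsub>M\<^esub> m') = coset (frag_of (m, 1) + frag_of (m', 1))"
      unfolding unit_tensor_def
      using that rel_left[OF that, of 1] by (intro coset_eqI) (auto simp: keys_add_subset diff_diff_eq)
    then show ?thesis
      unfolding unit_tensor_def using that by (simp add: coset_add)
  qed
  moreover have "unit_tensor m \<in> carrier (tensor M N)" if "m \<in> carrier M" for m
    unfolding unit_tensor_def using that by (intro coset_closed) simp
  ultimately show ?thesis by (auto simp: hom_def)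
qed

text \<open>A map that is additive modulo the relations is determined by its value at 1. Used in
  each factor, this moves integers across the tensor sign.\<close>

lemma int_multiple_rel:
  fixes h :: "int \<Rightarrow> _"
  assumes h: "\<And>a b. h (a + b) - h a - h b \<in> R"
  shows "h a - frag_cmul a (h 1) \<in> R"
proof (induction a rule: int_induct[where k = 0])
  case base
  show ?case using rel_closed(4)[OF h[of 0 0]] by simp
next
  case (step1 a)
  have eq: "h (a + 1) - frag_cmul (a + 1) (h 1) = (h (a + 1) - h a - h 1) + (h a - frag_cmul a (h 1))"
    by (simp add: frag_cmul_distrib)
  show ?case unfolding eq by (rule rel_closed(3)[OF h step1(2)])
next
  case (step2 a)
  have eq: "h (a - 1) - frag_cmul (a - 1) (h 1) = (h a - frag_cmul a (h 1)) - (h (a - 1 + 1) - h (a - 1) - h 1)"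
    by (simp add: frag_cmul_distrib[of "a - 1" 1, simplified])
  show ?case unfolding eq by (rule rel_closed(5)[OF step2(2) h])
qed

lemma rel_frag_of_zero_right: "m \<in> carrier M \<Longrightarrow> frag_of (m, 0) \<in> R"
  using rel_closed(4)[OF rel_right[of m 0 0]] by simp

lemma rel_frag_of_zero_left: "frag_of (\<zero>\<^bsub>M\<^esub>, y) \<in> R"
  using rel_closed(4)[OF rel_left[of "\<zero>\<^bsub>M\<^esub>" "\<zero>\<^bsub>M\<^esub>" y]] by simp

lemma rel_frag_of_minus:
  assumes "m \<in> carrier M" "m' \<in> carrier M"
  shows "frag_of (m, y) - frag_of (m', y) - frag_of (m \<ominus>\<^bsub>M\<^esub> m', y) \<in> R"
proof -
  have "(m \<ominus>\<^bsub>M\<^esub> m') \<oplus>\<^bsub>M\<^esub> m' = m"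
    using assms by (simp add: M.minus_eq M.a_assoc M.l_neg)
  then show ?thesis
    using rel_left[of "m \<ominus>\<^bsub>M\<^esub> m'" m' y] assms by (simp add: algebra_simps)
qed

end


locale tensor_functor =
  dom: tensor_product M N + cod: tensor_product M' N
  for M :: "(int, 'a) module" and M' :: "(int, 'c) module" and N :: "('k::comm_ring_1, 'b::comm_ring_1) module" +
  fixes f
  assumes f_hom: "f \<in> hom (add_monoid M) (add_monoid M')"
begin

definition "push = frag_extend (\<lambda>(m, y). frag_of (f m, y :: 'b))"

lemma push_simps [simp]: "push (frag_of (m, y)) = frag_of (f m, y)"
  "push (a + b) = push a + push b" "push (a - b) = push a - push b" "push (- a) = - push a" "push 0 = 0"
  by (simp_all add: push_def frag_extend_add frag_extend_diff frag_extend_minus)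

lemma f_simps [simp]: "m \<in> carrier M \<Longrightarrow> f m \<in> carrier M'"
  "m \<in> carrier M \<Longrightarrow> m' \<in> carrier M \<Longrightarrow> f (m \<oplus>\<^bsub>M\<^esub> m') = f m \<oplus>\<^bsub>M'\<^esub> f m'"
  using f_hom by (auto simp: hom_def)

lemma push_closed: "x \<in> carrier dom.F \<Longrightarrow> push x \<in> carrier cod.F"
proof -
  assume "x \<in> carrier dom.F"
  then have "keys x \<subseteq> carrier M \<times> UNIV" by simp
  then have "keys (push x) \<subseteq> carrier M' \<times> UNIV"
  proof (induction x rule: frag_induction)
    case (diff a b)
    then show ?case by (simp add: cod.keys_diff_subset)
  qed auto
  then show ?thesis by simp
qed

lemma push_rel: "x \<in> dom.R \<Longrightarrow> push x \<in> cod.R"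
  by (induction rule: dom.rel_induct) (simp_all add: cod.rel_left cod.rel_right cod.rel_closed)

text \<open>\<open>tensor_map\<close> pushes forward a whole coset and then adds the relations of
  the target. As relations go to relations, any single representative determines the result.\<close>

lemma tensor_map_coset:
  assumes x: "x \<in> carrier dom.F"
  shows "tensor_map M' N f (dom.coset x) = cod.coset (push x)"
proof -
  have "tensor_map M' N f (dom.coset x) = (\<Union>r\<in>cod.R. \<Union>r'\<in>dom.R. {r + (push r' + push x)})"
    by (auto simp: tensor_map_def set_add_def' dom.coset_def a_r_coset_def' push_def[symmetric])
  also have "\<dots> = (\<Union>r\<in>cod.R. {r + push x})"
  proof (intro subset_antisym subsetI)
    fix z assume "z \<in> (\<Union>r\<in>cod.R. \<Union>r'\<in>dom.R. {r + (push r' + push x)})"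
    then obtain r r' where r: "r \<in> cod.R" "r' \<in> dom.R" "z = r + (push r' + push x)" by blast
    then have "z = (r + push r') + push x" "r + push r' \<in> cod.R"
      using cod.rel_closed(3) push_rel by (simp_all add: add.assoc)
    then show "z \<in> (\<Union>r\<in>cod.R. {r + push x})" by blast
  next
    fix z assume "z \<in> (\<Union>r\<in>cod.R. {r + push x})"
    then obtain r where "r \<in> cod.R" "z = r + (push 0 + push x)" by auto
    then show "z \<in> (\<Union>r\<in>cod.R. \<Union>r'\<in>dom.R. {r + (push r' + push x)})"
      using dom.rel_closed(2) by blast
  qed
  also have "\<dots> = cod.coset (push x)"
    by (auto simp: cod.coset_def a_r_coset_def')
  finally show ?thesis .
qed

lemma tensor_map_unit_tensor: "m \<in> carrier M \<Longrightarrow> tensor_map M' N f (dom.unit_tensor m) = cod.unit_tensor (f m)"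
  unfolding dom.unit_tensor_def cod.unit_tensor_def by (subst tensor_map_coset) simp_all

lemma tensor_map_hom: "tensor_map M' N f \<in> hom (add_monoid (tensor M N)) (add_monoid (tensor M' N))"
proof -
  have "tensor_map M' N f X \<in> carrier (tensor M' N)" if X: "X \<in> carrier (tensor M N)" for X
  proof -
    obtain x where x: "x \<in> carrier dom.F" "X = dom.coset x" using X dom.carrier_tensor by blast
    then show ?thesis using tensor_map_coset[OF x(1)] cod.coset_closed[OF push_closed[OF x(1)]] by simp
  qed
  moreover have "tensor_map M' N f (X \<oplus>\<^bsub>tensor M N\<^esub> Y) = tensor_map M' N f X \<oplus>\<^bsub>tensor M' N\<^esub> tensor_map M' N f Y"
    if X: "X \<in> carrier (tensor M N)" and Y: "Y \<in> carrier (tensor M N)" for X Y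
  proof -
    obtain x where x: "x \<in> carrier dom.F" "X = dom.coset x" using X dom.carrier_tensor by blast
    obtain y where y: "y \<in> carrier dom.F" "Y = dom.coset y" using Y dom.carrier_tensor by blast
    have "x + y \<in> carrier dom.F" using dom.F.a_closed[OF x(1) y(1)] by simp
    then show ?thesis
      using dom.coset_add[OF x(1) y(1)] cod.coset_add[OF push_closed[OF x(1)] push_closed[OF y(1)]]
      by (simp only: x(2) y(2) tensor_map_coset x(1) y(1) push_simps)
  qed
  ultimately show ?thesis by (auto simp: hom_def)
qed

end

subsection \<open>Tensor product with the field of two elements\<close>

locale mod_2_tensor = tensor_product M N + module class_ring M
  for M :: "(int, 'a) module" and N :: "('k::comm_ring_1, bit) module"
begin

lemma Tor_aug_superset:
  assumes "finite S" "keys c \<subseteq> S" "S \<subseteq> carrier M"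
  shows "Tor_aug M c = (\<Oplus>\<^bsub>M\<^esub>a\<in>S. lookup c a \<odot>\<^bsub>M\<^esub> a)"
  unfolding Tor_aug_def
proof (rule M.add.finprod_mono_neutral_cong_left)
  show "lookup c i \<odot>\<^bsub>M\<^esub> i = \<zero>\<^bsub>M\<^esub>" if "i \<in> S - keys c" for i
    using that assms(3) lmult_0[of i] by (auto simp: in_keys_iff)
qed (use assms in \<open>auto intro!: smult_closed\<close>)

lemma Tor_aug_closed: "keys c \<subseteq> carrier M \<Longrightarrow> Tor_aug M c \<in> carrier M"
  unfolding Tor_aug_def by (rule M.finsum_closed) (auto intro!: smult_closed)

lemma Tor_aug_add:
  assumes "keys a \<subseteq> carrier M" "keys b \<subseteq> carrier M"
  shows "Tor_aug M (a + b) = Tor_aug M a \<oplus>\<^bsub>M\<^esub> Tor_aug M b"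
proof -
  let ?S = "keys a \<union> keys b"
  have S: "finite ?S" "?S \<subseteq> carrier M" using assms by auto
  have "Tor_aug M (a + b) = (\<Oplus>\<^bsub>M\<^esub>x\<in>?S. (lookup a x \<odot>\<^bsub>M\<^esub> x) \<oplus>\<^bsub>M\<^esub> (lookup b x \<odot>\<^bsub>M\<^esub> x))"
    unfolding Tor_aug_superset[OF S(1) Poly_Mapping.keys_add S(2)]
    using S(2) smult_l_distr
    by (intro M.finsum_cong') (auto simp: lookup_add intro!: smult_closed M.a_closed)
  also have "\<dots> = Tor_aug M a \<oplus>\<^bsub>M\<^esub> Tor_aug M b"
    unfolding Tor_aug_superset[OF S(1) Un_upper1 S(2)] Tor_aug_superset[OF S(1) Un_upper2 S(2)]
    using S(2) by (intro M.finsum_addf) (auto intro!: smult_closed)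
  finally show ?thesis .
qed

lemma Tor_aug_zero [simp]: "Tor_aug M 0 = \<zero>\<^bsub>M\<^esub>"
  by (simp add: Tor_aug_def)

lemma Tor_aug_uminus: "keys a \<subseteq> carrier M \<Longrightarrow> Tor_aug M (- a) = \<ominus>\<^bsub>M\<^esub> Tor_aug M a"
  using Tor_aug_add[of "- a" a] Tor_aug_closed[of a] Tor_aug_closed[of "- a"]
  by (intro M.minus_equality[symmetric]) (simp_all add: keys_uminus)

lemma Tor_aug_diff: "keys a \<subseteq> carrier M \<Longrightarrow> keys b \<subseteq> carrier M \<Longrightarrow>
    Tor_aug M (a - b) = Tor_aug M a \<ominus>\<^bsub>M\<^esub> Tor_aug M b"
  using Tor_aug_add[of a "- b"] Tor_aug_uminus[of b] by (simp add: keys_uminus M.minus_eq)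

lemma Tor_aug_frag_of [simp]: "m \<in> carrier M \<Longrightarrow> Tor_aug M (frag_of m) = m"
  by (simp add: Tor_aug_def smult_one[simplified])

text \<open>The contraction \<open>m \<otimes> y \<mapsto> y m\<close> is only well defined up to doubles.\<close>

definition contract :: "('a \<times> bit \<Rightarrow>\<^sub>0 int) \<Rightarrow> 'a" where
  "contract x = Tor_aug M (frag_extend (\<lambda>(m, y). if y = 0 then 0 else frag_of m) x)"

lemma contract_keys: "keys x \<subseteq> carrier M \<times> UNIV \<Longrightarrow>
    keys (frag_extend (\<lambda>(m, y :: bit). if y = 0 then 0 else frag_of m) x) \<subseteq> carrier M"
proof (induction x rule: frag_induction)
  case (diff a b)
  then show ?case by (simp add: frag_extend_diff keys_diff_subset)
qed (auto split: if_splits)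

lemma contract_rel: "x \<in> R \<Longrightarrow> \<exists>w\<in>carrier M. contract x = w \<oplus>\<^bsub>M\<^esub> w"
proof (induction rule: rel_induct)
  case (left m m' y)
  have "m \<oplus>\<^bsub>M\<^esub> m' \<ominus>\<^bsub>M\<^esub> m \<ominus>\<^bsub>M\<^esub> m' = \<zero>\<^bsub>M\<^esub>"
    using left by (simp add: M.minus_eq M.a_ac M.r_neg M.r_neg1)
  then have "contract (frag_of (m \<oplus>\<^bsub>M\<^esub> m', y) - frag_of (m, y) - frag_of (m', y)) = \<zero>\<^bsub>M\<^esub> \<oplus>\<^bsub>M\<^esub> \<zero>\<^bsub>M\<^esub>"
    using left by (simp add: contract_def frag_extend_diff Tor_aug_diff keys_diff_subset)
  then show ?case using M.zero_closed by blast
next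
  case (right m y y')
  consider "y = 0 \<or> y' = 0" | "y = 1" "y' = 1" by fastforce
  then show ?case
  proof cases
    case 1
    then have "contract (frag_of (m, y + y') - frag_of (m, y) - frag_of (m, y')) = \<zero>\<^bsub>M\<^esub> \<oplus>\<^bsub>M\<^esub> \<zero>\<^bsub>M\<^esub>"
      by (auto simp: contract_def frag_extend_diff)
    then show ?thesis using M.zero_closed by blast
  next
    \<comment> \<open>The only relation with a nontrivial contraction: 1 + 1 = 0 in the field, so
      what remains is minus the double of \<open>m\<close>.\<close>
    case 2
    then have "contract (frag_of (m, y + y') - frag_of (m, y) - frag_of (m, y')) = (\<ominus>\<^bsub>M\<^esub> m) \<oplus>\<^bsub>M\<^esub> (\<ominus>\<^bsub>M\<^esub> m)"
      using right by (simp add: contract_def frag_extend_diff Tor_aug_diff Tor_aug_uminus keys_uminus M.minus_eq)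
    then show ?thesis using right by blast
  qed
next
  case zero
  have "contract 0 = \<zero>\<^bsub>M\<^esub> \<oplus>\<^bsub>M\<^esub> \<zero>\<^bsub>M\<^esub>" by (simp add: contract_def)
  then show ?case using M.zero_closed by blast
next
  case (uminus x)
  then obtain w where w: "w \<in> carrier M" "contract x = w \<oplus>\<^bsub>M\<^esub> w" by blast
  then have "contract (- x) = (\<ominus>\<^bsub>M\<^esub> w) \<oplus>\<^bsub>M\<^esub> (\<ominus>\<^bsub>M\<^esub> w)"
    using contract_keys[OF uminus(1)] M.minus_add[OF w(1) w(1)]
    by (simp add: contract_def frag_extend_minus Tor_aug_uminus)
  then show ?case using w(1) by blast
next
  case (plus x y)
  then obtain w v where w: "w \<in> carrier M" "contract x = w \<oplus>\<^bsub>M\<^esub> w" "v \<in> carrier M" "contract y = v \<oplus>\<^bsub>M\<^esub> v" by blast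
  then have "contract (x + y) = (w \<oplus>\<^bsub>M\<^esub> v) \<oplus>\<^bsub>M\<^esub> (w \<oplus>\<^bsub>M\<^esub> v)"
    using contract_keys[OF plus(1)] contract_keys[OF plus(2)]
    by (simp add: contract_def frag_extend_add Tor_aug_add M.a_ac)
  then show ?case using w by blast
qed

lemma unit_tensor_eq_zero:
  assumes m: "m \<in> carrier M" and z: "unit_tensor m = \<zero>\<^bsub>tensor M N\<^esub>"
  shows "\<exists>w\<in>carrier M. m = w \<oplus>\<^bsub>M\<^esub> w"
proof -
  have "frag_of (m, 1) \<in> R"
    using z m coset_zero_iff[of "frag_of (m, 1)"] by (simp add: unit_tensor_def)
  from contract_rel[OF this] show ?thesis using m by (simp add: contract_def)
qed

lemma unit_tensor_double:
  assumes m: "m \<in> carrier M"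
  shows "unit_tensor (m \<oplus>\<^bsub>M\<^esub> m) = \<zero>\<^bsub>tensor M N\<^esub>"
proof -
  \<comment> \<open>The computation 2m (x) 1 = m (x) (1 + 1) = m (x) 0 = 0, written with one
    relation for each equality.\<close>
  have "frag_of (m \<oplus>\<^bsub>M\<^esub> m, 1) = (frag_of (m \<oplus>\<^bsub>M\<^esub> m, 1) - frag_of (m, 1) - frag_of (m, 1))
     - (frag_of (m, 1 + 1) - frag_of (m, 1) - frag_of (m, 1)) + frag_of (m, 0 :: bit)"
    by simp
  also have "\<dots> \<in> R"
    by (intro rel_closed(3,5) rel_left rel_right rel_frag_of_zero_right m)
  finally show ?thesis
    using m coset_zero_iff[of "frag_of (m \<oplus>\<^bsub>M\<^esub> m, 1)"] by (simp add: unit_tensor_def)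
qed

lemma unit_tensor_surj: "carrier (tensor M N) \<subseteq> unit_tensor ` carrier M"
proof
  fix X assume "X \<in> carrier (tensor M N)"
  then obtain x where x: "x \<in> carrier F" "X = coset x" using carrier_tensor by blast
  then have "keys x \<subseteq> carrier M \<times> UNIV" by simp
  then have "\<exists>m\<in>carrier M. x - frag_of (m, 1) \<in> R"
  proof (induction x rule: frag_induction)
    case zero
    show ?case using rel_closed(4)[OF rel_frag_of_zero_left[of 1]] by (intro bexI[of _ "\<zero>\<^bsub>M\<^esub>"]) auto
  next
    case (one p)
    then obtain m y where p: "p = (m, y)" "m \<in> carrier M" by auto
    show ?case
    proof (cases "y = 0")
      case True
      then show ?thesis
        using p rel_closed(5)[OF rel_frag_of_zero_right[OF p(2)] rel_frag_of_zero_left[of 1]]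
        by (intro bexI[of _ "\<zero>\<^bsub>M\<^esub>"]) auto
    next
      case False
      then show ?thesis using p rel_closed(2) by (intro bexI[of _ m]) auto
    qed
  next
    case (diff a b)
    then obtain m m' where m: "m \<in> carrier M" "a - frag_of (m, 1) \<in> R" "m' \<in> carrier M" "b - frag_of (m', 1) \<in> R"
      by blast
    have eq: "a - b - frag_of (m \<ominus>\<^bsub>M\<^esub> m', 1) = (a - frag_of (m, 1)) - (b - frag_of (m', 1))
        + (frag_of (m, 1) - frag_of (m', 1) - frag_of (m \<ominus>\<^bsub>M\<^esub> m', 1 :: bit))"
      by simp
    have "a - b - frag_of (m \<ominus>\<^bsub>M\<^esub> m', 1) \<in> R"
      unfolding eq by (intro rel_closed(3,5) rel_frag_of_minus m)
    then show ?case using m by blast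
  qed
  then obtain m where m: "m \<in> carrier M" "x - frag_of (m, 1) \<in> R" by blast
  then have "X = unit_tensor m"
    unfolding x(2) unit_tensor_def using x(1) by (intro coset_eqI) simp_all
  with m(1) show "X \<in> unit_tensor ` carrier M" by blast
qed

end

subsection \<open>Tensor product with the rationals\<close>

lemma frag_cmul_diff: "frag_cmul c (a - b) = frag_cmul c a - frag_cmul c b"
  by (rule poly_mapping_eqI) (simp add: lookup_minus right_diff_distrib)

locale rational_tensor = tensor_product M N + module class_ring M
  for M :: "(int, 'a) module" and N :: "('k::comm_ring_1, rat) module"
begin

lemma rel_cmul: "x \<in> R \<Longrightarrow> frag_cmul c x \<in> R"
proof (induction c rule: int_induct[where k = 0])
  case base
  show ?case using rel_closed(2) by simp
next
  case (step1 c)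
  have eq: "frag_cmul (c + 1) x = frag_cmul c x + x" by (simp add: frag_cmul_distrib)
  show ?case unfolding eq by (rule rel_closed(3)[OF step1(2)[OF step1(3)] step1(3)])
next
  case (step2 c)
  have eq: "frag_cmul (c - 1) x = frag_cmul c x - x"
    by (simp add: frag_cmul_distrib[of "c - 1" 1, simplified])
  show ?case unfolding eq by (rule rel_closed(5)[OF step2(2)[OF step2(3)] step2(3)])
qed

lemma rel_smult:
  assumes "m \<in> carrier M"
  shows "frag_of (a \<odot>\<^bsub>M\<^esub> m, y) - frag_cmul a (frag_of (m, y)) \<in> R"
proof -
  have "frag_of (a \<odot>\<^bsub>M\<^esub> m, y) - frag_cmul a (frag_of (1 \<odot>\<^bsub>M\<^esub> m, y)) \<in> R"
  proof (rule int_multiple_rel)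
    fix a b :: int
    have "(a + b) \<odot>\<^bsub>M\<^esub> m = a \<odot>\<^bsub>M\<^esub> m \<oplus>\<^bsub>M\<^esub> b \<odot>\<^bsub>M\<^esub> m"
      using smult_l_distr[of a b m] assms by simp
    then show "frag_of ((a + b) \<odot>\<^bsub>M\<^esub> m, y) - frag_of (a \<odot>\<^bsub>M\<^esub> m, y) - frag_of (b \<odot>\<^bsub>M\<^esub> m, y) \<in> R"
      using rel_left[of "a \<odot>\<^bsub>M\<^esub> m" "b \<odot>\<^bsub>M\<^esub> m" y] smult_closed[of _ m] assms by simp
  qed
  then show ?thesis using smult_one[OF assms] by simp
qed

lemma rel_of_int_mult:
  assumes "m \<in> carrier M"
  shows "frag_of (m, of_int a * y) - frag_cmul a (frag_of (m, y)) \<in> R"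
proof -
  have "frag_of (m, of_int a * y) - frag_cmul a (frag_of (m, of_int 1 * y)) \<in> R"
  proof (rule int_multiple_rel)
    fix a b :: int
    show "frag_of (m, of_int (a + b) * y) - frag_of (m, of_int a * y) - frag_of (m, of_int b * y) \<in> R"
      using rel_right[OF assms, of "of_int a * y" "of_int b * y"] by (simp add: distrib_right)
  qed
  then show ?thesis by simp
qed

text \<open>A generator m (x) a/b becomes (a m) (x) 1 after multiplication by b; for a difference,
  the product of the two multipliers serves both terms.\<close>

lemma unit_tensor_dense:
  assumes X: "X \<in> carrier (tensor M N)"
  shows "\<exists>k>0. \<exists>m\<in>carrier M. [(k :: nat)] \<cdot>\<^bsub>tensor M N\<^esub> X = unit_tensor m"
proof -
  obtain x where x: "x \<in> carrier F" "X = coset x" using X carrier_tensor by blast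
  then have "keys x \<subseteq> carrier M \<times> UNIV" by simp
  then have "\<exists>k>0. \<exists>m\<in>carrier M. frag_cmul (int k) x - frag_of (m, 1) \<in> R"
  proof (induction x rule: frag_induction)
    case zero
    show ?case
      using rel_closed(4)[OF rel_frag_of_zero_left[of 1]]
      by (intro exI[of _ 1] conjI bexI[of _ "\<zero>\<^bsub>M\<^esub>"]) auto
  next
    case (one p)
    then obtain m y where p: "p = (m, y)" "m \<in> carrier M" by auto
    obtain a b where ab: "y = Rat.Fract a b" "b > 0" using Rat_cases[of y] by metis
    then have y: "of_int b * y = of_int a * 1" by (simp add: Fract_of_int_quotient)
    have eq: "frag_cmul b (frag_of (m, y)) - frag_of (a \<odot>\<^bsub>M\<^esub> m, 1) =
       (frag_of (m, of_int a * 1) - frag_cmul a (frag_of (m, 1))) - (frag_of (m, of_int b * y) - frag_cmul b (frag_of (m, y)))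
        - (frag_of (a \<odot>\<^bsub>M\<^esub> m, 1) - frag_cmul a (frag_of (m, 1)))"
      unfolding y by (simp only: diff_diff_eq2 algebra_simps)
    have "frag_cmul b (frag_of (m, y)) - frag_of (a \<odot>\<^bsub>M\<^esub> m, 1) \<in> R"
      unfolding eq by (intro rel_closed(5) rel_smult rel_of_int_mult p)
    then show ?case
      using p ab(2) smult_closed[of a m] by (intro exI[of _ "nat b"] conjI bexI[of _ "a \<odot>\<^bsub>M\<^esub> m"]) auto
  next
    case (diff a b)
    then obtain k m l m' where k: "k > 0" "m \<in> carrier M" "frag_cmul (int k) a - frag_of (m, 1) \<in> R"
      and l: "l > 0" "m' \<in> carrier M" "frag_cmul (int l) b - frag_of (m', 1) \<in> R"
      by blast
    let ?m = "int l \<odot>\<^bsub>M\<^esub> m" and ?m' = "int k \<odot>\<^bsub>M\<^esub> m'"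
    have m: "?m \<in> carrier M" "?m' \<in> carrier M" using k(2) l(2) smult_closed by auto
    have "frag_cmul (int (k * l)) (a - b) = frag_cmul (int l) (frag_cmul (int k) a) - frag_cmul (int k) (frag_cmul (int l) b)"
      by (simp add: frag_cmul_diff mult.commute)
    then have eq: "frag_cmul (int (k * l)) (a - b) - frag_of (?m \<ominus>\<^bsub>M\<^esub> ?m', 1) =
        frag_cmul (int l) (frag_cmul (int k) a - frag_of (m, 1)) - frag_cmul (int k) (frag_cmul (int l) b - frag_of (m', 1))
        - (frag_of (?m, 1) - frag_cmul (int l) (frag_of (m, 1))) + (frag_of (?m', 1) - frag_cmul (int k) (frag_of (m', 1)))
        + (frag_of (?m, 1) - frag_of (?m', 1) - frag_of (?m \<ominus>\<^bsub>M\<^esub> ?m', 1 :: rat))"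
      by (simp add: frag_cmul_diff)
    have "frag_cmul (int (k * l)) (a - b) - frag_of (?m \<ominus>\<^bsub>M\<^esub> ?m', 1) \<in> R"
      unfolding eq by (intro rel_closed(3,5) rel_cmul rel_smult rel_frag_of_minus k l m)
    moreover have "k * l > 0" using k(1) l(1) by simp
    ultimately show ?case using m by blast
  qed
  then obtain k m where k: "k > 0" "m \<in> carrier M" "frag_cmul (int k) x - frag_of (m, 1) \<in> R" by blast
  have "frag_cmul (int k) x \<in> carrier F" using x(1) keys_cmul[of "int k" x] by auto
  then have "coset (frag_cmul (int k) x) = unit_tensor m"
    unfolding unit_tensor_def using k by (intro coset_eqI) simp_all
  then show ?thesis using k x coset_pow[OF x(1), of k] by auto
qed

text \<open>The additive map \<phi> extends to m (x) y -> y \<phi>(m), with values in a rational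
  vector space. Since the extension respects the bilinearity relations, m (x) 1 = 0 forces \<phi>(m)
  = 0; an injective \<phi> thus makes \<open>unit_tensor\<close> injective.\<close>

lemma unit_tensor_inj:
  fixes \<phi> :: "'a \<Rightarrow> ('b \<Rightarrow>\<^sub>0 int)"
  assumes \<phi>: "\<And>m m'. m \<in> carrier M \<Longrightarrow> m' \<in> carrier M \<Longrightarrow> \<phi> (m \<oplus>\<^bsub>M\<^esub> m') = \<phi> m + \<phi> m'"
    and m: "m \<in> carrier M" and z: "unit_tensor m = \<zero>\<^bsub>tensor M N\<^esub>"
  shows "\<phi> m = 0"
proof -
  define g :: "'a \<times> rat \<Rightarrow> ('b \<Rightarrow>\<^sub>0 rat)" where "g = (\<lambda>(m, y). poly_scale y (Poly_Mapping.map of_int (\<phi> m)))"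
  define G where "G x = linear_extension g (Poly_Mapping.map of_int x)" for x :: "'a \<times> rat \<Rightarrow>\<^sub>0 int"
  have map_add: "(Poly_Mapping.map of_int (x + y) :: _ \<Rightarrow>\<^sub>0 rat) = Poly_Mapping.map of_int x + Poly_Mapping.map of_int y"
    for x y :: "'a \<times> rat \<Rightarrow>\<^sub>0 int"
    by (rule poly_mapping_eqI) (simp add: lookup_add)
  have G_add: "G (x + y) = G x + G y" for x y
    by (simp add: G_def map_add linear_extension_add)
  have G_0: "G 0 = 0" using G_add[of 0 0] by simp
  have G_neg: "G (- x) = - G x" for x
    using G_add[of "- x" x] G_0 by (simp add: eq_neg_iff_add_eq_0)
  have G_diff: "G (x - y) = G x - G y" for x y
    using G_add[of x "- y"] by (simp add: G_neg)
  have G_of: "G (frag_of p) = g p" for p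
  proof (rule poly_mapping_eqI)
    fix b
    have "keys (Poly_Mapping.map of_int (frag_of p) :: _ \<Rightarrow>\<^sub>0 rat) \<subseteq> {p}"
      by (auto simp: in_keys_iff lookup_single when_def split: if_splits)
    then show "lookup (G (frag_of p)) b = lookup (g p) b"
      by (simp add: G_def lookup_linear_extension[where S = "{p}"])
  qed
  have G_rel: "G x = 0" if "x \<in> R" for x
    using that
  proof (induction rule: rel_induct)
    case (left m m' y)
    show ?case
      by (rule poly_mapping_eqI)
        (simp add: G_add G_diff G_of g_def \<phi>[OF left] lookup_add lookup_minus algebra_simps)
  next
    case (right m y y')
    show ?case
      by (rule poly_mapping_eqI) (simp add: G_add G_diff G_of g_def lookup_add lookup_minus algebra_simps)
  qed (simp_all add: G_0 G_neg G_add)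
  have "frag_of (m, 1) \<in> R"
    using z m coset_zero_iff[of "frag_of (m, 1)"] by (simp add: unit_tensor_def)
  then have "g (m, 1) = 0" using G_rel G_of by metis
  then have "lookup (g (m, 1)) b = 0" for b by simp
  then show ?thesis by (intro poly_mapping_eqI) (simp add: g_def)
qed

end

subsection \<open>Tensor products of complexes\<close>

lemma additive_complex_tensor:
  fixes N :: "('k::comm_ring_1, 'b::comm_ring_1) module"
  assumes C: "additive_complex C d" and N: "carrier N = UNIV" "add N = (+)"
  shows "additive_complex (\<lambda>n. tensor (C n) N) (\<lambda>n. tensor_map (C (n - 1)) N (d n))"
proof -
  interpret additive_complex C d by (rule C)
  have t: "tensor_product (C n) N" for n
    by (intro tensor_product.intro abelian tensor_product_axioms.intro N)
  show ?thesis
  proof (rule additive_complex.intro)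
    show "abelian_group (tensor (C n) N)" for n
      by (rule tensor_product.abelian_group_tensor[OF t])
    show "tensor_map (C (n - 1)) N (d n) \<in> hom (add_monoid (tensor (C n) N)) (add_monoid (tensor (C (n - 1)) N))" for n
      by (rule tensor_functor.tensor_map_hom) (intro tensor_functor.intro t tensor_functor_axioms.intro hom)
  qed
qed

lemma tensor_map_unit_tensor:
  fixes N :: "('k::comm_ring_1, 'b::comm_ring_1) module"
  assumes C: "additive_complex C d" and N: "carrier N = UNIV" "add N = (+)" and x: "x \<in> carrier (C n)"
  shows "tensor_map (C (n - 1)) N (d n) (tensor_product.unit_tensor (C n) N x) =
    tensor_product.unit_tensor (C (n - 1)) N (d n x)"
proof -
  interpret additive_complex C d by (rule C)
  have t: "tensor_product (C n) N" for n
    by (intro tensor_product.intro abelian tensor_product_axioms.intro N)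
  show ?thesis
    by (rule tensor_functor.tensor_map_unit_tensor[OF _ x]) (intro tensor_functor.intro t tensor_functor_axioms.intro hom)
qed

lemma free_abelian_embedding:
  fixes M :: "(int, 'a) module"
  assumes M: "abelian_group M" and free: "free_abelian M"
  obtains \<phi> :: "'a \<Rightarrow> ('a \<Rightarrow>\<^sub>0 int)" where
    "\<And>m m'. m \<in> carrier M \<Longrightarrow> m' \<in> carrier M \<Longrightarrow> \<phi> (m \<oplus>\<^bsub>M\<^esub> m') = \<phi> m + \<phi> m'"
    "\<And>m. m \<in> carrier M \<Longrightarrow> \<phi> m = 0 \<Longrightarrow> m = \<zero>\<^bsub>M\<^esub>"
proof -
  interpret abelian_group M by (rule M)
  obtain B \<phi> where \<phi>: "\<phi> \<in> iso (add_monoid M) (free_Abelian_group (B :: 'a set))"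
    using free by (auto simp: free_abelian_def is_iso_def)
  have add: "\<phi> (m \<oplus>\<^bsub>M\<^esub> m') = \<phi> m + \<phi> m'" if "m \<in> carrier M" "m' \<in> carrier M" for m m'
    using \<phi> that by (auto simp: iso_def hom_def)
  have "\<phi> \<zero>\<^bsub>M\<^esub> = 0" using add[of "\<zero>\<^bsub>M\<^esub>" "\<zero>\<^bsub>M\<^esub>"] by simp
  moreover have "inj_on \<phi> (carrier M)" using \<phi> by (auto simp: iso_def bij_betw_def)
  ultimately have "m = \<zero>\<^bsub>M\<^esub>" if "m \<in> carrier M" "\<phi> m = 0" for m
    using that zero_closed by (metis inj_onD)
  with add show ?thesis using that by blast
qed

text \<open>Freeness enters both parts through an embedding into finitely supported integer
  functions: it excludes 2-torsion, and it makes \<open>unit_tensor\<close> injective over the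
  rationals.\<close>

lemma
  fixes C :: "int \<Rightarrow> (int, 'a) module"
  assumes C: "chain_complex C d" and free: "\<And>n. free_abelian (C n)"
  shows mod_2_reduction_tensor:
      "mod_2_reduction C d (\<lambda>n. tensor (C n) (self_module TYPE(bit)))
        (\<lambda>n. tensor_map (C (n - 1)) (self_module TYPE(bit)) (d n))
        (\<lambda>n. tensor_product.unit_tensor (C n) (self_module TYPE(bit)))"
    and rational_extension_tensor:
      "rational_extension C d (\<lambda>n. tensor (C n) (self_module TYPE(rat)))
        (\<lambda>n. tensor_map (C (n - 1)) (self_module TYPE(rat)) (d n))
        (\<lambda>n. tensor_product.unit_tensor (C n) (self_module TYPE(rat)))"
proof -
  have cpl: "differential_complex C d" by (rule differential_complex_chain_complex[OF C])
  have ac: "additive_complex C d" by (rule additive_complex_chain_complex[OF C])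
  have mod: "Module.module class_ring (C n)" for n using C by (simp add: chain_complex_def)
  have ab: "abelian_group (C n)" for n by (rule additive_complex.abelian[OF ac])
  have N: "carrier (self_module TYPE('k)) = UNIV" "add (self_module TYPE('k)) = (+)" for k :: "'k::comm_ring_1"
    by (simp_all add: self_module_def)
  have N2: "carrier (self_module TYPE(bit)) = UNIV" "add (self_module TYPE(bit)) = (+)"
    and NQ: "carrier (self_module TYPE(rat)) = UNIV" "add (self_module TYPE(rat)) = (+)"
    by (simp_all add: self_module_def)
  have t2: "mod_2_tensor (C n) (self_module TYPE(bit))" for n
    by (intro mod_2_tensor.intro tensor_product.intro tensor_product_axioms.intro ab mod N2)
  have tQ: "rational_tensor (C n) (self_module TYPE(rat))" for n
    by (intro rational_tensor.intro tensor_product.intro tensor_product_axioms.intro ab mod NQ)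
  show "mod_2_reduction C d (\<lambda>n. tensor (C n) (self_module TYPE(bit)))
        (\<lambda>n. tensor_map (C (n - 1)) (self_module TYPE(bit)) (d n))
        (\<lambda>n. tensor_product.unit_tensor (C n) (self_module TYPE(bit)))"
  proof (intro mod_2_reduction.intro cpl additive_complex_tensor ac N2 mod_2_reduction_axioms.intro
      tensor_map_unit_tensor tensor_product.unit_tensor_hom[OF mod_2_tensor.axioms(1)[OF t2]])
    fix x n assume x: "x \<in> carrier (C n)"
    show "x = \<zero>\<^bsub>C n\<^esub>" if xx: "x \<oplus>\<^bsub>C n\<^esub> x = \<zero>\<^bsub>C n\<^esub>"
    proof -
      interpret abelian_group "C n" by (rule ab)
      obtain \<phi> :: "'a \<Rightarrow> ('a \<Rightarrow>\<^sub>0 int)" where \<phi>: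
        "\<And>m m'. m \<in> carrier (C n) \<Longrightarrow> m' \<in> carrier (C n) \<Longrightarrow> \<phi> (m \<oplus>\<^bsub>C n\<^esub> m') = \<phi> m + \<phi> m'"
        "\<And>m. m \<in> carrier (C n) \<Longrightarrow> \<phi> m = 0 \<Longrightarrow> m = \<zero>\<^bsub>C n\<^esub>"
        using free_abelian_embedding[OF ab free] by blast
      have "\<phi> x + \<phi> x = 0"
        using \<phi>(1)[OF x x] \<phi>(1)[of "\<zero>\<^bsub>C n\<^esub>" "\<zero>\<^bsub>C n\<^esub>"] xx by simp
      then have "lookup (\<phi> x) b + lookup (\<phi> x) b = 0" for b by (metis lookup_add lookup_zero)
      then have "\<phi> x = 0" by (intro poly_mapping_eqI) simp
      then show ?thesis using \<phi>(2) x by blast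
    qed
  qed (use mod_2_tensor.unit_tensor_eq_zero[OF t2] mod_2_tensor.unit_tensor_double[OF t2]
      mod_2_tensor.unit_tensor_surj[OF t2] in blast)+
  show "rational_extension C d (\<lambda>n. tensor (C n) (self_module TYPE(rat)))
        (\<lambda>n. tensor_map (C (n - 1)) (self_module TYPE(rat)) (d n))
        (\<lambda>n. tensor_product.unit_tensor (C n) (self_module TYPE(rat)))"
  proof (intro rational_extension.intro cpl additive_complex_tensor ac NQ rational_extension_axioms.intro
      tensor_map_unit_tensor tensor_product.unit_tensor_hom[OF rational_tensor.axioms(1)[OF tQ]])
    fix x n assume x: "x \<in> carrier (C n)"
      and z: "tensor_product.unit_tensor (C n) (self_module TYPE(rat)) x = \<zero>\<^bsub>tensor (C n) (self_module TYPE(rat))\<^esub>"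
    obtain \<phi> :: "'a \<Rightarrow> ('a \<Rightarrow>\<^sub>0 int)" where \<phi>:
      "\<And>m m'. m \<in> carrier (C n) \<Longrightarrow> m' \<in> carrier (C n) \<Longrightarrow> \<phi> (m \<oplus>\<^bsub>C n\<^esub> m') = \<phi> m + \<phi> m'"
      "\<And>m. m \<in> carrier (C n) \<Longrightarrow> \<phi> m = 0 \<Longrightarrow> m = \<zero>\<^bsub>C n\<^esub>"
      using free_abelian_embedding[OF ab free] by blast
    show "x = \<zero>\<^bsub>C n\<^esub>"
      by (rule \<phi>(2)[OF x rational_tensor.unit_tensor_inj[OF tQ \<phi>(1) x z]])
  qed (assumption, rule rational_tensor.unit_tensor_dense[OF tQ])
qed

subsection \<open>The path complex\<close>

lemma path_seqs_eq: "path_seqs digraph_G n = (if n < 0 then {} else paths (nat n))"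
  by (cases "n < 0") (auto simp: paths_def path_seqs_def neq_Nil_conv)

lemma path_seqs_regular: "path_seqs digraph_G n \<subseteq> regular_seqs digraph_G n"
proof
  fix xs assume xs: "xs \<in> path_seqs digraph_G n"
  then have "distinct xs" using paths_distinct[of xs "nat n"] by (auto simp: path_seqs_eq split: if_splits)
  then have "distinct_adj xs" by (simp add: distinct_adj_conv_nth nth_eq_iff_index_eq)
  with xs show "xs \<in> regular_seqs digraph_G n" by (auto simp: path_seqs_def regular_seqs_def)
qed

lemma carrier_path_chain:
  "carrier (path_chain_module digraph_G n :: ('k::comm_ring_1, _) module) =
   {c. keys c \<subseteq> path_seqs digraph_G n \<and> keys (path_boundary c) \<subseteq> path_seqs digraph_G (n - 1)}"
  using path_seqs_regular[of n] by (auto simp: path_chain_module_def)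

lemma path_chain_simps [simp]:
  "zero (path_chain_module G n) = 0" "add (path_chain_module G n) = (+)"
  "module.smult (path_chain_module G n) = poly_scale"
  by (simp_all add: path_chain_module_def)

text \<open>Discarding irregular faces could spoil the transposed formula. Paths here have distinct
  vertices, so a list with equal neighbours is no face of a path and its insertion sum is zero as
  well; the first boundary is thus an insertion sum without exceptions, and
  \<open>ins_sum_ins_sum\<close> applies.\<close>

lemma path_boundary_path_boundary:
  fixes c :: "vertex list \<Rightarrow>\<^sub>0 'k::comm_ring_1"
  assumes c: "keys c \<subseteq> path_seqs digraph_G n"
  shows "path_boundary (path_boundary c) = 0"
proof (rule ccontr)
  let ?V = "pverts digraph_G"
  assume "path_boundary (path_boundary c) \<noteq> 0"
  then obtain ys where ys: "ys \<in> keys (path_boundary (path_boundary c))"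
    by (metis ex_in_conv keys_eq_empty)
  then obtain zs j where zs: "zs \<in> keys (path_boundary c)" "j < length zs" "length zs > 1" "ys = delete_at j zs"
    and dys: "distinct_adj ys"
    using keys_path_boundary by metis
  have face: "length us = nat n \<and> set us \<subseteq> ?V \<and> n > 0" if us: "us \<in> keys (path_boundary c)" for us
  proof -
    obtain xs i where xs: "xs \<in> keys c" "i < length xs" "length xs > 1" "us = delete_at i xs"
      using keys_path_boundary[OF us] by metis
    then have "int (length xs) = n + 1" "set xs \<subseteq> ?V" using c by (auto simp: path_seqs_def)
    with xs(2-4) set_take_subset[of i xs] set_drop_subset[of "Suc i" xs] show ?thesis by auto
  qed
  have lys: "Suc (length ys) = nat n" "set ys \<subseteq> ?V" "ys \<noteq> []"
    using face[OF zs(1)] zs(2-4) set_take_subset[of j zs] set_drop_subset[of "Suc j" zs] by auto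
  have c': "keys c \<subseteq> paths (Suc (length ys))"
    using c unfolding lys(1) by (auto simp: path_seqs_eq split: if_splits)
  have coeff: "lookup (path_boundary c) us = ins_sum ?V (lookup c) us"
    if us: "length us = Suc (length ys)" "set us \<subseteq> ?V" for us
  proof (cases "distinct_adj us")
    case True
    then show ?thesis using lookup_boundary_paths[OF c' us] by simp
  next
    case False
    have "lookup c (take i us @ v # drop i us) = 0" for i v
    proof (rule ccontr)
      assume "lookup c (take i us @ v # drop i us) \<noteq> 0"
      then have "take i us @ v # drop i us \<in> keys c" by (simp add: in_keys_iff)
      then have "take i us @ v # drop i us \<in> paths (Suc (length ys))" using c' by blast
      then have "distinct (take i us @ v # drop i us)" by (rule paths_distinct)
      then have "distinct (take i us @ drop i us)" by (auto simp del: append_take_drop_id)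
      then have "distinct us" by simp
      then have "distinct_adj us" by (simp add: distinct_adj_conv_nth nth_eq_iff_index_eq)
      with False show False by simp
    qed
    then have "ins_sum ?V (lookup c) us = 0" by (simp add: ins_sum_eq)
    then show ?thesis using False lookup_boundary_paths[OF c' us] by simp
  qed
  have "lookup (path_boundary (path_boundary c)) ys = ins_sum ?V (lookup (path_boundary c)) ys"
    using lookup_path_boundary[of ?V "path_boundary c" ys] face lys dys by auto
  also have "\<dots> = ins_sum ?V (ins_sum ?V (lookup c)) ys"
  proof (rule ins_sum_cong, rule coeff)
    fix v i assume "v \<in> ?V" "i \<le> length ys"
    then show "length (take i ys @ v # drop i ys) = Suc (length ys)" "set (take i ys @ v # drop i ys) \<subseteq> ?V"
      using lys(2) set_take_subset[of i ys] set_drop_subset[of i ys] by auto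
  qed
  also have "\<dots> = 0" by (rule ins_sum_ins_sum)
  finally show False using ys by (simp add: in_keys_iff)
qed

lemma module_path_chain: "Module.module class_ring (path_chain_module digraph_G n :: ('k::comm_ring_1, _) module)"
proof -
  let ?M = "free_module (regular_seqs digraph_G n) :: ('k, vertex list \<Rightarrow>\<^sub>0 'k) module"
  interpret module class_ring ?M by (rule module_free_module)
  let ?N = "carrier (path_chain_module digraph_G n :: ('k, _) module)"
  have eq: "path_chain_module digraph_G n = ?M\<lparr>carrier := ?N\<rparr>"
    by (simp add: path_chain_module_def)
  have sub: "?N \<subseteq> carrier ?M" by (auto simp: path_chain_module_def)
  have add: "x + y \<in> ?N" if "x \<in> ?N" "y \<in> ?N" for x y
    using that unfolding carrier_path_chain by (simp add: path_boundary_add keys_add_subset)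
  have scale: "poly_scale r x \<in> ?N" if "x \<in> ?N" for r x
    using that keys_poly_scale[of r x] keys_poly_scale[of r "path_boundary x"]
    unfolding carrier_path_chain by (auto simp: path_boundary_scale)
  have sub: "LinearCombinations.submodule class_ring ?N ?M"
  proof (rule LinearCombinations.submodule.intro[OF module_axioms sub])
    show "\<zero>\<^bsub>?M\<^esub> \<in> ?N" unfolding carrier_path_chain by simp
  qed (use add scale in simp_all)
  show ?thesis by (subst eq) (rule submodule_is_module[OF sub])
qed

lemma chain_complex_path:
  "chain_complex (path_chain_module digraph_G :: int \<Rightarrow> ('k::comm_ring_1, _) module) (\<lambda>n. path_boundary)"
  unfolding chain_complex_def
proof (intro conjI allI ballI)
  fix n :: int
  have dd: "path_boundary (path_boundary x) = 0" if "keys x \<subseteq> path_seqs digraph_G n" for x :: "vertex list \<Rightarrow>\<^sub>0 'k"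
    using that by (rule path_boundary_path_boundary)
  show "Module.module class_ring (path_chain_module digraph_G n :: ('k, _) module)" by (rule module_path_chain)
  show "path_boundary \<in> LinearCombinations.module_hom class_ring
      (path_chain_module digraph_G n :: ('k, _) module) (path_chain_module digraph_G (n - 1))"
    using dd
    by (auto simp: module_hom_def carrier_path_chain path_boundary_add path_boundary_scale)
  fix x :: "vertex list \<Rightarrow>\<^sub>0 'k" assume "x \<in> carrier (path_chain_module digraph_G n)"
  then show "path_boundary (path_boundary x) = \<zero>\<^bsub>path_chain_module digraph_G (n - 2)\<^esub>"
    using dd by (simp add: carrier_path_chain)
qed

abbreviation path_cycles :: "int \<Rightarrow> (vertex list \<Rightarrow>\<^sub>0 'k::comm_ring_1) set" where
  "path_cycles \<equiv> cycles (path_chain_module digraph_G) (\<lambda>n. path_boundary)"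

abbreviation path_boundaries :: "int \<Rightarrow> (vertex list \<Rightarrow>\<^sub>0 'k::comm_ring_1) set" where
  "path_boundaries \<equiv> boundaries (path_chain_module digraph_G) (\<lambda>n. path_boundary)"

abbreviation path_acyclic :: "'k::comm_ring_1 itself \<Rightarrow> int \<Rightarrow> bool" where
  "path_acyclic _ \<equiv> acyclic_at (path_chain_module digraph_G :: int \<Rightarrow> ('k, _) module) (\<lambda>n. path_boundary)"

interpretation PC: differential_complex
  "path_chain_module digraph_G :: int \<Rightarrow> ('k::comm_ring_1, _) module" "\<lambda>n. path_boundary"
  by (rule differential_complex_chain_complex[OF chain_complex_path])

lemma path_cycles_iff: "c \<in> path_cycles (int n) \<longleftrightarrow> keys c \<subseteq> paths n \<and> path_boundary c = 0"
  by (auto simp: cycles_def carrier_path_chain path_seqs_eq)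

text \<open>The condition that the boundary of \<open>b\<close> consists of paths is absorbed by its
  being equal to \<open>c\<close>.\<close>

lemma path_boundaries_iff:
  "c \<in> path_boundaries (int n) \<longleftrightarrow> keys c \<subseteq> paths n \<and> (\<exists>b. keys b \<subseteq> paths (Suc n) \<and> path_boundary b = c)"
proof -
  have "nat (int n + 1) = Suc n" by simp
  then show ?thesis
    by (auto simp: boundaries_def carrier_path_chain path_seqs_eq image_iff)
qed

lemma path_acyclic_outside:
  assumes "n \<noteq> 0" "n \<noteq> 2"
  shows "path_acyclic TYPE('k::comm_ring_1) n"
proof -
  consider "n < 0" | "n = int 1" | "n = int 3" | "n = int 4" | "n \<ge> 5" using assms by linarith
  then show ?thesis
  proof cases
    case 1
    have "c = 0" if "c \<in> path_cycles n" for c :: "vertex list \<Rightarrow>\<^sub>0 'k"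
      using that 1 by (simp add: cycles_def carrier_path_chain path_seqs_eq)
    then show ?thesis using PC.boundaries_closed(2)[of n] by (auto simp: acyclic_at_def)
  next
    case 2
    show ?thesis unfolding acyclic_at_def 2
    proof
      fix c :: "vertex list \<Rightarrow>\<^sub>0 'k" assume "c \<in> path_cycles (int 1)"
      then have c: "keys c \<subseteq> paths 1" "path_boundary c = 0" unfolding path_cycles_iff by auto
      from cycle1_boundary[OF this] c(1) show "c \<in> path_boundaries (int 1)"
        unfolding path_boundaries_iff Suc_1_2 by blast
    qed
  next
    case 3
    show ?thesis unfolding acyclic_at_def 3
    proof
      fix c :: "vertex list \<Rightarrow>\<^sub>0 'k" assume "c \<in> path_cycles (int 3)"
      then have c: "keys c \<subseteq> paths 3" "path_boundary c = 0" unfolding path_cycles_iff by auto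
      from cycle3_boundary[OF this] c(1) show "c \<in> path_boundaries (int 3)"
        unfolding path_boundaries_iff Suc_3_4 by blast
    qed
  next
    case 4
    show ?thesis unfolding acyclic_at_def 4
    proof
      fix c :: "vertex list \<Rightarrow>\<^sub>0 'k" assume "c \<in> path_cycles (int 4)"
      then have "c = 0" unfolding path_cycles_iff using cycle4_zero by blast
      then show "c \<in> path_boundaries (int 4)" using PC.boundaries_closed(2)[of "int 4"] by simp
    qed
  next
    case 5
    have "c = 0" if "c \<in> path_cycles n" for c :: "vertex list \<Rightarrow>\<^sub>0 'k"
      using that 5 paths_empty[of "nat n"] by (simp add: cycles_def carrier_path_chain path_seqs_eq)
    then show ?thesis using PC.boundaries_closed(2)[of n] by (auto simp: acyclic_at_def)
  qed
qed

lemma path_boundaries_2_invariant: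
  fixes c :: "vertex list \<Rightarrow>\<^sub>0 'k::comm_ring_1"
  assumes "c \<in> path_cycles 2"
  shows "c \<in> path_boundaries 2 \<longleftrightarrow> (\<exists>r. invariant2 c = r + r)"
proof -
  have c: "keys c \<subseteq> paths 2" "path_boundary c = 0"
    using assms path_cycles_iff[of c 2] by simp_all
  have "c \<in> path_boundaries 2 \<longleftrightarrow> (\<exists>b. keys b \<subseteq> paths 3 \<and> path_boundary b = c)"
    using path_boundaries_iff[of c 2] c(1) by (simp add: numeral_3_eq_3)
  then show ?thesis using invariant2_boundary c cycle2_boundary[OF c] by blast
qed

lemma invariant2_add: "invariant2 (c + c') = invariant2 c + invariant2 c'"
  by (simp add: invariant2_def lookup_add)

lemma ex_path_cycle_invariant_1: "\<exists>c \<in> path_cycles 2. invariant2 c = (1 :: 'k::comm_ring_1)"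
  using ex_cycle2_invariant_1 path_cycles_iff[of _ 2] by force

text \<open>The group K/2K vanishes exactly if 2 is invertible: the class of invariant 1 gives one
  direction, and multiplying an invariant by the inverse of 2 the other.\<close>

lemma path_acyclic_2_iff: "path_acyclic TYPE('k::comm_ring_1) 2 \<longleftrightarrow> (\<exists>r :: 'k. r + r = 1)"
proof
  assume ac: "path_acyclic TYPE('k) 2"
  obtain c :: "vertex list \<Rightarrow>\<^sub>0 'k" where c: "c \<in> path_cycles 2" "invariant2 c = 1"
    using ex_path_cycle_invariant_1 by blast
  then have "c \<in> path_boundaries 2" using ac by (auto simp: acyclic_at_def)
  then show "\<exists>r :: 'k. r + r = 1" using path_boundaries_2_invariant[OF c(1)] c(2) by metis
next
  assume "\<exists>r :: 'k. r + r = 1"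
  then obtain r :: 'k where r: "r + r = 1" by blast
  show "path_acyclic TYPE('k) 2"
    unfolding acyclic_at_def
  proof
    fix c :: "vertex list \<Rightarrow>\<^sub>0 'k" assume c: "c \<in> path_cycles 2"
    have "invariant2 c = r * invariant2 c + r * invariant2 c"
      using r by (metis distrib_right mult_1)
    then show "c \<in> path_boundaries 2" using path_boundaries_2_invariant[OF c] by blast
  qed
qed

lemma path_boundary_0: "keys c \<subseteq> paths 0 \<Longrightarrow> path_boundary c = 0"
proof (rule ccontr)
  assume c: "keys c \<subseteq> paths 0" and "path_boundary c \<noteq> 0"
  then obtain ys where "ys \<in> keys (path_boundary c)" by (metis ex_in_conv keys_eq_empty)
  then obtain xs where "xs \<in> keys c" "length xs > 1" using keys_path_boundary by blast
  with c show False by (auto simp: paths_def path_seqs_def)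
qed

lemma path_cycles_0_iff: "c \<in> path_cycles 0 \<longleftrightarrow> keys c \<subseteq> paths 0"
  using path_cycles_iff[of c 0] path_boundary_0[of c] by auto

subsection \<open>Euler characteristics\<close>

lemma dim_eq_1:
  fixes V :: "('k::field, 'v) module"
  assumes V: "Module.module class_ring V" and v: "v \<in> carrier V"
    and gen: "\<And>x. x \<in> carrier V \<Longrightarrow> \<exists>r. x = r \<odot>\<^bsub>V\<^esub> v"
    and nontriv: "carrier V \<noteq> {\<zero>\<^bsub>V\<^esub>}"
  shows "vectorspace.dim class_ring V = 1"
proof -
  interpret vectorspace class_ring V
    by (intro vectorspace.intro V class_field)
  interpret S: LinearCombinations.submodule class_ring "span {v}" V
    using v by (intro span_is_submodule) simp
  have "v \<in> span {v}" using in_own_span[of "{v}"] v by simp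
  then have "carrier V \<subseteq> span {v}"
    using gen S.smult_closed[of _ v] by (metis UNIV_I partial_object.select_convs(1) subsetI)
  then have span: "span {v} = carrier V" using S.subset by blast
  have "dim \<le> card {v}" by (rule gen_ge_dim) (use v span in auto)
  moreover have "dim \<noteq> 0"
  proof
    assume "dim = 0"
    \<comment> \<open>The dimension is a least number, so it is attained by a generating set only
      once some finite one is exhibited.\<close>
    have ex: "\<exists>n A. finite A \<and> card A = n \<and> A \<subseteq> carrier V \<and> gen_set A"
      using v span by (intro exI[of _ "card {v}"] exI[of _ "{v}"]) simp
    have "\<exists>A. finite A \<and> card A = dim \<and> A \<subseteq> carrier V \<and> gen_set A"
      unfolding dim_def by (rule LeastI_ex[OF ex])
    then have "span {} = carrier V" using \<open>dim = 0\<close> by auto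
    moreover have "span {} = {\<zero>\<^bsub>V\<^esub>}" by (auto simp: span_def lincomb_def)
    ultimately show False using nontriv by simp
  qed
  ultimately show ?thesis by simp
qed

lemma path_homology_eq:
  "path_homology TYPE('k::comm_ring_1) G n = homology (path_chain_module G) (\<lambda>n. path_boundary) n"
  by (simp add: path_homology_def)

lemma path_homology_carrier_iff:
  "carrier (path_homology TYPE('k::comm_ring_1) digraph_G n) = {\<zero>\<^bsub>path_homology TYPE('k) digraph_G n\<^esub>}
    \<longleftrightarrow> path_acyclic TYPE('k) n"
proof -
  let ?H = "path_homology TYPE('k) digraph_G n"
  have "\<zero>\<^bsub>?H\<^esub> \<in> carrier ?H"
    using PC.H.abelian_group_quotient abelian_monoid.zero_closed
    unfolding path_homology_eq homology_eq abelian_group_def by blast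
  then show ?thesis
    unfolding path_homology_eq PC.acyclic_at_iff by auto
qed

lemma path_not_acyclic_0: "\<not> path_acyclic TYPE('k::comm_ring_1) 0"
proof
  assume ac: "path_acyclic TYPE('k) 0"
  let ?c = "Poly_Mapping.single [vx0] (1 :: 'k)"
  have c: "?c \<in> path_cycles 0"
    unfolding path_cycles_0_iff by (simp add: paths_def path_seqs_def)
  then have "?c \<in> path_boundaries 0" using ac by (auto simp: acyclic_at_def)
  then obtain b where "keys b \<subseteq> paths 1" "path_boundary b = ?c"
    using path_boundaries_iff[of ?c 0] by auto
  then have "augmentation ?c = 0" using augmentation_boundary[of b] by simp
  then show False by (simp add: augmentation_def sum_verts[of _ 0] lookup_single)
qed

lemma path_homology_coset:
  "carrier (path_homology TYPE('k::comm_ring_1) digraph_G n) =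
    (\<lambda>z. (\<lambda>b. b + z) ` path_boundaries n) ` path_cycles n"
  unfolding path_homology_eq carrier_homology by simp

text \<open>Translates a homology between \<open>r z\<close> and \<open>z'\<close> into the
  coset-wise scalar action; it serves to show that a single class spans.\<close>

lemma path_homology_smult:
  fixes z :: "vertex list \<Rightarrow>\<^sub>0 'k::comm_ring_1"
  assumes "z \<in> path_cycles n" "z' \<in> path_cycles n" "poly_scale r z - z' \<in> path_boundaries n"
  shows "r \<odot>\<^bsub>path_homology TYPE('k) digraph_G n\<^esub> ((\<lambda>b. b + z) ` path_boundaries n) = (\<lambda>b. b + z') ` path_boundaries n"
proof -
  let ?B = "path_boundaries n :: (vertex list \<Rightarrow>\<^sub>0 'k) set"
  have B: "x + y \<in> ?B" if "x \<in> ?B" "y \<in> ?B" for x y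
    using PC.boundaries_closed(3)[of x n y] that by simp
  have B0: "0 \<in> ?B" using PC.boundaries_closed(2)[of n] by simp
  have Bm: "- x \<in> ?B" if "x \<in> ?B" for x
  proof -
    have "\<ominus>\<^bsub>path_chain_module digraph_G n\<^esub> x = - x"
      using that PC.boundaries_closed(1,4)[of x n] PC.boundaries_closed(1)[OF PC.boundaries_closed(4)[OF that]]
        PC.C.r_neg[of x n] by (simp add: eq_neg_iff_add_eq_0 add.commute)
    then show ?thesis using PC.boundaries_closed(4)[OF that] by simp
  qed
  have Bs: "poly_scale r x \<in> ?B" if x: "x \<in> ?B" for x
  proof -
    interpret M: module class_ring "path_chain_module digraph_G (n + 1) :: ('k, _) module"
      by (rule module_path_chain)
    obtain y where y: "y \<in> carrier (path_chain_module digraph_G (n + 1))" "x = path_boundary y"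
      using x by (auto simp: boundaries_def)
    then have "poly_scale r y \<in> carrier (path_chain_module digraph_G (n + 1))"
      using M.smult_closed[of r y] by simp
    then show ?thesis using y(2) by (auto simp: boundaries_def path_boundary_scale[symmetric])
  qed
  have "r \<odot>\<^bsub>path_homology TYPE('k) digraph_G n\<^esub> ((\<lambda>b. b + z) ` ?B) = {b + poly_scale r (b' + z) | b b'. b \<in> ?B \<and> b' \<in> ?B}"
    by (auto simp: path_homology_eq homology_eq set_add_def')
  also have "\<dots> = (\<lambda>b. b + z') ` ?B"
  proof (intro subset_antisym subsetI)
    fix x assume "x \<in> {b + poly_scale r (b' + z) | b b'. b \<in> ?B \<and> b' \<in> ?B}"
    then obtain b b' where b: "b \<in> ?B" "b' \<in> ?B" "x = b + poly_scale r (b' + z)" by blast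
    have "x = (b + (poly_scale r b' + (poly_scale r z - z'))) + z'"
      unfolding b(3) by (rule poly_mapping_eqI) (simp add: lookup_add lookup_minus algebra_simps)
    moreover have "b + (poly_scale r b' + (poly_scale r z - z')) \<in> ?B"
      by (intro B Bs b assms(3))
    ultimately show "x \<in> (\<lambda>b. b + z') ` ?B" by blast
  next
    fix x assume "x \<in> (\<lambda>b. b + z') ` ?B"
    then obtain b where b: "b \<in> ?B" "x = b + z'" by blast
    then have "x = (b + (- (poly_scale r z - z'))) + poly_scale r (0 + z)" by simp
    moreover have "b + (- (poly_scale r z - z')) \<in> ?B"
      by (intro B Bm b assms(3))
    ultimately show "x \<in> {b + poly_scale r (b' + z) | b b'. b \<in> ?B \<and> b' \<in> ?B}"
      using B0 by blast
  qed
  finally show ?thesis .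
qed

lemma dim_path_homology_0: "vectorspace.dim class_ring (path_homology TYPE('k::field) digraph_G 0) = 1"
proof (rule dim_eq_1)
  let ?H = "path_homology TYPE('k) digraph_G 0" and ?e = "Poly_Mapping.single [vx0] (1 :: 'k)"
  let ?v = "(\<lambda>b. b + ?e) ` path_boundaries 0"
  show "Module.module class_ring ?H" unfolding path_homology_eq by (rule module_homology[OF chain_complex_path])
  have e: "?e \<in> path_cycles 0"
    unfolding path_cycles_0_iff by (simp add: paths_def path_seqs_def)
  then show "?v \<in> carrier ?H" unfolding path_homology_coset by blast
  show "carrier ?H \<noteq> {\<zero>\<^bsub>?H\<^esub>}"
    unfolding path_homology_carrier_iff by (rule path_not_acyclic_0)
  fix x assume "x \<in> carrier ?H"
  then obtain z where z: "z \<in> path_cycles 0" "x = (\<lambda>b. b + z) ` path_boundaries 0"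
    unfolding path_homology_coset by blast
  have kz: "keys z \<subseteq> paths 0" using z(1) unfolding path_cycles_0_iff .
  \<comment> \<open>The augmentation is the coordinate of a class with respect to the vertex x0,
    which itself has augmentation 1.\<close>
  let ?r = "augmentation z"
  have sub: "keys (poly_scale ?r ?e - z) \<subseteq> paths 0"
    using e kz keys_diff[of "poly_scale ?r ?e" z] keys_poly_scale[of ?r ?e] unfolding path_cycles_0_iff by blast
  have "augmentation (poly_scale ?r ?e - z) = 0"
    by (simp add: augmentation_def sum_subtractf lookup_minus sum_distrib_left[symmetric] sum_verts[of _ 0] lookup_single)
  from augmentation_zero_boundary[OF sub this]
  have "poly_scale ?r ?e - z \<in> path_boundaries 0"
    using sub path_boundaries_iff[of _ 0] by auto
  then show "\<exists>r. x = r \<odot>\<^bsub>?H\<^esub> ?v"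
    using path_homology_smult[OF e z(1)] z(2) by metis
qed

lemma invariant2_scale_diff: "invariant2 (poly_scale r c - z) = r * invariant2 c - invariant2 z"
  by (simp add: invariant2_def lookup_minus algebra_simps)

lemma dim_path_homology_2_bit: "vectorspace.dim class_ring (path_homology TYPE(bit) digraph_G 2) = 1"
proof -
  let ?H = "path_homology TYPE(bit) digraph_G 2"
  obtain c :: "vertex list \<Rightarrow>\<^sub>0 bit" where c: "c \<in> path_cycles 2" "invariant2 c = 1"
    using ex_path_cycle_invariant_1 by blast
  let ?v = "(\<lambda>b. b + c) ` path_boundaries 2"
  show ?thesis
  proof (rule dim_eq_1)
    show "Module.module class_ring ?H" unfolding path_homology_eq by (rule module_homology[OF chain_complex_path])
    show "?v \<in> carrier ?H" using c(1) unfolding path_homology_coset by blast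
    show "carrier ?H \<noteq> {\<zero>\<^bsub>?H\<^esub>}"
      unfolding path_homology_carrier_iff path_acyclic_2_iff by (simp add: bit_add_self)
    fix x assume "x \<in> carrier ?H"
    then obtain z where z: "z \<in> path_cycles 2" "x = (\<lambda>b. b + z) ` path_boundaries 2"
      unfolding path_homology_coset by blast
    \<comment> \<open>As \<open>c\<close> has invariant 1, this is the coordinate of the class of
      \<open>z\<close>; the difference has invariant 0, hence bounds.\<close>
    let ?r = "invariant2 z"
    have inv: "invariant2 (poly_scale ?r c - z) = 0"
      unfolding invariant2_scale_diff c(2) by simp
    have "poly_scale ?r c - z \<in> path_cycles 2"
    proof -
      have kc: "keys c \<subseteq> paths 2" "path_boundary c = 0" "keys z \<subseteq> paths 2" "path_boundary z = 0"
        using c(1) z(1) path_cycles_iff[of _ 2] by auto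
      then have "keys (poly_scale ?r c - z) \<subseteq> paths 2"
        using keys_diff[of "poly_scale ?r c" z] keys_poly_scale[of ?r c] by blast
      moreover have "path_boundary (poly_scale ?r c - z) = 0"
        unfolding path_boundary_diff path_boundary_scale kc by (rule poly_mapping_eqI) simp
      ultimately show ?thesis using path_cycles_iff[of "poly_scale ?r c - z" 2] by simp
    qed
    then have "poly_scale ?r c - z \<in> path_boundaries 2"
      using path_boundaries_2_invariant inv bit_add_self[of 0] by metis
    then show "\<exists>r. x = r \<odot>\<^bsub>?H\<^esub> ?v"
      using path_homology_smult[OF c(1) z(1)] z(2) by metis
  qed
qed

lemma support_rat: "path_homology_support TYPE(rat) digraph_G = {0}"
proof -
  have "path_acyclic TYPE(rat) 2" unfolding path_acyclic_2_iff by (intro exI[of _ "1 / 2"]) simp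
  then have "path_acyclic TYPE(rat) n \<longleftrightarrow> n \<noteq> 0" for n
    using path_acyclic_outside[of n] path_not_acyclic_0 by metis
  then show ?thesis
    unfolding path_homology_support_def path_homology_carrier_iff by simp
qed

lemma support_bit: "path_homology_support TYPE(bit) digraph_G = {0, 2}"
proof -
  have "\<not> path_acyclic TYPE(bit) 2" unfolding path_acyclic_2_iff by (simp add: bit_add_self)
  then have "path_acyclic TYPE(bit) n \<longleftrightarrow> n \<noteq> 0 \<and> n \<noteq> 2" for n
    using path_acyclic_outside[of n] path_not_acyclic_0 by metis
  then show ?thesis
    unfolding path_homology_support_def path_homology_carrier_iff by auto
qed

lemma euler_characteristics:
  "path_euler_char TYPE(rat) digraph_G = 1" "path_euler_char TYPE(bit) digraph_G = 2"
proof -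
  show "path_euler_char TYPE(rat) digraph_G = 1"
    by (simp add: path_euler_char_def support_rat dim_path_homology_0)
  have "(\<Sum>n\<in>{0, 2}. f n) = f 0 + f 2" for f :: "int \<Rightarrow> int" by simp
  then show "path_euler_char TYPE(bit) digraph_G = 2"
    by (simp only: path_euler_char_def support_bit dim_path_homology_0 dim_path_homology_2_bit) simp
qed

subsection \<open>No space or complex of free groups realises the path homology\<close>

text \<open>A cycle of invariant 1 does not bound because 1 is odd, while its double has invariant 1
  + 1 and does.\<close>

lemma path_homology_int_2_torsion:
  "\<exists>a\<in>carrier (path_homology TYPE(int) digraph_G 2).
     a \<noteq> \<zero>\<^bsub>path_homology TYPE(int) digraph_G 2\<^esub> \<and>
     a \<oplus>\<^bsub>path_homology TYPE(int) digraph_G 2\<^esub> a = \<zero>\<^bsub>path_homology TYPE(int) digraph_G 2\<^esub>"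
proof -
  let ?H = "path_homology TYPE(int) digraph_G 2"
  let ?Z = "(path_chain_module digraph_G 2 :: (int, _) module)\<lparr>carrier := path_cycles 2\<rparr>"
  have H: "?H = quotient_module ?Z (path_boundaries 2)"
    unfolding path_homology_eq homology_eq ..
  obtain c :: "vertex list \<Rightarrow>\<^sub>0 int" where c: "c \<in> path_cycles 2" "invariant2 c = 1"
    using ex_path_cycle_invariant_1 by blast
  have cc: "c + c \<in> path_cycles 2" using PC.cycles_closed(3)[OF c(1) c(1)] by simp
  let ?a = "path_boundaries 2 +>\<^bsub>?Z\<^esub> c"
  have cZ: "c \<in> carrier ?Z" "c \<oplus>\<^bsub>?Z\<^esub> c \<in> carrier ?Z" using c(1) cc by simp_all
  have "\<not> (\<exists>r. (1 :: int) = r + r)" by presburger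
  then have "c \<notin> path_boundaries 2" using path_boundaries_2_invariant[OF c(1)] c(2) by simp
  then have "?a \<noteq> \<zero>\<^bsub>?H\<^esub>" unfolding H using PC.H.coset_zero_iff[OF cZ(1)] by blast
  moreover have "c + c \<in> path_boundaries 2"
    using path_boundaries_2_invariant[OF cc] c(2) by (auto simp: invariant2_add)
  then have "?a \<oplus>\<^bsub>?H\<^esub> ?a = \<zero>\<^bsub>?H\<^esub>"
    unfolding H using PC.H.quotient_add[OF cZ(1) cZ(1)] PC.H.coset_zero_iff[OF cZ(2)] by simp
  moreover have "?a \<in> carrier ?H" unfolding H using cZ(1) by (rule PC.H.quotient_closed)
  ultimately show ?thesis by blast
qed

lemma path_acyclic_facts:
  "path_acyclic TYPE(rat) 1" "path_acyclic TYPE(rat) 2"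
  "path_acyclic TYPE(bit) 1" "path_acyclic TYPE(bit) 3" "\<not> path_acyclic TYPE(bit) 2"
proof -
  show "path_acyclic TYPE(rat) 2" unfolding path_acyclic_2_iff by (intro exI[of _ "1 / 2"]) simp
  show "\<not> path_acyclic TYPE(bit) 2" unfolding path_acyclic_2_iff by (simp add: bit_add_self)
qed (simp_all add: path_acyclic_outside)

lemma graded_iso_acyclic:
  assumes iso: "graded_iso (path_homology TYPE('k::comm_ring_1) digraph_G) (homology E e)"
    and E: "additive_complex E e"
  shows "path_acyclic TYPE('k) n \<longleftrightarrow> acyclic_at E e n"
proof -
  obtain f where "bij_betw f (carrier (path_homology TYPE('k) digraph_G n)) (carrier (homology E e n))"
    using iso unfolding graded_iso_def by blast
  then show ?thesis
    unfolding path_homology_eq by (rule acyclic_at_cong_iso[OF PC.additive_complex_axioms E])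
qed

lemma no_finite_type_model:
  assumes r: "mod_2_reduction C d E e \<rho>" and q: "rational_extension C d Q q \<sigma>"
    and fg: "\<And>n. finitely_generated_group (homology C d n)"
    and isoQ: "graded_iso (path_homology TYPE(rat) digraph_G) (homology Q q)"
    and isoE: "graded_iso (path_homology TYPE(bit) digraph_G) (homology E e)"
  shows False
proof -
  interpret r: mod_2_reduction C d E e \<rho> by (rule r)
  interpret q: rational_extension C d Q q \<sigma> by (rule q)
  note acQ = graded_iso_acyclic[OF isoQ q.Q.additive_complex_axioms]
  note acE = graded_iso_acyclic[OF isoE r.E.additive_complex_axioms]
  have "acyclic_at E e 2"
  proof (rule r.acyclic_of_exponents)
    show "\<exists>N>0. \<forall>z\<in>cycles C d (2 - 1). [(N :: nat)] \<cdot>\<^bsub>C (2 - 1)\<^esub> z \<in> boundaries C d (2 - 1)"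
      using acQ[of 1] path_acyclic_facts(1) by (intro q.homology_exponent fg) simp
    show "\<exists>N>0. \<forall>z\<in>cycles C d 2. [(N :: nat)] \<cdot>\<^bsub>C 2\<^esub> z \<in> boundaries C d 2"
      using acQ[of 2] path_acyclic_facts(2) by (intro q.homology_exponent fg) simp
    show "acyclic_at E e (2 - 1)" "acyclic_at E e (2 + 1)"
      using acE path_acyclic_facts(3,4) by simp_all
  qed
  then show False using acE path_acyclic_facts(5) by simp
qed

lemma singular_homology_eq:
  "singular_homology TYPE('k::comm_ring_1) X = homology (singular_chain_module X) singular_boundary"
  by (rule ext) (simp add: singular_homology_def)

lemma no_singular_model_int_bit:
  assumes isoZ: "graded_group_iso (path_homology TYPE(int) digraph_G) (singular_homology TYPE(int) X)"
    and iso2: "graded_group_iso (path_homology TYPE(bit) digraph_G) (singular_homology TYPE(bit) X)"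
  shows False
proof -
  let ?C = "singular_chain_module X :: int \<Rightarrow> (int, _) module"
  let ?E = "singular_chain_module X :: int \<Rightarrow> (bit, _) module"
  let ?P = "path_homology TYPE(int) digraph_G 2" and ?H = "homology ?C singular_boundary 2"
  let ?Z = "(?C 2)\<lparr>carrier := cycles ?C singular_boundary 2\<rparr>" and ?B = "boundaries ?C singular_boundary 2"
  interpret r: mod_2_reduction ?C singular_boundary ?E singular_boundary "\<lambda>n. Poly_Mapping.map of_int"
    by (rule mod_2_reduction_singular)
  have H: "?H = quotient_module ?Z ?B" by (rule homology_eq)
  have "add_monoid (path_homology TYPE(bit) digraph_G 3) \<cong> add_monoid (singular_homology TYPE(bit) X 3)"
    using iso2 unfolding graded_group_iso_def by blast
  then obtain f where "bij_betw f (carrier (path_homology TYPE(bit) digraph_G 3)) (carrier (homology ?E singular_boundary 3))"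
    unfolding singular_homology_eq by (auto simp: is_iso_def iso_def)
  then have ac: "acyclic_at ?E singular_boundary 3"
    using acyclic_at_cong_iso[OF PC.additive_complex_axioms additive_complex_singular, of f 3 X]
      path_acyclic_facts(4) unfolding path_homology_eq by blast
  have "add_monoid ?P \<cong> add_monoid ?H"
    using isoZ unfolding graded_group_iso_def singular_homology_eq by blast
  then obtain h where h: "h \<in> iso (add_monoid ?P) (add_monoid ?H)" by (auto simp: is_iso_def)
  obtain a where a: "a \<in> carrier ?P" "a \<noteq> \<zero>\<^bsub>?P\<^esub>" "a \<oplus>\<^bsub>?P\<^esub> a = \<zero>\<^bsub>?P\<^esub>"
    using path_homology_int_2_torsion by blast
  have groupP: "abelian_group ?P"
    unfolding path_homology_eq homology_eq by (rule PC.H.abelian_group_quotient)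
  have groupH: "abelian_group ?H" unfolding H by (rule r.C.H.abelian_group_quotient)
  interpret P: abelian_group ?P by (rule groupP)
  interpret h: group_hom "add_monoid ?P" "add_monoid ?H" h
    using h by (intro group_hom.intro P.a_group abelian_group.a_group[OF groupH] group_hom_axioms.intro)
      (simp add: iso_def)
  have inj: "inj_on h (carrier ?P)" using h by (auto simp: iso_def bij_betw_def)
  have h0: "h \<zero>\<^bsub>?P\<^esub> = \<zero>\<^bsub>?H\<^esub>" using h.hom_one by simp
  have "h a \<noteq> \<zero>\<^bsub>?H\<^esub>" using inj_onD[OF inj _ a(1) P.zero_closed] h0 a(2) by auto
  moreover have hh: "h a \<oplus>\<^bsub>?H\<^esub> h a = \<zero>\<^bsub>?H\<^esub>" using h.hom_mult[of a a] a(1,3) h0 by simp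
  moreover have "h a \<in> carrier ?H" using h.hom_closed[of a] a(1) by simp
  then obtain w where w: "w \<in> carrier ?Z" "h a = ?B +>\<^bsub>?Z\<^esub> w"
    unfolding H r.C.H.quotient_cosets by blast
  have wZ: "w \<in> cycles ?C singular_boundary 2" using w(1) by simp
  have ww: "w \<oplus>\<^bsub>?Z\<^esub> w \<in> carrier ?Z" using r.C.cycles_closed(3)[OF wZ wZ] by simp
  ultimately have "w \<notin> ?B" "w \<oplus>\<^bsub>?Z\<^esub> w \<in> ?B"
    unfolding w(2) H using r.C.H.coset_zero_iff[OF w(1)] r.C.H.coset_zero_iff[OF ww]
      r.C.H.quotient_add[OF w(1) w(1)] by simp_all
  then show False
    using r.homology_no_2_torsion[of 2 w] ac wZ by simp
qed

subsection \<open>The universal coefficient sequence\<close>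

lemma additive_group_bit_simps [simp]:
  "carrier (additive_group TYPE(bit)) = UNIV" "add (additive_group TYPE(bit)) = (+)"
  by (simp_all add: additive_group_def)

lemma mod_2_tensor_additive_group:
  "Module.module class_ring M \<Longrightarrow> mod_2_tensor M (additive_group TYPE(bit))"
  by (intro mod_2_tensor.intro tensor_product.intro tensor_product_axioms.intro additive_group_bit_simps)
    (auto simp: module_def)

text \<open>Let e be the generator of the free group F0 belonging to \<open>a\<close>. As 2a = 0,
  the element 2e lies in F1. Its class 2e (x) 1 dies in F0 (x) Z/2, where 2e is a double, but not in
  F1 (x) Z/2: 2e = 2w forces w = e, and e is not in F1. Hence the kernel contains two
  elements.\<close>

lemma Tor_nontrivial:
  fixes A :: "(int, 'a) module"
  assumes A: "Module.module class_ring A" and a: "a \<in> carrier A" "a \<noteq> \<zero>\<^bsub>A\<^esub>" "a \<oplus>\<^bsub>A\<^esub> a = \<zero>\<^bsub>A\<^esub>"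
  shows "\<exists>s\<in>carrier (Tor A (additive_group TYPE(bit))). \<exists>t\<in>carrier (Tor A (additive_group TYPE(bit))). s \<noteq> t"
proof -
  let ?T = "additive_group TYPE(bit)" and ?F0 = "Tor_F0 A" and ?F1 = "Tor_F1 A"
  interpret A: mod_2_tensor A ?T by (rule mod_2_tensor_additive_group[OF A])
  have F0: "Module.module class_ring ?F0" unfolding Tor_F0_def by (rule module_free_module)
  interpret F0: mod_2_tensor ?F0 ?T by (rule mod_2_tensor_additive_group[OF F0])
  have F1_carrier: "carrier ?F1 = {c. keys c \<subseteq> carrier A \<and> Tor_aug A c = \<zero>\<^bsub>A\<^esub>}"
    by (simp add: Tor_F1_def Tor_F0_def)
  have F0_simps: "carrier ?F0 = {c. keys c \<subseteq> carrier A}" "zero ?F0 = 0" "add ?F0 = (+)" "module.smult ?F0 = poly_scale"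
    by (simp_all add: Tor_F0_def)
  have F1_simps: "zero ?F1 = 0" "add ?F1 = (+)" by (simp_all add: Tor_F1_def F0_simps)
  have scale: "Tor_aug A (poly_scale r c) = r \<odot>\<^bsub>A\<^esub> Tor_aug A c" if c: "keys c \<subseteq> carrier A" for r c
  proof -
    have "Tor_aug A (poly_scale r c) = (\<Oplus>\<^bsub>A\<^esub>x\<in>keys c. r \<odot>\<^bsub>A\<^esub> (lookup c x \<odot>\<^bsub>A\<^esub> x))"
      unfolding A.Tor_aug_superset[OF finite_keys keys_poly_scale c]
      using c A.smult_assoc1 by (intro A.M.finsum_cong') (auto intro!: A.smult_closed)
    also have "\<dots> = r \<odot>\<^bsub>A\<^esub> Tor_aug A c"
      unfolding Tor_aug_def using c by (intro A.finsum_smult[symmetric]) (auto intro!: A.smult_closed)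
    finally show ?thesis .
  qed
  have "LinearCombinations.submodule class_ring (carrier ?F1) ?F0"
  proof (rule LinearCombinations.submodule.intro[OF F0])
    show "carrier ?F1 \<subseteq> carrier ?F0" by (auto simp: F1_carrier F0_simps)
    show "\<zero>\<^bsub>?F0\<^esub> \<in> carrier ?F1" by (simp add: F1_carrier F0_simps)
    show "v \<oplus>\<^bsub>?F0\<^esub> w \<in> carrier ?F1" if "v \<in> carrier ?F1" "w \<in> carrier ?F1" for v w
      using that by (simp add: F1_carrier F0_simps keys_add_subset A.Tor_aug_add)
    show "r \<odot>\<^bsub>?F0\<^esub> v \<in> carrier ?F1" if "r \<in> carrier class_ring" "v \<in> carrier ?F1" for r v
      using that keys_poly_scale[of r v] A.smult_r_null[of r] by (auto simp: F1_carrier F0_simps scale)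
  qed
  then have "Module.module class_ring (?F0\<lparr>carrier := carrier ?F1\<rparr>)"
    by (rule F0.submodule_is_module)
  then have F1: "Module.module class_ring ?F1" by (simp add: Tor_F1_def)
  interpret F1: mod_2_tensor ?F1 ?T by (rule mod_2_tensor_additive_group[OF F1])
  interpret inc: tensor_functor ?F1 ?F0 ?T "\<lambda>c. c"
    by (intro tensor_functor.intro F1.tensor_product_axioms F0.tensor_product_axioms tensor_functor_axioms.intro)
      (auto simp: hom_def F1_carrier F0_simps F1_simps)
  have Tor: "carrier (Tor A ?T) = {t \<in> carrier (tensor ?F1 ?T).
      tensor_map ?F0 ?T (\<lambda>c. c) t = \<zero>\<^bsub>tensor ?F0 ?T\<^esub>}"
    by (simp add: Tor_def)
  let ?e = "frag_of a"
  have e: "?e \<in> carrier ?F0" using a(1) by (simp add: F0_simps)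
  have k: "?e + ?e \<in> carrier ?F1"
    using a by (simp add: F1_carrier keys_add_subset A.Tor_aug_add)
  let ?t = "F1.unit_tensor (?e + ?e)"
  have "tensor_map ?F0 ?T (\<lambda>c. c) ?t = \<zero>\<^bsub>tensor ?F0 ?T\<^esub>"
    using inc.tensor_map_unit_tensor[OF k] F0.unit_tensor_double[OF e] by (simp add: F0_simps)
  moreover have "?t \<in> carrier (tensor ?F1 ?T)"
    using F1.unit_tensor_hom k by (auto simp: hom_def)
  ultimately have t: "?t \<in> carrier (Tor A ?T)" unfolding Tor by blast
  interpret gh: group_hom "add_monoid (tensor ?F1 ?T)" "add_monoid (tensor ?F0 ?T)" "tensor_map ?F0 ?T (\<lambda>c. c)"
    by (intro group_hom.intro group_hom_axioms.intro inc.tensor_map_hom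
        abelian_group.a_group F1.abelian_group_tensor F0.abelian_group_tensor)
  have s: "\<zero>\<^bsub>tensor ?F1 ?T\<^esub> \<in> carrier (Tor A ?T)"
    unfolding Tor using gh.hom_one gh.G.one_closed by simp
  have "?t \<noteq> \<zero>\<^bsub>tensor ?F1 ?T\<^esub>"
  proof
    assume "?t = \<zero>\<^bsub>tensor ?F1 ?T\<^esub>"
    then obtain w where w: "w \<in> carrier ?F1" "?e + ?e = w + w"
      using F1.unit_tensor_eq_zero[OF k] by (auto simp: F1_simps)
    have "lookup ?e x = lookup w x" for x
    proof -
      have "lookup ?e x + lookup ?e x = lookup w x + lookup w x" using w(2) by (metis lookup_add)
      then show ?thesis by simp
    qed
    then have "w = ?e" by (intro poly_mapping_eqI) simp
    then show False using w(1) a(1,2) by (simp add: F1_carrier)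
  qed
  with s t show ?thesis by blast
qed

text \<open>In degree 3 the middle term is trivial and cannot map onto a Tor group with two distinct
  elements. The index \<open>3 - 1\<close> keeps the shape of the existential claim.\<close>

lemma no_universal_coefficient_sequence:
  "\<not> short_exact_sequence_exists
     (tensor (path_homology TYPE(int) digraph_G 3) (additive_group TYPE(bit)))
     (path_homology TYPE(bit) digraph_G 3)
     (Tor (path_homology TYPE(int) digraph_G (3 - 1)) (additive_group TYPE(bit)))"
proof
  let ?B = "path_homology TYPE(bit) digraph_G 3"
  let ?A = "path_homology TYPE(int) digraph_G (3 - 1)"
  assume "short_exact_sequence_exists
     (tensor (path_homology TYPE(int) digraph_G 3) (additive_group TYPE(bit))) ?B (Tor ?A (additive_group TYPE(bit)))"
  then obtain g where g: "g ` carrier ?B = carrier (Tor ?A (additive_group TYPE(bit)))"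
    by (auto simp: short_exact_sequence_exists_def epi_def)
  have "carrier ?B = {\<zero>\<^bsub>?B\<^esub>}"
    unfolding path_homology_carrier_iff by (rule path_acyclic_facts)
  then have sing: "carrier (Tor ?A (additive_group TYPE(bit))) = {g \<zero>\<^bsub>?B\<^esub>}" using g by auto
  have A: "Module.module class_ring ?A"
    unfolding path_homology_eq by (rule module_homology[OF chain_complex_path])
  obtain a where "a \<in> carrier ?A" "a \<noteq> \<zero>\<^bsub>?A\<^esub>" "a \<oplus>\<^bsub>?A\<^esub> a = \<zero>\<^bsub>?A\<^esub>"
    using path_homology_int_2_torsion by auto
  from Tor_nontrivial[OF A this] show False unfolding sing by auto
qed

subsection \<open>Torsion in the cochain module\<close>

text \<open>Dual to \<open>ins_sum\<close>: for \<open>f\<close> the coefficients of a cochain, this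
  is a coefficient of its coboundary, in a form that unfolds on explicit lists.\<close>

primrec del_sum :: "('v list \<Rightarrow> 'k::comm_ring_1) \<Rightarrow> 'v list \<Rightarrow> 'k" where
  "del_sum f [] = 0"
| "del_sum f (x # xs) = f xs - del_sum (\<lambda>ys. f (x # ys)) xs"

lemma del_sum_eq: "del_sum f xs = (\<Sum>i<length xs. (-1) ^ i * f (delete_at i xs))"
proof (induction xs arbitrary: f)
  case (Cons x xs)
  show ?case by (simp add: Cons.IH sum.lessThan_Suc_shift sum_negf del: sum.lessThan_Suc)
qed simp

lemma path_coboundary_eq:
  "path_coboundary G = linear_extension (\<lambda>xs. \<Sum>i\<le>length xs. \<Sum>v\<in>pverts G.
        Poly_Mapping.single (take i xs @ v # drop i xs) ((-1) ^ i))"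
  by (simp add: path_coboundary_def)

lemma lookup_path_coboundary:
  assumes V: "finite (pverts G)" and c: "\<And>zs. zs \<in> keys c \<Longrightarrow> set zs \<subseteq> pverts G"
  shows "lookup (path_coboundary G c) xs = (if set xs \<subseteq> pverts G then del_sum (lookup c) xs else 0)"
proof -
  have inner: "(\<Sum>i\<le>length zs. \<Sum>v\<in>pverts G. lookup (Poly_Mapping.single (take i zs @ v # drop i zs) ((-1) ^ i)) xs)
      = (if set xs \<subseteq> pverts G then \<Sum>i<length xs. if delete_at i xs = zs then (-1) ^ i else 0 else 0)"
    if zs: "set zs \<subseteq> pverts G" for zs
  proof (cases "length xs = Suc (length zs) \<and> set xs \<subseteq> pverts G")
    case True
    have "(\<Sum>v\<in>pverts G. lookup (Poly_Mapping.single (take i zs @ v # drop i zs) ((-1) ^ i)) xs)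
        = (if delete_at i xs = zs then (-1) ^ i else 0)" if i: "i \<le> length zs" for i
    proof -
      have ix: "i < length xs" using i True by simp
      have eq: "take i zs @ v # drop i zs = xs \<longleftrightarrow> v = xs ! i \<and> delete_at i xs = zs" for v
      proof
        assume h: "take i zs @ v # drop i zs = xs"
        show "v = xs ! i \<and> delete_at i xs = zs" unfolding h[symmetric] using i by (simp add: nth_append)
      next
        assume "v = xs ! i \<and> delete_at i xs = zs"
        then show "take i zs @ v # drop i zs = xs" using delete_at_eq_iff[OF ix, of zs] by metis
      qed
      have "xs ! i \<in> pverts G" using True ix by (meson nth_mem subsetD)
      then show ?thesis
        by (simp add: lookup_single when_def eq sum.delta[OF V] sum.delta'[OF V] if_distrib cong: if_cong)
    qed
    then show ?thesis using True by (auto simp: lessThan_Suc_atMost intro!: sum.cong)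
  next
    case False
    have "lookup (Poly_Mapping.single (take i zs @ v # drop i zs) ((-1) ^ i)) xs = 0"
      if "i \<le> length zs" "v \<in> pverts G" for i v
    proof -
      have "set (take i zs @ v # drop i zs) \<subseteq> pverts G"
        using zs that(2) set_take_subset[of i zs] set_drop_subset[of i zs] by auto
      moreover have "length (take i zs @ v # drop i zs) = Suc (length zs)" using that(1) by simp
      ultimately have "take i zs @ v # drop i zs \<noteq> xs" using False by metis
      then show ?thesis by (simp add: lookup_single when_def)
    qed
    moreover have "delete_at i xs \<noteq> zs" if "i < length xs" "set xs \<subseteq> pverts G" for i
      using that False by auto
    ultimately show ?thesis by (auto intro!: sum.neutral)
  qed
  have "lookup (path_coboundary G c) xs = (\<Sum>zs\<in>keys c. lookup c zs *
      (\<Sum>i\<le>length zs. \<Sum>v\<in>pverts G. lookup (Poly_Mapping.single (take i zs @ v # drop i zs) ((-1) ^ i)) xs))"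
    by (simp add: path_coboundary_eq lookup_linear_extension[where S = "keys c"] lookup_sum)
  also have "\<dots> = (\<Sum>zs\<in>keys c. lookup c zs *
      (if set xs \<subseteq> pverts G then \<Sum>i<length xs. if delete_at i xs = zs then (-1) ^ i else 0 else 0))"
    by (intro sum.cong refl) (simp only: inner[OF c])
  also have "\<dots> = (if set xs \<subseteq> pverts G then del_sum (lookup c) xs else 0)"
  proof (cases "set xs \<subseteq> pverts G")
    case True
    have "(\<Sum>zs\<in>keys c. lookup c zs * (\<Sum>i<length xs. if delete_at i xs = zs then (-1) ^ i else 0))
        = (\<Sum>i<length xs. \<Sum>zs\<in>keys c. if delete_at i xs = zs then (-1) ^ i * lookup c zs else 0)"
      by (subst sum.swap) (simp add: sum_distrib_left if_distrib mult.commute cong: if_cong)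
    also have "\<dots> = (\<Sum>i<length xs. (-1) ^ i * lookup c (delete_at i xs))"
      by (intro sum.cong refl) (auto simp: sum.delta in_keys_iff)
    finally show ?thesis using True by (simp add: del_sum_eq)
  qed simp
  finally show ?thesis .
qed

lemma path_coboundary_add: "path_coboundary G (c + d) = path_coboundary G c + path_coboundary G d"
  by (simp add: path_coboundary_eq linear_extension_add)

abbreviation nonpaths :: "int \<Rightarrow> (vertex list \<Rightarrow>\<^sub>0 'k::comm_ring_1) set" where
  "nonpaths n \<equiv> carrier (nonpath_module digraph_G n)"

lemma nonpaths_iff: "c \<in> nonpaths n \<longleftrightarrow> keys c \<subseteq> regular_seqs digraph_G n - path_seqs digraph_G n"
  by (simp add: nonpath_module_def)

lemma ideal_eq: "path_cochain_ideal digraph_G n =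
   {c + path_coboundary digraph_G e | c e. c \<in> nonpaths n \<and> e \<in> nonpaths (n - 1)}"
  by (auto simp: path_cochain_ideal_def set_add_def')

lemma lookup_nonpaths_coboundary:
  assumes m: "m \<in> nonpaths 3"
  shows "lookup (path_coboundary digraph_G m) xs = (if set xs \<subseteq> pverts digraph_G then del_sum (lookup m) xs else 0)"
proof (rule lookup_path_coboundary)
  show "set zs \<subseteq> pverts digraph_G" if "zs \<in> keys m" for zs
    using that m unfolding nonpaths_iff by (auto simp: regular_seqs_def)
qed simp

lemma nonpaths_3_zero:
  assumes "m \<in> nonpaths 3"
  shows "successively arr zs \<Longrightarrow> lookup m zs = 0" "\<not> distinct_adj zs \<Longrightarrow> lookup m zs = 0"
    "length zs \<noteq> 4 \<Longrightarrow> lookup m zs = 0"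
proof -
  show reg: "\<not> distinct_adj zs \<Longrightarrow> lookup m zs = 0" "length zs \<noteq> 4 \<Longrightarrow> lookup m zs = 0"
    using assms unfolding nonpaths_iff by (auto simp: regular_seqs_def in_keys_iff)
  show "lookup m zs = 0" if "successively arr zs"
  proof (cases "length zs = 4")
    case True
    then have "zs \<in> path_seqs digraph_G 3" using that by (simp add: path_seqs_eq mem_paths)
    then show ?thesis using assms unfolding nonpaths_iff by (auto simp: in_keys_iff)
  qed (rule reg(2))
qed

lemma path_4_not_in_ideal:
  "Poly_Mapping.single [vx0, x1 0, x2 0, x3 (nx 0), vx4] (1 :: int) \<notin> path_cochain_ideal digraph_G 4"
  (is "?e \<notin> _")
proof
  define \<phi> where "\<phi> c = (\<Sum>i\<in>{0, nx 0, pv 0}. lookup c [vx0, x1 i, x2 i, x3 i, vx4] + lookup c [vx0, x1 i, x2 i, x3 (nx i), vx4]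
     + lookup c [vx0, x1 i, x2 (nx i), x3 (nx i), vx4] + lookup c [vx0, x1 i, x2 (nx i), x3 (pv i), vx4])"
    for c :: "vertex list \<Rightarrow>\<^sub>0 int"
  assume "?e \<in> path_cochain_ideal digraph_G 4"
  then obtain c m where c: "c \<in> nonpaths 4" and m: "m \<in> nonpaths 3" and eq: "?e = c + path_coboundary digraph_G m"
    unfolding ideal_eq by auto
  have c0: "lookup c xs = 0" if "length xs = 5" "successively arr xs" for xs
  proof -
    have "xs \<in> path_seqs digraph_G 4" using that by (simp add: path_seqs_eq mem_paths)
    then show ?thesis using c unfolding nonpaths_iff by (auto simp: in_keys_iff)
  qed
  have "\<phi> ?e = \<phi> (path_coboundary digraph_G m)"
    unfolding eq by (simp add: \<phi>_def lookup_add c0)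
  \<comment> \<open>The five kinds of forbidden faces of 4-paths. The faces without x0 or x4, and
    those with x1 i, x3 i or x1 i, x3 (pv i), are 3-paths, where \<open>m\<close> vanishes.\<close>
  also have "\<dots> = 2 * (\<Sum>i\<in>{0, nx 0, pv 0}. lookup m [vx0, x1 i, x3 (nx i), vx4]
      - lookup m [vx0, x2 i, x3 i, vx4] - lookup m [vx0, x2 i, x3 (nx i), vx4]
      - lookup m [vx0, x1 i, x2 i, vx4] - lookup m [vx0, x1 i, x2 (nx i), vx4])"
    by (simp add: \<phi>_def lookup_nonpaths_coboundary[OF m] nonpaths_3_zero(1)[OF m])
  finally have "even (\<phi> ?e)" by simp
  moreover have "\<phi> ?e = 1"
    by (simp add: \<phi>_def lookup_single when_def)
  ultimately show False by simp
qed

lemma double_path_4_in_ideal: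
  "Poly_Mapping.single [vx0, x1 0, x2 0, x3 (nx 0), vx4] (1 :: int) +
   Poly_Mapping.single [vx0, x1 0, x2 0, x3 (nx 0), vx4] 1 \<in> path_cochain_ideal digraph_G 4"
  (is "?e + ?e \<in> _")
proof -
  \<comment> \<open>Abbreviate a 4-path by its three indices. The forbidden faces x1 i x3 (i+1), x1
    i x2 (i+1) and x2 (i+1) x3 (i+2) join i,i,i+1 to i,i+1,i+1 to i,i+1,i+2 to i+1,i+1,i+2, and
    three such turns close a circle of nine. The signs make the two contributions cancel at each
    4-path on it except 0,0,1, where they add up to 2. The other sequences that match the pattern
    are faces of no 4-path.\<close>
  define f :: "vertex list \<Rightarrow> int" where "f xs = (case xs of
      [vx0, vx i a, vx j b, vx4] \<Rightarrow>
        if j = nx i then if a = 2 then if i = pv 0 then 1 else - 1 else if i = nx 0 then - 1 else 1 else 0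
    | _ \<Rightarrow> 0)" for xs
  let ?S = "regular_seqs digraph_G 3 - path_seqs digraph_G 3"
  have finS: "finite ?S"
  proof (rule finite_subset)
    show "?S \<subseteq> {xs. set xs \<subseteq> pverts digraph_G \<and> length xs = 4}" by (auto simp: regular_seqs_def)
  qed (simp add: finite_lists_length_eq)
  define m where "m = chain_on ?S f"
  have m: "m \<in> nonpaths 3" unfolding nonpaths_iff m_def by (rule keys_chain_on[OF finS])
  have lm: "lookup m xs = f xs"
    if "length xs = 4" "\<not> successively arr xs" "distinct_adj xs" "set xs \<subseteq> pverts digraph_G" for xs
  proof -
    have "xs \<in> ?S" using that by (auto simp: regular_seqs_def path_seqs_eq mem_paths)
    then show ?thesis by (simp add: m_def lookup_chain_on[OF finS])
  qed
  define n where "n = (?e + ?e) - path_coboundary digraph_G m"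
  have ln: "lookup n xs = 2 * lookup ?e xs - (if set xs \<subseteq> pverts digraph_G then del_sum (lookup m) xs else 0)" for xs
    by (simp add: n_def lookup_minus lookup_add lookup_nonpaths_coboundary[OF m])
  have path: "lookup n xs = 0" if "xs \<in> paths 4" for xs
  proof -
    have "\<forall>xs\<in>paths 4. lookup n xs = 0"
      unfolding all_paths_4
    proof
      fix i :: 3
      have "i = 0 \<or> i = nx 0 \<or> i = pv 0" using UNIV_3[of 0] by blast
      then show "lookup n [vx0, x1 i, x2 i, x3 i, vx4] = 0 \<and> lookup n [vx0, x1 i, x2 i, x3 (nx i), vx4] = 0 \<and>
          lookup n [vx0, x1 i, x2 (nx i), x3 (nx i), vx4] = 0 \<and> lookup n [vx0, x1 i, x2 (nx i), x3 (pv i), vx4] = 0"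
        by (elim disjE) (simp_all add: ln lookup_single when_def nonpaths_3_zero(1)[OF m] lm f_def)
    qed
    with that show ?thesis by blast
  qed
  have "xs \<in> regular_seqs digraph_G 4 - path_seqs digraph_G 4" if xs: "xs \<in> keys n" for xs
  proof -
    have nz: "lookup n xs \<noteq> 0" using xs by (simp add: in_keys_iff)
    have verts: "set xs \<subseteq> pverts digraph_G"
      using nz unfolding ln by (auto simp: lookup_single when_def split: if_splits)
    have len: "length xs = 5"
    proof (rule ccontr)
      assume "length xs \<noteq> 5"
      then have "lookup m (delete_at i xs) = 0" if "i < length xs" for i
        using that by (intro nonpaths_3_zero(3)[OF m]) auto
      then have "del_sum (lookup m) xs = 0" by (simp add: del_sum_eq)
      moreover have "lookup ?e xs = 0" using \<open>length xs \<noteq> 5\<close> by (auto simp: lookup_single when_def)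
      ultimately have "lookup n xs = 0" unfolding ln by presburger
      with nz show False by contradiction
    qed
    have dist: "distinct_adj xs"
    proof (rule ccontr)
      assume nd: "\<not> distinct_adj xs"
      obtain a b c d e where abc: "xs = [a, b, c, d, e]"
        using len by (auto simp: eval_nat_numeral length_Suc_conv)
      from nd have "a = b \<or> b = c \<or> c = d \<or> d = e" unfolding abc by auto
      \<comment> \<open>Deleting either of two equal neighbours gives the same list with opposite
        signs; every other deletion keeps the repetition, and \<open>m\<close> vanishes
        there.\<close>
      then have "del_sum (lookup m) xs = 0"
        unfolding abc by (elim disjE) (simp_all add: nonpaths_3_zero(2)[OF m])
      moreover have "lookup ?e xs = 0" using nd by (auto simp: lookup_single when_def)
      ultimately have "lookup n xs = 0" unfolding ln by presburger
      with nz show False by contradiction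
    qed
    have "xs \<notin> path_seqs digraph_G 4" using path[of xs] nz by (auto simp: path_seqs_eq)
    moreover have "xs \<in> regular_seqs digraph_G 4" using verts len dist by (auto simp: regular_seqs_def)
    ultimately show ?thesis by simp
  qed
  then have "n \<in> nonpaths 4" unfolding nonpaths_iff by blast
  moreover have "?e + ?e = n + path_coboundary digraph_G m" by (simp add: n_def)
  ultimately show ?thesis unfolding ideal_eq using m by auto
qed

lemma ideal_add_closed:
  assumes "x \<in> path_cochain_ideal digraph_G n" "y \<in> path_cochain_ideal digraph_G n"
  shows "x + y \<in> path_cochain_ideal digraph_G n"
proof -
  obtain c e c' e' where x: "c \<in> nonpaths n" "e \<in> nonpaths (n - 1)" "x = c + path_coboundary digraph_G e"
    and y: "c' \<in> nonpaths n" "e' \<in> nonpaths (n - 1)" "y = c' + path_coboundary digraph_G e'"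
    using assms unfolding ideal_eq by blast
  have "x + y = (c + c') + path_coboundary digraph_G (e + e')"
    by (simp add: x(3) y(3) path_coboundary_add)
  moreover have "c + c' \<in> nonpaths n" "e + e' \<in> nonpaths (n - 1)"
    using x(1,2) y(1,2) by (simp_all only: nonpaths_iff keys_add_subset)
  ultimately show ?thesis unfolding ideal_eq by blast
qed

lemma ideal_uminus_closed:
  assumes "x \<in> path_cochain_ideal digraph_G n"
  shows "- x \<in> path_cochain_ideal digraph_G n"
proof -
  obtain c e where x: "c \<in> nonpaths n" "e \<in> nonpaths (n - 1)" "x = c + path_coboundary digraph_G e"
    using assms unfolding ideal_eq by blast
  have "- x = - c + path_coboundary digraph_G (- e)"
    by (simp add: x(3) path_coboundary_eq linear_extension_uminus)
  moreover have "- c \<in> nonpaths n" "- e \<in> nonpaths (n - 1)"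
    using x(1,2) by (simp_all only: nonpaths_iff keys_uminus)
  ultimately show ?thesis unfolding ideal_eq by blast
qed

lemma path_cochain_module_2_torsion: "has_2_torsion (path_cochain_module TYPE(int) digraph_G 4)"
proof -
  let ?M = "free_module (regular_seqs digraph_G 4) :: (int, vertex list \<Rightarrow>\<^sub>0 int) module"
  let ?J = "path_cochain_ideal digraph_G 4 :: (vertex list \<Rightarrow>\<^sub>0 int) set"
  let ?e = "Poly_Mapping.single [vx0, x1 0, x2 0, x3 (nx 0), vx4] (1 :: int)"
  let ?x = "?J +>\<^bsub>?M\<^esub> ?e"
  have Q: "path_cochain_module TYPE(int) digraph_G 4 = quotient_module ?M ?J"
    by (simp add: path_cochain_module_def)
  have e: "?e \<in> carrier ?M" by (simp add: regular_seqs_def)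
  have "0 \<in> nonpaths n" for n unfolding nonpaths_iff by simp
  then have "0 + path_coboundary digraph_G 0 \<in> ?J" unfolding ideal_eq by blast
  then have J0: "0 \<in> ?J" by (simp add: path_coboundary_eq)
  have "?x \<in> carrier (quotient_module ?M ?J)" unfolding quotient_module_simps A_RCOSETS_def' using e by blast
  moreover have "?x \<noteq> ?J"
  proof
    assume "?x = ?J"
    moreover have "?e \<in> ?x" using J0 by (auto simp: a_r_coset_def' intro!: bexI[of _ 0])
    ultimately show False using path_4_not_in_ideal by simp
  qed
  moreover have "2 \<odot>\<^bsub>quotient_module ?M ?J\<^esub> ?x = ?J"
  proof (intro subset_antisym subsetI)
    fix y assume "y \<in> 2 \<odot>\<^bsub>quotient_module ?M ?J\<^esub> ?x"
    then obtain j j' where j: "j \<in> ?J" "j' \<in> ?J" "y = j + poly_scale 2 (j' + ?e)"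
      by (auto simp: set_add_def' a_r_coset_def')
    have "y = j + (j' + j') + (?e + ?e)"
      unfolding j(3) by (rule poly_mapping_eqI) (simp add: lookup_add)
    then show "y \<in> ?J" using j double_path_4_in_ideal by (simp only: ideal_add_closed)
  next
    fix y assume y: "y \<in> ?J"
    have "y = (y + - (?e + ?e)) + poly_scale 2 (0 + ?e)"
      by (rule poly_mapping_eqI) (simp add: lookup_add lookup_minus)
    moreover have "y + - (?e + ?e) \<in> ?J"
      using y double_path_4_in_ideal by (simp only: ideal_add_closed ideal_uminus_closed)
    moreover have "0 + ?e \<in> ?x" using J0 by (auto simp: a_r_coset_def' intro!: bexI[of _ 0])
    ultimately show "y \<in> 2 \<odot>\<^bsub>quotient_module ?M ?J\<^esub> ?x"
      by (simp only: quotient_module_simps free_module_simps set_add_def' UN_iff image_iff) blast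
  qed
  ultimately show ?thesis
    unfolding has_2_torsion_def Q by (intro bexI[of _ ?x]) simp_all
qed

theorem mainTheorem1:
  shows
    "(path_euler_char_defined TYPE(rat) digraph_G \<and>
      path_euler_char_defined TYPE(bit) digraph_G \<and>
      path_euler_char TYPE(rat) digraph_G \<noteq> path_euler_char TYPE(bit) digraph_G)
     \<and>
     (\<nexists>X :: 'a topology.
        graded_group_iso (path_homology TYPE(int) digraph_G) (singular_homology TYPE(int) X) \<and>
        graded_group_iso (path_homology TYPE(bit) digraph_G) (singular_homology TYPE(bit) X))
     \<and>
     (\<nexists>X :: 'a topology.
        (\<forall>n. finitely_generated_group (singular_homology TYPE(int) X n)) \<and>
        graded_iso (path_homology TYPE(rat) digraph_G) (singular_homology TYPE(rat) X) \<and>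
        graded_iso (path_homology TYPE(bit) digraph_G) (singular_homology TYPE(bit) X))
     \<and>
     (\<nexists>(C :: int \<Rightarrow> (int, 'c) module) d.
        chain_complex C d \<and>
        (\<forall>n. free_abelian (C n)) \<and>
        (\<forall>n. finitely_generated_group (homology C d n)) \<and>
        graded_iso (path_homology TYPE(rat) digraph_G)
          (homology (\<lambda>n. tensor (C n) (self_module TYPE(rat)))
                    (\<lambda>n. tensor_map (C (n - 1)) (self_module TYPE(rat)) (d n))) \<and>
        graded_iso (path_homology TYPE(bit) digraph_G)
          (homology (\<lambda>n. tensor (C n) (self_module TYPE(bit)))
                    (\<lambda>n. tensor_map (C (n - 1)) (self_module TYPE(bit)) (d n))))
     \<and>
     (\<exists>n. \<not> short_exact_sequence_exists
             (tensor (path_homology TYPE(int) digraph_G n) (additive_group TYPE(bit)))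
             (path_homology TYPE(bit) digraph_G n)
             (Tor (path_homology TYPE(int) digraph_G (n - 1)) (additive_group TYPE(bit))))
     \<and>
     has_2_torsion (path_cochain_module TYPE(int) digraph_G 4)"
proof (intro conjI)
  show "path_euler_char_defined TYPE(rat) digraph_G" "path_euler_char_defined TYPE(bit) digraph_G"
    by (simp_all add: path_euler_char_defined_def support_rat support_bit)
  show "path_euler_char TYPE(rat) digraph_G \<noteq> path_euler_char TYPE(bit) digraph_G"
    by (simp add: euler_characteristics)
  show "\<nexists>X :: 'a topology.
      graded_group_iso (path_homology TYPE(int) digraph_G) (singular_homology TYPE(int) X) \<and>
      graded_group_iso (path_homology TYPE(bit) digraph_G) (singular_homology TYPE(bit) X)"
    using no_singular_model_int_bit by blast
  show "\<nexists>X :: 'a topology.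
      (\<forall>n. finitely_generated_group (singular_homology TYPE(int) X n)) \<and>
      graded_iso (path_homology TYPE(rat) digraph_G) (singular_homology TYPE(rat) X) \<and>
      graded_iso (path_homology TYPE(bit) digraph_G) (singular_homology TYPE(bit) X)"
    unfolding singular_homology_eq
    using no_finite_type_model[OF mod_2_reduction_singular rational_extension_singular] by blast
  show "\<nexists>(C :: int \<Rightarrow> (int, 'c) module) d.
      chain_complex C d \<and>
      (\<forall>n. free_abelian (C n)) \<and>
      (\<forall>n. finitely_generated_group (homology C d n)) \<and>
      graded_iso (path_homology TYPE(rat) digraph_G)
        (homology (\<lambda>n. tensor (C n) (self_module TYPE(rat)))
                  (\<lambda>n. tensor_map (C (n - 1)) (self_module TYPE(rat)) (d n))) \<and>
      graded_iso (path_homology TYPE(bit) digraph_G)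
        (homology (\<lambda>n. tensor (C n) (self_module TYPE(bit)))
                  (\<lambda>n. tensor_map (C (n - 1)) (self_module TYPE(bit)) (d n)))"
    using no_finite_type_model[OF mod_2_reduction_tensor rational_extension_tensor] by blast
  show "\<exists>n. \<not> short_exact_sequence_exists
      (tensor (path_homology TYPE(int) digraph_G n) (additive_group TYPE(bit)))
      (path_homology TYPE(bit) digraph_G n)
      (Tor (path_homology TYPE(int) digraph_G (n - 1)) (additive_group TYPE(bit)))"
    using no_universal_coefficient_sequence by (rule exI)
  show "has_2_torsion (path_cochain_module TYPE(int) digraph_G 4)"
    by (rule path_cochain_module_2_torsion)
qed


end
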